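(* Let $k,s\ge 1$ be integers and suppose that for each system $i\in\{1,\dots,k\}$ the observation vectors (over the $s$ performance measures) are iid $s$-variate normal with mean $(y_{i1},\dots,y_{is})$ and positive definite covariance matrix $\Sigma_i$. Let the procedure $\mathcal{IZE}$ be run with integers $n_0'\ge 2$ and $n_0''\ge 0$, $n_0''\ne 1$, nominal error $\alpha\in(0,1)$, integer $c\ge 1$, constant $\nu\in(0.5,1]$, thresholds $q_\ell\in\mathbb{R}$ and tolerance levels $\epsilon_\ell>0$, $\ell=1,\dots,s$. Then, both when the systems are mutually independent (with the corresponding choice of $\beta_E$) and when they may be arbitrarily dependent (with the other choice of $\beta_E$), $$\mathbf{P}\Big\{\bigcap_{i=1}^k\bigcap_{\ell=1}^s \mathrm{CD}_{i\ell}\Big\}\ \ge\ 1-\alpha .$$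
   Context: Setting. There are $k$ systems and $s$ constraints. For each system $i$, the observation vectors $(Y'_{i1j},\dots,Y'_{isj})$, $j=1,\dots,n_0'$, and $(Y_{i1j},\dots,Y_{isj})$, $j=1,2,\dots$, are all iid, with $\ell$th component having mean $y_{i\ell}$ and variance $\sigma_{i\ell}^2$. Observations of different systems may be dependent unless systems are said to be independent. Function $g$. For positive integers $c,n$ and $\eta>0$, $$g_n(\eta)=\sum_{m=1}^c(-1)^{m+1}\Big(1-\tfrac12\mathbb{I}(m=c)\Big)\Big(1+\tfrac{2\eta(2c-m)m}{c}\Big)^{-n/2}.$$ Boundary. $R(r;v,w,z)=\max\{0,\frac{wz}{2cv}-\frac{v}{2c}r\}$. Parameters of $\mathcal{IZE}$. $\beta_E=[1-(1-\alpha)^{1/k}]/(2s)$ if the systems are independent, and $\beta_E=\alpha/(2ks)$ otherwise. Let $n=n_0'+n_0''-2$ if $n_0''\ge2$ and $n=n_0'-1$ if $n_0''=0$; $\eta_E>0$ satisfies $g_n(\eta_E)=\beta_E$ and $h_E^2=2c\eta_En$. Let $S_{i\ell}'^2$ and $S_{i\ell}''^2$ be the (unbiased) sample variances of $Y'_{i\ell1},\dots,Y'_{i\ell n_0'}$ and of $Y_{i\ell1},\dots,Y_{i\ell n_0''}$, and $$\widetilde S_{i\ell}^2=\frac{n_0'-1}{n_0'+n_0''-2}S_{i\ell}'^2+\frac{n_0''-1}{n_0'+n_0''-2}S_{i\ell}''^2\ \text{ if } n_0''\ge2,\qquad \widetilde S_{i\ell}^2=S_{i\ell}'^2\ \text{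 if } n_0''=0.$$ With $\bar Y'_{i\ell}=\frac1{n_0'}\sum_{j=1}^{n_0'}Y'_{i\ell j}$, set $\widehat\Delta_{i\ell}=\max\{\epsilon_\ell,|\bar Y'_{i\ell}-q_\ell|\}$, $\hat\xi^*_{i\ell}=\max\{2,\frac{\widehat\Delta_{i\ell}+\epsilon_\ell}{2\epsilon_\ell}\}$, $\epsilon_{i\ell}^{(1)}=\nu\hat\xi^*_{i\ell}\epsilon_\ell$ (random) and $\epsilon_{i\ell}^{(2)}=\epsilon_\ell$. Procedure for constraint $\ell$ of system $i$ considered in isolation. For each $\epsilon\in\{\epsilon_{i\ell}^{(1)},\epsilon_{i\ell}^{(2)}\}$, two subroutines monitor, for integers $r\ge\max\{n_0'',1\}$ in increasing order, the statistics $$\mathcal{F_U}:\ \sum_{j=1}^rY_{i\ell j}-r(q_\ell+\epsilon_\ell-\epsilon),\qquad \mathcal{F_D}:\ \sum_{j=1}^rY_{i\ell j}-r(q_\ell-\epsilon_\ell+\epsilon)$$ (the observations $Y'$ are not used in these sums). Each subroutine stops at the first such $r$ at which its statistic is $\le -R(r;\epsilon,h_E^2,\widetilde S_{i\ell}^2)$ (decision $1$, "feasible") or else $\ge R(r;\epsilon,h_E^2,\widetilde S_{i\ell}^2)$ (decision $-1$, "infeasible"). The procedure stops at the first $r$ at which, for some $\epsilon$, both subroutines with that $\epsilon$ have stopped with equal decisions (if both $\epsilon$ qualify at the same $r$, one is selected by a fixed deterministic tie-breaking rule), and declares system $i$ feasible for constraint $\ell$ if the common decision is $1$ and infeasible if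 it is $-1$. Correct decision. If $y_{i\ell}\le q_\ell-\epsilon_\ell$, $\mathrm{CD}_{i\ell}$ is the event that system $i$ is declared feasible for constraint $\ell$; if $y_{i\ell}\ge q_\ell+\epsilon_\ell$, it is the event that system $i$ is declared infeasible for constraint $\ell$; if $q_\ell-\epsilon_\ell<y_{i\ell}<q_\ell+\epsilon_\ell$, any decision is correct, i.e. $\mathrm{CD}_{i\ell}$ is the sure event. The events $\mathrm{CD}_{i\ell}$ are understood with each constraint $\ell$ of each system $i$ run in isolation until a decision for it is made. *)

theory Defs
  imports "HOL-Probability.Probability"
begin

definition positive_definite :: "real ^ 's ^ 's \<Rightarrow> bool" where
  "positive_definite A \<longleftrightarrow> transpose A = A \<and> (\<forall>x. x \<noteq> 0 \<longrightarrow> x \<bullet> (A *v x) > 0)"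

definition mvn_density :: "real ^ 's \<Rightarrow> real ^ 's ^ 's \<Rightarrow> real ^ 's \<Rightarrow> real" where
  "mvn_density \<mu> \<Sigma> x =
     exp (- ((x - \<mu>) \<bullet> (matrix_inv \<Sigma> *v (x - \<mu>))) / 2) / sqrt ((2 * pi) ^ CARD('s) * det \<Sigma>)"

text \<open>
  The observation vectors of system \<open>i\<close> are \<open>Y' i j\<close> with \<open>1 \<le> j \<le> n\<^sub>0'\<close> and \<open>Y i j\<close> with
  \<open>1 \<le> j\<close>. A disjoint sum of the two index ranges makes them a single family.
\<close>

definition obs_index :: "nat \<Rightarrow> (nat + nat) set" where
  "obs_index n0' = {1..n0'} <+> {1..}"

definition obs ::
  "('k \<Rightarrow> nat \<Rightarrow> 'a \<Rightarrow> real ^ 's) \<Rightarrow> ('k \<Rightarrow> nat \<Rightarrow> 'a \<Rightarrow> real ^ 's) \<Rightarrow> 'k \<Rightarrow> nat + nat \<Rightarrow> 'a \<Rightarrow> real ^ 's"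
  where "obs Y' Y i = case_sum (Y' i) (Y i)"

definition iid_mvn ::
  "'a measure \<Rightarrow> (nat + nat) set \<Rightarrow> (nat + nat \<Rightarrow> 'a \<Rightarrow> real ^ 's) \<Rightarrow> real ^ 's \<Rightarrow> real ^ 's ^ 's \<Rightarrow> bool"
  where
  "iid_mvn M J X \<mu> \<Sigma> \<longleftrightarrow>
     prob_space.indep_vars M (\<lambda>_. borel) X J \<and>
     (\<forall>p\<in>J. distributed M lborel (X p) (\<lambda>x. ennreal (mvn_density \<mu> \<Sigma> x)))"

definition systems_independent ::
  "'a measure \<Rightarrow> (nat + nat) set \<Rightarrow> ('k \<Rightarrow> nat + nat \<Rightarrow> 'a \<Rightarrow> real ^ 's) \<Rightarrow> bool" where
  "systems_independent M J X \<longleftrightarrow>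
     prob_space.indep_vars M (\<lambda>_. PiM J (\<lambda>_. borel)) (\<lambda>i \<omega>. \<lambda>p\<in>J. X i p \<omega>) UNIV"

definition g_fun :: "nat \<Rightarrow> nat \<Rightarrow> real \<Rightarrow> real" where
  "g_fun c n \<eta> =
     (\<Sum>m=1..c. (- 1) ^ (m + 1) * (1 - (if m = c then 1 else 0) / 2) *
        (1 + 2 * \<eta> * (2 * real c - real m) * real m / real c) powr (- real n / 2))"

definition boundary :: "nat \<Rightarrow> real \<Rightarrow> real \<Rightarrow> real \<Rightarrow> real \<Rightarrow> real" where
  "boundary c r v w z = max 0 (w * z / (2 * real c * v) - v / (2 * real c) * r)"

definition beta_indep :: "real \<Rightarrow> nat \<Rightarrow> nat \<Rightarrow> real" where
  "beta_indep \<alpha> k s = (1 - (1 - \<alpha>) powr (1 / real k)) / (2 * real s)"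

definition beta_dep :: "real \<Rightarrow> nat \<Rightarrow> nat \<Rightarrow> real" where
  "beta_dep \<alpha> k s = \<alpha> / (2 * real k * real s)"

definition dof :: "nat \<Rightarrow> nat \<Rightarrow> nat" where
  "dof n0' n0'' = (if n0'' \<ge> 2 then n0' + n0'' - 2 else n0' - 1)"

definition h_sq :: "nat \<Rightarrow> real \<Rightarrow> nat \<Rightarrow> real" where
  "h_sq c \<eta> n = 2 * real c * \<eta> * real n"

definition sample_mean :: "nat \<Rightarrow> (nat \<Rightarrow> real) \<Rightarrow> real" where
  "sample_mean n x = (\<Sum>j=1..n. x j) / real n"

definition sample_var :: "nat \<Rightarrow> (nat \<Rightarrow> real) \<Rightarrow> real" where
  "sample_var n x = (\<Sum>j=1..n. (x j - sample_mean n x)\<^sup>2) / (real n - 1)"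

definition pooled_var :: "nat \<Rightarrow> nat \<Rightarrow> (nat \<Rightarrow> real) \<Rightarrow> (nat \<Rightarrow> real) \<Rightarrow> real" where
  "pooled_var n0' n0'' x' x =
     (if n0'' \<ge> 2 then
        (real n0' - 1) / (real n0' + real n0'' - 2) * sample_var n0' x' +
        (real n0'' - 1) / (real n0' + real n0'' - 2) * sample_var n0'' x
      else sample_var n0' x')"

datatype phase = First | Second

definition delta_hat :: "nat \<Rightarrow> real \<Rightarrow> real \<Rightarrow> (nat \<Rightarrow> real) \<Rightarrow> real" where
  "delta_hat n0' q e x' = max e \<bar>sample_mean n0' x' - q\<bar>"

definition xi_hat :: "nat \<Rightarrow> real \<Rightarrow> real \<Rightarrow> (nat \<Rightarrow> real) \<Rightarrow> real" where
  "xi_hat n0' q e x' = max 2 ((delta_hat n0' q e x' + e) / (2 * e))"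

fun tolerance :: "nat \<Rightarrow> real \<Rightarrow> real \<Rightarrow> real \<Rightarrow> (nat \<Rightarrow> real) \<Rightarrow> phase \<Rightarrow> real" where
  "tolerance n0' \<nu> q e x' First = \<nu> * xi_hat n0' q e x' * e"
| "tolerance n0' \<nu> q e x' Second = e"

datatype decision = Feasible | Infeasible

text \<open>
  \<open>subroutine_stops r0 S R r d\<close>: monitoring the statistic \<open>S\<close> from \<open>r0\<close> on, the subroutine
  stops exactly at \<open>r\<close>, with decision \<open>d\<close>. Decisions are relations rather than functions, so that
  nothing has to be assumed about termination.
\<close>

definition subroutine_stops ::
  "nat \<Rightarrow> (nat \<Rightarrow> real) \<Rightarrow> (nat \<Rightarrow> real) \<Rightarrow> nat \<Rightarrow> decision \<Rightarrow> bool" where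
  "subroutine_stops r0 S R r d \<longleftrightarrow>
     r0 \<le> r \<and> (S r \<le> - R r \<or> S r \<ge> R r) \<and>
     (\<forall>r'. r0 \<le> r' \<and> r' < r \<longrightarrow> \<not> (S r' \<le> - R r' \<or> S r' \<ge> R r')) \<and>
     d = (if S r \<le> - R r then Feasible else Infeasible)"

text \<open>
  \<open>agree_by r0 c w z q e x v r d\<close>: by time \<open>r\<close> both subroutines with tolerance \<open>v\<close> have stopped,
  both with decision \<open>d\<close>. Here \<open>w\<close> and \<open>z\<close> are the arguments \<open>h\<^sup>2\<close> and variance estimate of the
  boundary.
\<close>

definition agree_by ::
  "nat \<Rightarrow> nat \<Rightarrow> real \<Rightarrow> real \<Rightarrow> real \<Rightarrow> real \<Rightarrow> (nat \<Rightarrow> real) \<Rightarrow> real \<Rightarrow> nat \<Rightarrow> decision \<Rightarrow> bool" where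
  "agree_by r0 c w z q e x v r d \<longleftrightarrow>
     (\<exists>rU\<le>r. subroutine_stops r0 (\<lambda>m. (\<Sum>j=1..m. x j) - real m * (q + e - v))
                (\<lambda>m. boundary c (real m) v w z) rU d) \<and>
     (\<exists>rD\<le>r. subroutine_stops r0 (\<lambda>m. (\<Sum>j=1..m. x j) - real m * (q - e + v))
                (\<lambda>m. boundary c (real m) v w z) rD d)"

text \<open>
  The deterministic tie-breaking rule \<open>tie\<close> may depend on the stopping time and on the decisions
  reached with the two tolerances.
\<close>

definition declares ::
  "nat \<Rightarrow> nat \<Rightarrow> nat \<Rightarrow> real \<Rightarrow> real \<Rightarrow> real \<Rightarrow> real \<Rightarrow> (nat \<Rightarrow> decision \<Rightarrow> decision \<Rightarrow> phase) \<Rightarrow>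
   (nat \<Rightarrow> real) \<Rightarrow> (nat \<Rightarrow> real) \<Rightarrow> decision \<Rightarrow> bool" where
  "declares n0' n0'' c \<eta> \<nu> q e tie x' x d \<longleftrightarrow>
     (let A = (\<lambda>t. agree_by (max n0'' 1) c (h_sq c \<eta> (dof n0' n0'')) (pooled_var n0' n0'' x' x)
                     q e x (tolerance n0' \<nu> q e x' t))
      in \<exists>r t. A t r d \<and>
           (\<forall>r'<r. \<forall>t' d'. \<not> A t' r' d') \<and>
           (\<forall>d1 d2. A First r d1 \<and> A Second r d2 \<longrightarrow> t = tie r d1 d2))"

definition correct_decision :: "real \<Rightarrow> real \<Rightarrow> real \<Rightarrow> (decision \<Rightarrow> bool) \<Rightarrow> bool" where
  "correct_decision y q e D \<longleftrightarrow>
     (y \<le> q - e \<longrightarrow> D Feasible) \<and> (y \<ge> q + e \<longrightarrow> D Infeasible)"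

text \<open>
  \<open>CD_event \<dots> i l\<close> is the event of a correct decision for constraint \<open>l\<close> of system \<open>i\<close>, with
  \<open>\<mu> i $ l\<close> the true mean.
\<close>

definition CD_event ::
  "'a measure \<Rightarrow> ('k \<Rightarrow> nat \<Rightarrow> 'a \<Rightarrow> real ^ 's) \<Rightarrow> ('k \<Rightarrow> nat \<Rightarrow> 'a \<Rightarrow> real ^ 's) \<Rightarrow> ('k \<Rightarrow> real ^ 's) \<Rightarrow>
   nat \<Rightarrow> nat \<Rightarrow> nat \<Rightarrow> real \<Rightarrow> real \<Rightarrow> ('s \<Rightarrow> real) \<Rightarrow> ('s \<Rightarrow> real) \<Rightarrow>
   ('k \<Rightarrow> 's \<Rightarrow> nat \<Rightarrow> decision \<Rightarrow> decision \<Rightarrow> phase) \<Rightarrow> 'k \<Rightarrow> 's \<Rightarrow> 'a set" where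
  "CD_event M Y' Y \<mu> n0' n0'' c \<eta> \<nu> q \<epsilon> tie i l =
     {\<omega> \<in> space M. correct_decision (\<mu> i $ l) (q l) (\<epsilon> l)
        (declares n0' n0'' c \<eta> \<nu> (q l) (\<epsilon> l) (tie i l) (\<lambda>j. Y' i j \<omega> $ l) (\<lambda>j. Y i j \<omega> $ l))}"

end

theory Submission
  imports Defs
begin

text \<open>
  Suppose the true mean lies on the feasible side (the other side is symmetric). A wrong decision
  with one of the two tolerances forces the subroutine \<open>F\<^sub>D\<close> with that tolerance \<open>v\<close> to leave through
  its upper boundary, and its statistic is at most a Gaussian walk with drift \<open>- v\<close>. So it suffices
  to bound, by \<open>g\<close>, the probability that such a walk leaves the triangle \<open>\<bar>x\<bar> < A - B t\<close> upwards, where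
  \<open>B = v / (2 c)\<close> and \<open>A\<close> is proportional to the variance estimate; the factor \<open>2\<close> in \<open>\<beta>\<close> pays for the
  two tolerances.

  For fixed \<open>A\<close> and unit variance, change the measure to the driftless walk \<open>W\<close> and symmetrize: the
  probability becomes half the expectation of \<open>f (T, W\<^sub>T)\<close> at the exit time \<open>T\<close>, where
  \<open>f (t, x) = exp (- v \<bar>x\<bar> - v\<^sup>2 t / 2)\<close>. The method of images gives a finite alternating
  sum \<open>u\<close> of functions \<open>exp (\<lambda> x - \<lambda>\<^sup>2 t / 2)\<close> which agrees with \<open>f\<close> on the two lines and dominates \<open>f\<close>
  outside the triangle up to the time of its apex. Since \<open>u (t, W\<^sub>t)\<close> is a martingale and
  \<open>f (t, W\<^sub>t)\<close> a supermartingale, the exit probability is at most \<open>u (0, 0) / 2\<close>, also in discrete time.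
  This is a combination of exponentials in the pooled sum of squares, which is independent of the
  partial sums from \<open>r\<^sub>0\<close> on, and its expectation is \<open>g\<close>.
\<close>

section \<open>Centred Gaussian measures\<close>

text \<open>The integer \<open>c\<close> is what makes the sum of images finite. The slope
  \<open>B\<close> of the boundary is \<open>v / (2 c)\<close>, so the rate \<open>v\<close> of
  \<open>f\<close> is \<open>2 c B\<close>. Each reflection at the two lines lowers a rate
  \<open>2 k B\<close> to \<open>2 (k - 1) B\<close>, and after \<open>c\<close> reflections a
  constant function is reached, which is its own mirror image. It is counted once instead of twice,
  whence the halved term \<open>m = c\<close> of \<open>g\<close>. The first tolerance is random and
  computed from the same first-stage sample as the variance estimate. This does no harm: whatever
  the tolerance, \<open>A v\<close> equals \<eta> times the pooled sum of squares, and
  \<open>u (0, 0)\<close> depends on \<open>A\<close> and \<open>v\<close> only through this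
  product. So the tolerance drops out before any expectation is taken.\<close>

definition gauss :: "real \<Rightarrow> real measure" where
  "gauss h = density lborel (normal_density 0 (sqrt h))"

lemma sets_gauss [simp, measurable_cong]: "sets (gauss h) = sets borel"
  by (simp add: gauss_def)

lemma space_gauss [simp]: "space (gauss h) = UNIV"
  by (simp add: gauss_def)

lemma prob_space_gauss: "0 < h \<Longrightarrow> prob_space (gauss h)"
  unfolding gauss_def by (rule prob_space_normal_density) simp

lemma integral_gauss:
  fixes g :: "real \<Rightarrow> real"
  assumes [measurable]: "g \<in> borel_measurable borel"
  shows "integral\<^sup>L (gauss h) g = (\<integral>z. normal_density 0 (sqrt h) z * g z \<partial>lborel)"
  unfolding gauss_def by (subst integral_density) auto

lemma integrable_gauss:
  fixes g :: "real \<Rightarrow> real"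
  assumes [measurable]: "g \<in> borel_measurable borel"
  shows "integrable (gauss h) g \<longleftrightarrow> integrable lborel (\<lambda>z. normal_density 0 (sqrt h) z * g z)"
  unfolding gauss_def by (subst integrable_density) auto

lemma nn_integral_gauss:
  assumes [measurable]: "g \<in> borel_measurable borel"
  shows "nn_integral (gauss h) g = (\<integral>\<^sup>+z. ennreal (normal_density 0 (sqrt h) z) * g z \<partial>lborel)"
  unfolding gauss_def by (subst nn_integral_density) auto

lemma normal_density_tilt:
  assumes "0 < h"
  shows "normal_density 0 (sqrt h) (z + h * a)
    = normal_density 0 (sqrt h) z * exp (- a * z - a\<^sup>2 * h / 2)"
proof -
  have "- (z + h * a)\<^sup>2 / (2 * h) = - z\<^sup>2 / (2 * h) + (- a * z - a\<^sup>2 * h / 2)"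
    using assms by (simp add: field_simps power2_eq_square)
  then show ?thesis
    using assms by (simp add: normal_density_def exp_add[symmetric])
qed

text \<open>One step of the change of measure: a drift \<open>- a\<close> over time \<open>h\<close>
  is traded for an exponential weight. It is a translation of Lebesgue measure.\<close>

lemma integral_gauss_tilt:
  assumes [measurable]: "g \<in> borel_measurable borel" and "0 < h"
  shows "(\<integral>z. g (z - h * a) \<partial>gauss h) = (\<integral>z. g z * exp (- a * z - a\<^sup>2 * h / 2) \<partial>gauss h)"
proof -
  have "(\<integral>z. g (z - h * a) \<partial>gauss h) = (\<integral>z. normal_density 0 (sqrt h) z * g (z - h * a) \<partial>lborel)"
    by (rule integral_gauss) simp
  also have "\<dots> = (\<integral>z. normal_density 0 (sqrt h) (z + h * a) * g z \<partial>lborel)"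
    by (subst lborel_integral_real_affine[where c=1 and t="h*a"]) (auto simp: add.commute)
  also have "\<dots> = (\<integral>z. normal_density 0 (sqrt h) z * (g z * exp (- a * z - a\<^sup>2 * h / 2)) \<partial>lborel)"
    by (intro Bochner_Integration.integral_cong refl) (simp add: normal_density_tilt[OF assms(2)])
  also have "\<dots> = (\<integral>z. g z * exp (- a * z - a\<^sup>2 * h / 2) \<partial>gauss h)"
    by (rule integral_gauss[symmetric]) simp
  finally show ?thesis .
qed

lemma has_integral_exp_gauss:
  assumes "0 < h"
  shows "has_bochner_integral (gauss h) (\<lambda>z. exp (a * z)) (exp (a\<^sup>2 * h / 2))"
proof -
  have eq: "normal_density 0 (sqrt h) z * exp (a * z)
      = exp (a\<^sup>2 * h / 2) * normal_density (h * a) (sqrt h) z" for z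
  proof -
    have "- z\<^sup>2 / (2 * h) + a * z = a\<^sup>2 * h / 2 + - (z - h * a)\<^sup>2 / (2 * h)"
      using assms by (simp add: field_simps power2_eq_square)
    then show ?thesis
      using assms by (simp add: normal_density_def exp_add[symmetric])
  qed
  have "has_bochner_integral lborel (normal_density (h * a) (sqrt h)) 1"
    using assms by (simp add: has_bochner_integral_iff)
  then have "has_bochner_integral lborel (\<lambda>z. exp (a\<^sup>2 * h / 2) * normal_density (h * a) (sqrt h) z) (exp (a\<^sup>2 * h / 2) * 1)"
    by (rule has_bochner_integral_mult_right)
  then have "has_bochner_integral lborel (\<lambda>z. normal_density 0 (sqrt h) z * exp (a * z)) (exp (a\<^sup>2 * h / 2))"
    by (simp add: eq)
  then show ?thesis
    by (simp add: has_bochner_integral_iff integrable_gauss integral_gauss)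
qed

lemma integral_gauss_minus:
  fixes g :: "real \<Rightarrow> real"
  assumes [measurable]: "g \<in> borel_measurable borel"
  shows "(\<integral>z. g (- z) \<partial>gauss h) = (\<integral>z. g z \<partial>gauss h)"
proof -
  have "(\<integral>z. g (- z) \<partial>gauss h) = (\<integral>z. normal_density 0 (sqrt h) z * g (- z) \<partial>lborel)"
    by (rule integral_gauss) simp
  also have "\<dots> = (\<integral>z. normal_density 0 (sqrt h) z * g z \<partial>lborel)"
    by (subst lborel_integral_real_affine[where c="-1" and t=0]) (auto simp: normal_density_def)
  also have "\<dots> = (\<integral>z. g z \<partial>gauss h)"
    by (rule integral_gauss[symmetric]) simp
  finally show ?thesis .
qed

lemma gauss_add:
  assumes "0 < a" "0 < b"
  shows "gauss (a + b) = distr (gauss a \<Otimes>\<^sub>M gauss b) borel (\<lambda>(x, y). x + y)"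
proof -
  interpret A: prob_space "gauss a" by (rule prob_space_gauss) fact
  interpret B: prob_space "gauss b" by (rule prob_space_gauss) fact
  have "convolution (gauss a) (gauss b) = density lborel
     (\<lambda>x. \<integral>\<^sup>+y. ennreal (normal_density 0 (sqrt a) (x - y)) * ennreal (normal_density 0 (sqrt b) y) \<partial>lborel)"
    using A.finite_measure_axioms B.finite_measure_axioms
    unfolding gauss_def by (intro convolution_density) auto
  also have "\<dots> = gauss (a + b)"
    using conv_normal_density_zero_mean[of "sqrt a" "sqrt b"] assms
    by (simp add: gauss_def ennreal_mult'')
  finally show ?thesis by (simp add: convolution_def)
qed

text \<open>\<open>gauss\<close> is indexed by variance, so that \<open>gauss h\<close> is the law
  of a Brownian increment over time \<open>h\<close>. Splitting the time \<open>a + b\<close> serves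
  to interrupt a step at the apex of the triangle.\<close>

lemma
  fixes F :: "real \<Rightarrow> real"
  assumes "0 < a" "0 < b" and [measurable]: "F \<in> borel_measurable borel"
    and int: "integrable (gauss (a + b)) F"
  shows integral_gauss_add: "(\<integral>z. F z \<partial>gauss (a + b)) = (\<integral>x. \<integral>y. F (x + y) \<partial>gauss b \<partial>gauss a)"
    and integrable_gauss_add: "integrable (gauss a) (\<lambda>x. \<integral>y. F (x + y) \<partial>gauss b)"
proof -
  interpret A: prob_space "gauss a" by (rule prob_space_gauss) fact
  interpret B: prob_space "gauss b" by (rule prob_space_gauss) fact
  interpret P: pair_sigma_finite "gauss a" "gauss b" ..
  have i: "integrable (gauss a \<Otimes>\<^sub>M gauss b) (\<lambda>(x, y). F (x + y))"
    using int unfolding gauss_add[OF assms(1,2)]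
    by (subst (asm) integrable_distr_eq) (auto simp: case_prod_beta')
  show "(\<integral>z. F z \<partial>gauss (a + b)) = (\<integral>x. \<integral>y. F (x + y) \<partial>gauss b \<partial>gauss a)"
    unfolding gauss_add[OF assms(1,2)]
    by (subst integral_distr) (use P.integral_fst'[OF i] in \<open>auto simp: case_prod_beta'\<close>)
  show "integrable (gauss a) (\<lambda>x. \<integral>y. F (x + y) \<partial>gauss b)"
    using P.integrable_fst'[OF i] by simp
qed

section \<open>Exit of a Gaussian walk from a triangle\<close>

text \<open>The sums satisfy \<open>S (m + 1) = d m - S m\<close>, so the upper bound of one sum
  gives the lower bound of the next, and conversely.\<close>

lemma alternating_sum_bounds:
  fixes d :: "nat \<Rightarrow> real"
  assumes "1 \<le> m" and "\<And>k. 0 \<le> d k" and "\<And>k. d k \<le> d (Suc k)"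
  shows "0 \<le> (\<Sum>k<m. (- 1) ^ (m - 1 - k) * d k) \<and> (\<Sum>k<m. (- 1) ^ (m - 1 - k) * d k) \<le> d (m - 1)"
  using assms(1)
proof (induction m rule: nat_induct_at_least)
  case base
  show ?case using assms by simp
next
  case (Suc m)
  have "(\<Sum>k<m. (- 1) ^ (m - k) * d k) = (\<Sum>k<m. - ((- 1) ^ (m - 1 - k) * d k))"
  proof (intro sum.cong refl)
    fix k assume "k \<in> {..<m}"
    then have "m - k = Suc (m - 1 - k)" by auto
    then show "(- 1) ^ (m - k) * d k = - ((- 1) ^ (m - 1 - k) * d k)" by simp
  qed
  then have "(\<Sum>k<Suc m. (- 1) ^ (Suc m - 1 - k) * d k) = d m - (\<Sum>k<m. (- 1) ^ (m - 1 - k) * d k)"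
    by (simp add: sum_negf)
  moreover have "d (m - 1) \<le> d m"
    using assms(3)[of "m - 1"] Suc(1) by simp
  ultimately show ?case
    using Suc(2) by simp
qed

section \<open>The method of images for a triangle\<close>

locale triangle =
  fixes c :: nat and A B :: real
  assumes c_pos: "1 \<le> c" and B_pos: "0 < B" and A_nonneg: "0 \<le> A"
begin

text \<open>With \<lambda> = 2 B k this is \<open>exp (\<lambda> x - \<lambda>^2 t / 2)\<close> up
  to a constant factor. The term \<open>k^2 A\<close> makes \<open>\<theta> k t x\<close> and
  \<open>\<theta> (Suc k) t (- x)\<close> agree on the line \<open>x = A - B t\<close>; the term
  \<open>c^2 A\<close> makes \<open>\<theta> c t (- x)\<close> the weight \<open>e\<close>.\<close>

definition \<theta> :: "nat \<Rightarrow> real \<Rightarrow> real \<Rightarrow> real" where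
  "\<theta> k t x = exp (2 * B * (real k * x + (real k)\<^sup>2 * (A - B * t) - (real c)\<^sup>2 * A))"

text \<open>On the upper line \<open>\<theta> (c - 1) t x\<close> equals \<open>e\<close>. Its
  mirror image, added for symmetry, is cancelled there by \<open>\<theta> (c - 2) t x\<close>, and
  so on down to \<open>\<theta> 0\<close>, which does not depend on \<open>x\<close>. The sum
  contains \<open>\<theta> 0\<close> twice; the last term removes one copy.\<close>

definition u :: "real \<Rightarrow> real \<Rightarrow> real" where
  "u t x = (\<Sum>k<c. (- 1) ^ (c - 1 - k) * (\<theta> k t x + \<theta> k t (- x))) - (- 1) ^ (c - 1) * \<theta> 0 t x"

text \<open>The likelihood ratio of the drift \<open>- 2 c B\<close> against no drift, at time
  \<open>t\<close> and position \<open>x\<close>.\<close>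

definition e :: "real \<Rightarrow> real \<Rightarrow> real" where
  "e t x = exp (- (2 * real c * B) * x - (2 * real c * B)\<^sup>2 * t / 2)"

definition f :: "real \<Rightarrow> real \<Rightarrow> real" where
  "f t x = e t \<bar>x\<bar>"

lemma e_pos: "0 < e t x"
  by (simp add: e_def)

lemma e_eq_\<theta>: "e t x = \<theta> c t (- x)"
  by (simp add: e_def \<theta>_def algebra_simps power2_eq_square)

lemma u_minus: "u t (- x) = u t x"
  by (simp add: u_def add.commute \<theta>_def)

text \<open>Each term is paired with its image across the upper line, so every summand vanishes for
  \<open>x = A - B t\<close>. The induction replaces \<open>c\<close> by a cutoff \<open>m\<close>,
  with \<open>\<theta> m t (- x)\<close> in the role of \<open>e\<close>.\<close>

lemma u_minus_e:
  "u t x - e t x = (\<Sum>k<c. (- 1) ^ (c - 1 - k) * (\<theta> k t x - \<theta> (Suc k) t (- x)))"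
proof -
  have "(\<Sum>k<m. (- 1) ^ (m - 1 - k) * (\<theta> k t x - \<theta> (Suc k) t (- x)))
      = (\<Sum>k<m. (- 1) ^ (m - 1 - k) * (\<theta> k t x + \<theta> k t (- x)))
        - (- 1) ^ (m - 1) * \<theta> 0 t (- x) - \<theta> m t (- x)" if "1 \<le> m" for m
    using that
  proof (induction m rule: nat_induct_at_least)
    case base
    show ?case by simp
  next
    case (Suc m)
    have flip: "(\<Sum>k<m. (- 1) ^ (m - k) * g k) = - (\<Sum>k<m. (- 1) ^ (m - 1 - k) * g k)"
      for g :: "nat \<Rightarrow> real"
      unfolding sum_negf[symmetric]
    proof (intro sum.cong refl)
      fix k assume "k \<in> {..<m}"
      then have "m - k = Suc (m - 1 - k)" by auto
      then show "(- 1) ^ (m - k) * g k = - ((- 1) ^ (m - 1 - k) * g k)" by simp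
    qed
    have "(- 1 :: real) ^ m = - ((- 1) ^ (m - 1))"
      using Suc(1) by (cases m) auto
    moreover have "(\<Sum>k<Suc m. (- 1) ^ (Suc m - 1 - k) * (\<theta> k t x - \<theta> (Suc k) t (- x)))
        = (\<theta> m t x - \<theta> (Suc m) t (- x)) - (\<Sum>k<m. (- 1) ^ (m - 1 - k) * (\<theta> k t x - \<theta> (Suc k) t (- x)))"
      using flip[of "\<lambda>k. \<theta> k t x - \<theta> (Suc k) t (- x)"] by simp
    moreover have "(\<Sum>k<Suc m. (- 1) ^ (Suc m - 1 - k) * (\<theta> k t x + \<theta> k t (- x)))
        = (\<theta> m t x + \<theta> m t (- x)) - (\<Sum>k<m. (- 1) ^ (m - 1 - k) * (\<theta> k t x + \<theta> k t (- x)))"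
      using flip[of "\<lambda>k. \<theta> k t x + \<theta> k t (- x)"] by simp
    ultimately show ?case
      using Suc(2) by simp
  qed
  from this[OF c_pos] show ?thesis
    by (simp add: u_def e_eq_\<theta> \<theta>_def)
qed

text \<open>Beyond the upper line the paired differences of \<open>u_minus_e\<close> are nonnegative
  and grow with \<open>k\<close>, and the largest one, \<open>k = c - 1\<close>, has a positive
  sign. The growth relies on \<open>0 \<le> A - B * t\<close>, that is, on a time not later than the
  apex.\<close>

lemma e_le_u:
  assumes s: "0 \<le> A - B * t" and x: "A - B * t \<le> x"
  shows "e t x \<le> u t x"
proof -
  define s where "s = A - B * t"
  define y where "y = x - s"
  define K where "K = 2 * exp (- 2 * B * (real c)\<^sup>2 * A - B * y)"
  \<comment> \<open>\<open>y\<close> is the overshoot beyond the line. Factoring the two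
    exponentials of a paired difference symmetrically leaves a \<open>sinh\<close>, and both
    remaining factors increase with \<open>k\<close>.\<close>
  define d where "d k = K * (exp (2 * B * (real k * (real k + 1)) * s) * sinh ((2 * real k + 1) * (B * y)))"
    for k :: nat
  have [simp]: "0 \<le> s" "0 \<le> y" "0 \<le> K" "0 \<le> B"
    using s x B_pos by (auto simp: s_def y_def K_def)
  have eq: "\<theta> k t x - \<theta> (Suc k) t (- x) = d k" for k
  proof -
    have "d k = exp (- 2 * B * (real c)\<^sup>2 * A - B * y) * exp (2 * B * (real k * (real k + 1)) * s)
       * (exp ((2 * real k + 1) * (B * y)) - exp (- ((2 * real k + 1) * (B * y))))"
      by (simp add: d_def K_def sinh_def)
    also have "\<dots> = exp (2 * B * (real k * (y + s) + (real k)\<^sup>2 * s - (real c)\<^sup>2 * A))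
       - exp (2 * B * (real (Suc k) * - (y + s) + (real (Suc k))\<^sup>2 * s - (real c)\<^sup>2 * A))"
      by (simp add: right_diff_distrib exp_add[symmetric] algebra_simps power2_eq_square)
    finally show ?thesis
      by (simp add: \<theta>_def s_def[symmetric] y_def)
  qed
  have "0 \<le> d k" for k
    by (simp add: d_def)
  moreover have "d k \<le> d (Suc k)" for k
    unfolding d_def
    by (intro mult_left_mono mult_mono) (auto intro!: mult_left_mono mult_right_mono mult_mono)
  ultimately have "0 \<le> (\<Sum>k<c. (- 1) ^ (c - 1 - k) * d k)"
    using alternating_sum_bounds[OF c_pos] by blast
  then show ?thesis
    using u_minus_e[of t x] by (simp add: eq)
qed

text \<open>A discrete walk overshoots the boundary, so equality of \<open>f\<close> and
  \<open>u\<close> on the two lines would not be enough.\<close>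

lemma f_le_u:
  assumes "0 \<le> A - B * t" and "A - B * t \<le> \<bar>x\<bar>"
  shows "f t x \<le> u t x"
  using e_le_u[OF assms] by (simp add: f_def abs_if u_minus split: if_splits)

lemma measurable_triangle [measurable]:
  "\<theta> k t \<in> borel_measurable borel" "u t \<in> borel_measurable borel"
  "e t \<in> borel_measurable borel" "f t \<in> borel_measurable borel"
  unfolding \<theta>_def[abs_def] u_def[abs_def] e_def[abs_def] f_def[abs_def] by measurable

section \<open>Martingale and supermartingale properties of the comparison functions\<close>

lemma has_integral_\<theta>:
  assumes "0 < h"
  shows "has_bochner_integral (gauss h) (\<lambda>z. \<theta> k (t + h) (x + z)) (\<theta> k t x)"
    and "has_bochner_integral (gauss h) (\<lambda>z. \<theta> k (t + h) (- (x + z))) (\<theta> k t (- x))"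
proof -
  define D where "D x = exp (2 * B * (real k * x + (real k)\<^sup>2 * (A - B * (t + h)) - (real c)\<^sup>2 * A))" for x
  have *: "exp ((2 * B * real k)\<^sup>2 * h / 2) * D x = \<theta> k t x" for x
    unfolding D_def \<theta>_def exp_add[symmetric] by (simp add: algebra_simps power2_eq_square)
  have "has_bochner_integral (gauss h) (\<lambda>z. exp (2 * B * real k * z) * D x) (exp ((2 * B * real k)\<^sup>2 * h / 2) * D x)"
    by (intro has_bochner_integral_mult_left has_integral_exp_gauss assms)
  then show "has_bochner_integral (gauss h) (\<lambda>z. \<theta> k (t + h) (x + z)) (\<theta> k t x)"
    unfolding * by (simp add: D_def \<theta>_def exp_add[symmetric] algebra_simps)
  have "has_bochner_integral (gauss h) (\<lambda>z. exp (- (2 * B * real k) * z) * D (- x))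
      (exp ((- (2 * B * real k))\<^sup>2 * h / 2) * D (- x))"
    by (intro has_bochner_integral_mult_left has_integral_exp_gauss assms)
  then show "has_bochner_integral (gauss h) (\<lambda>z. \<theta> k (t + h) (- (x + z))) (\<theta> k t (- x))"
    unfolding power2_minus * by (simp add: D_def \<theta>_def exp_add[symmetric] algebra_simps)
qed

lemma has_integral_u:
  assumes "0 < h"
  shows "has_bochner_integral (gauss h) (\<lambda>z. u (t + h) (x + z)) (u t x)"
  unfolding u_def
  by (intro has_bochner_integral_diff has_bochner_integral_sum has_bochner_integral_mult_right
      has_bochner_integral_add has_integral_\<theta> assms)

lemma integrable_f: "0 < h \<Longrightarrow> integrable (gauss h) (\<lambda>z. f t (x + z))"
proof -
  assume "0 < h"
  then interpret prob_space "gauss h" by (rule prob_space_gauss)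
  have "f t x \<le> f t 0" for x
    using B_pos by (simp add: f_def e_def)
  then show ?thesis
    by (intro integrable_const_bound[where B="f t 0"]) (auto simp: f_def less_imp_le[OF e_pos])
qed

text \<open>Since \<open>e\<close> decreases in \<open>x\<close>, \<open>f\<close> is the pointwise
  minimum of the martingales \<open>e t x\<close> and \<open>e t (- x)\<close>, hence a
  supermartingale.\<close>

lemma integral_f_le:
  assumes "0 < h"
  shows "(\<integral>z. f (t + h) (x + z) \<partial>gauss h) \<le> f t x"
proof -
  have 1: "has_bochner_integral (gauss h) (\<lambda>z. e (t + h) (x + z)) (e t x)" for x
    using has_integral_\<theta>(2)[OF assms, of c t x] by (simp add: e_eq_\<theta>)
  have 2: "has_bochner_integral (gauss h) (\<lambda>z. e (t + h) (- (x + z))) (e t (- x))" for x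
    using has_integral_\<theta>(1)[OF assms, of c t x] unfolding e_eq_\<theta> minus_minus .
  have "e t y \<le> e t x" if "x \<le> y" for t x y
    using that B_pos by (simp add: e_def mult_left_mono)
  then have "f t x \<le> e t x" "f t x \<le> e t (- x)" for t x
    unfolding f_def by simp_all
  then have "(\<integral>z. f (t + h) (x + z) \<partial>gauss h) \<le> (\<integral>z. e (t + h) (x + z) \<partial>gauss h)"
    "(\<integral>z. f (t + h) (x + z) \<partial>gauss h) \<le> (\<integral>z. e (t + h) (- (x + z)) \<partial>gauss h)"
    by (intro integral_mono integrable_f assms integrable.intros[OF 1] integrable.intros[OF 2]; simp only:)+
  then show ?thesis
    using 1[of x] 2[of x] by (auto simp: f_def has_bochner_integral_iff abs_if)
qed

text \<open>Dominates \<open>f\<close> wherever the walk may stop: by \<open>u\<close> up to the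
  apex time, and by \<open>f\<close> itself afterwards, when every position counts as an
  exit.\<close>

definition \<Psi> :: "real \<Rightarrow> real \<Rightarrow> real" where
  "\<Psi> t x = (if 0 \<le> A - B * t then u t x else f t x)"

lemma measurable_\<Psi> [measurable]: "\<Psi> t \<in> borel_measurable borel"
  unfolding \<Psi>_def[abs_def] by (cases "0 \<le> A - B * t") auto

lemma integrable_\<Psi>: "0 < h \<Longrightarrow> integrable (gauss h) (\<lambda>z. \<Psi> t (x + z))"
  using integrable_f[of h t x] has_integral_u[of h "t - h" x]
  by (cases "0 \<le> A - B * t") (auto simp: \<Psi>_def has_bochner_integral_iff)

text \<open>A step that jumps over the apex time \<open>A / B\<close> is split there, because beyond the apex \<open>u\<close>
  need not dominate \<open>f\<close>.\<close>
lemma integral_\<Psi>_le: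
  assumes t: "0 \<le> A - B * t" and h: "0 < h"
  shows "(\<integral>z. \<Psi> (t + h) (x + z) \<partial>gauss h) \<le> u t x"
proof (cases "0 \<le> A - B * (t + h)")
  case True
  then show ?thesis
    using has_integral_u[OF h, of t x] by (simp add: \<Psi>_def has_bochner_integral_iff)
next
  case False
  define a where "a = A / B - t"
  have apex: "A - B * (t + a) = 0"
    using B_pos by (simp add: a_def field_simps)
  have "(\<integral>z. f (t + h) (x + z) \<partial>gauss h) \<le> u t x"
  proof (cases "a = 0")
    case True
    then have "f t x \<le> u t x"
      using apex by (intro f_le_u) auto
    with integral_f_le[OF h] show ?thesis by (rule order_trans)
  next
    case a: False
    define b where "b = h - a"
    have "0 \<le> a" "0 < b"
      using t False B_pos by (auto simp: a_def b_def field_simps)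
    with a have ab: "0 < a" "0 < b" and h_eq: "h = a + b" by (auto simp: b_def)
    have int: "integrable (gauss (a + b)) (\<lambda>z. f (t + h) (x + z))"
      using h unfolding h_eq by (rule integrable_f)
    have "(\<integral>z. f (t + h) (x + z) \<partial>gauss h) = (\<integral>y. \<integral>z. f (t + h) (x + (y + z)) \<partial>gauss b \<partial>gauss a)"
      using integral_gauss_add[OF ab _ int] by (simp add: h_eq)
    also have "\<dots> \<le> (\<integral>y. f (t + a) (x + y) \<partial>gauss a)"
    proof (intro integral_mono integrable_f ab)
      show "integrable (gauss a) (\<lambda>y. \<integral>z. f (t + h) (x + (y + z)) \<partial>gauss b)"
        using integrable_gauss_add[OF ab _ int] by simp
      show "(\<integral>z. f (t + h) (x + (y + z)) \<partial>gauss b) \<le> f (t + a) (x + y)" for y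
        using integral_f_le[OF ab(2), of "t + a" "x + y"] by (simp add: h_eq add.assoc)
    qed
    \<comment> \<open>At the apex time the boundary has height \<open>0\<close>, so \<open>u\<close>
      dominates \<open>f\<close> at every position.\<close>
    also have "\<dots> \<le> (\<integral>y. u (t + a) (x + y) \<partial>gauss a)"
      using has_integral_u[OF ab(1), of t x] apex
      by (intro integral_mono integrable_f ab f_le_u) (auto simp: has_bochner_integral_iff)
    also have "\<dots> = u t x"
      using has_integral_u[OF ab(1), of t x] by (simp add: has_bochner_integral_iff)
    finally show ?thesis .
  qed
  with False show ?thesis by (simp add: \<Psi>_def)
qed

end

text \<open>The finite horizon \<open>n\<close> turns the event into a recursion over the remaining
  increments \<open>s\<close>, so that measurability and the change of measure become inductions;
  \<open>prob_up_exit_le\<close> removes the horizon. Where \<open>R\<close> vanishes the walk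
  cannot continue, because \<open>\<bar>x\<bar> < R r\<close> fails.\<close>

primrec up_exit_within ::
  "(nat \<Rightarrow> real) \<Rightarrow> real \<Rightarrow> nat \<Rightarrow> nat \<Rightarrow> real \<Rightarrow> real stream \<Rightarrow> bool" where
  "up_exit_within R v 0 r x s \<longleftrightarrow> R r \<le> x"
| "up_exit_within R v (Suc n) r x s \<longleftrightarrow>
     R r \<le> x \<or> \<bar>x\<bar> < R r \<and> up_exit_within R v n (Suc r) (x + shd s - v) (stl s)"

lemma measurable_up_exit_within [measurable (raw)]:
  assumes "\<And>r. (\<lambda>\<omega>. R \<omega> r) \<in> borel_measurable M" and "v \<in> borel_measurable M"
    and "x \<in> borel_measurable M" and "s \<in> M \<rightarrow>\<^sub>M stream_space borel"
  shows "Measurable.pred M (\<lambda>\<omega>. up_exit_within (R \<omega>) (v \<omega>) n r (x \<omega>) (s \<omega>))"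
  using assms(3,4)
proof (induction n arbitrary: r x s)
  case 0
  note [measurable] = assms(1,2) 0
  show ?case by simp
next
  case (Suc n)
  note [measurable] = assms(1,2) Suc.prems
  have [measurable]: "Measurable.pred M (\<lambda>\<omega>. up_exit_within (R \<omega>) (v \<omega>) n (Suc r) (x \<omega> + shd (s \<omega>) - v \<omega>) (stl (s \<omega>)))"
    by (rule Suc.IH) measurable
  show ?case by simp
qed

section \<open>Change of measure and symmetrization for the discrete walk\<close>

context triangle
begin

definition R :: "nat \<Rightarrow> real" where
  "R r = max 0 (A - B * real r)"

definition v :: real where "v = 2 * real c * B"

abbreviation steps :: "real stream measure" where
  "steps \<equiv> stream_space (gauss 1)"

definition P :: "nat \<Rightarrow> nat \<Rightarrow> real \<Rightarrow> real" where
  "P n r x = \<P>(s in steps. up_exit_within R v n r x s)"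

lemma measurable_P [measurable]: "P n r \<in> borel_measurable borel"
proof -
  interpret G: prob_space "gauss 1" by (rule prob_space_gauss) simp
  interpret S: prob_space steps by (rule G.prob_space_stream_space)
  have "Measurable.pred (borel \<Otimes>\<^sub>M steps) (\<lambda>(x, s). up_exit_within R v n r x s)"
    by measurable
  then have "(\<lambda>x. emeasure steps (Pair x -` {w \<in> space (borel \<Otimes>\<^sub>M steps). case w of (x, s) \<Rightarrow> up_exit_within R v n r x s}))
    \<in> borel_measurable borel"
    by (intro S.measurable_emeasure_Pair) (rule pred_def[THEN iffD1])
  then have "(\<lambda>x. enn2real (emeasure steps (Pair x -` {w \<in> space (borel \<Otimes>\<^sub>M steps). case w of (x, s) \<Rightarrow> up_exit_within R v n r x s})))
    \<in> borel_measurable borel"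
    by simp
  also have "(\<lambda>x. enn2real (emeasure steps (Pair x -` {w \<in> space (borel \<Otimes>\<^sub>M steps). case w of (x, s) \<Rightarrow> up_exit_within R v n r x s}))) = P n r"
    unfolding P_def measure_def
    by (intro ext arg_cong[where f="\<lambda>X. enn2real (emeasure steps X)"]) (auto simp: space_pair_measure)
  finally show ?thesis .
qed

lemma P_nonneg: "0 \<le> P n r x" and P_le_1: "P n r x \<le> 1"
proof -
  interpret G: prob_space "gauss 1" by (rule prob_space_gauss) simp
  interpret S: prob_space steps by (rule G.prob_space_stream_space)
  show "0 \<le> P n r x" "P n r x \<le> 1" by (auto simp: P_def)
qed

lemma P_outside: "R r \<le> \<bar>x\<bar> \<Longrightarrow> x < R r \<Longrightarrow> P n r x = 0"
proof -
  assume "R r \<le> \<bar>x\<bar>" "x < R r"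
  then have "\<not> R r \<le> x" "\<not> - x < R r" by auto
  then show ?thesis by (cases n) (auto simp: P_def)
qed

lemma P_Suc:
  assumes "\<bar>x\<bar> < R r"
  shows "P (Suc n) r x = (\<integral>z. P n (Suc r) (x + z - v) \<partial>gauss 1)"
proof -
  interpret G: prob_space "gauss 1" by (rule prob_space_gauss) simp
  interpret S: prob_space steps by (rule G.prob_space_stream_space)
  have [measurable]: "Measurable.pred steps (up_exit_within R v (Suc n) r x)" by measurable
  have "ennreal (P (Suc n) r x) = (\<integral>\<^sup>+z. ennreal (P n (Suc r) (x + z - v)) \<partial>gauss 1)"
  proof -
    have "\<not> R r \<le> x" using assms by auto
    then show ?thesis
      unfolding P_def using assms by (subst G.prob_stream_space) auto
  qed
  also have "\<dots> = ennreal (\<integral>z. P n (Suc r) (x + z - v) \<partial>gauss 1)"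
    by (intro nn_integral_eq_integral G.integrable_const_bound[where B=1])
       (auto simp: P_nonneg P_le_1)
  finally show ?thesis
    by (simp add: P_nonneg integral_nonneg_AE)
qed

lemma e_mult_exp: "e t x * exp (- v * z - v\<^sup>2 * h / 2) = e (t + h) (x + z)"
  by (simp add: e_def v_def exp_add[symmetric] algebra_simps add_divide_distrib)

lemma integrable_e_P:
  assumes "0 < h"
  shows "integrable (gauss h) (\<lambda>z. e t (x + z) * P n r (x + z))"
    and "integrable (gauss h) (\<lambda>z. e t (- (x + z)) * P n r (- (x + z)))"
proof -
  have "integrable (gauss h) (\<lambda>z. e t (x + z))"
    using has_integral_\<theta>(2)[OF assms, of c "t - h" x] by (simp add: e_eq_\<theta> has_bochner_integral_iff)
  then show "integrable (gauss h) (\<lambda>z. e t (x + z) * P n r (x + z))"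
    by (rule Bochner_Integration.integrable_bound)
       (auto simp: P_nonneg P_le_1 less_imp_le[OF e_pos] abs_mult intro!: mult_left_le)
  have "integrable (gauss h) (\<lambda>z. e t (- (x + z)))"
    using has_integral_\<theta>(1)[OF assms, of c "t - h" x]
    unfolding e_eq_\<theta> minus_minus by (simp add: has_bochner_integral_iff)
  then show "integrable (gauss h) (\<lambda>z. e t (- (x + z)) * P n r (- (x + z)))"
    by (rule Bochner_Integration.integrable_bound)
       (auto simp: P_nonneg P_le_1 less_imp_le[OF e_pos] abs_mult intro!: mult_left_le)
qed

text \<open>The weight \<open>e\<close> is multiplicative along the path by
  \<open>e_mult_exp\<close>, so carrying it along absorbs the drift: the step on the right is
  driftless.\<close>

lemma integral_P_tilt:
  assumes "0 < h"
  shows "e t x * (\<integral>z. P n r (x + z - h * v) \<partial>gauss h)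
    = (\<integral>z. e (t + h) (x + z) * P n r (x + z) \<partial>gauss h)"
proof -
  have "(\<integral>z. P n r (x + z - h * v) \<partial>gauss h) = (\<integral>z. P n r (x + (z - h * v)) \<partial>gauss h)"
    by (simp add: algebra_simps)
  also have "\<dots> = (\<integral>z. P n r (x + z) * exp (- v * z - v\<^sup>2 * h / 2) \<partial>gauss h)"
    by (rule integral_gauss_tilt[where g="\<lambda>z. P n r (x + z)"]) (use assms in auto)
  finally have "e t x * (\<integral>z. P n r (x + z - h * v) \<partial>gauss h)
    = (\<integral>z. e t x * (P n r (x + z) * exp (- v * z - v\<^sup>2 * h / 2)) \<partial>gauss h)"
    by simp
  then show ?thesis
    by (simp add: e_mult_exp[symmetric] mult_ac)
qed

text \<open>As \<open>gauss h\<close> is symmetric, the mirrored walk can be driven by the same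
  increment; both halves of the symmetrization then live on one driftless step.\<close>

lemma integral_P_tilt_minus:
  assumes "0 < h"
  shows "e t (- x) * (\<integral>z. P n r (- x + z - h * v) \<partial>gauss h)
    = (\<integral>z. e (t + h) (- (x + z)) * P n r (- (x + z)) \<partial>gauss h)"
  unfolding integral_P_tilt[OF assms]
  by (subst integral_gauss_minus[symmetric]) auto

text \<open>When the triangle is closed, the position \<open>0\<close> and its mirror image both
  count as upward exits, and the symmetrized bound may fail there. This null set has to be left
  out.\<close>

lemma AE_gauss_neq: "AE z in gauss h. x + z \<noteq> 0"
proof -
  have "AE z in lborel. z \<noteq> - x"
    by (rule AE_lborel_singleton)
  then have "AE z in lborel. x + z \<noteq> 0"
    by eventually_elim auto
  then show ?thesis
    unfolding gauss_def by (subst AE_density) auto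
qed

text \<open>Of \<open>x\<close> and \<open>- x\<close> only one lies above the triangle; the other
  has left it downwards and contributes nothing.\<close>

lemma symmetrized_P_le_outside:
  assumes "x \<noteq> 0" and "R r \<le> \<bar>x\<bar>"
  shows "e r x * P n r x + e r (- x) * P n r (- x) \<le> \<Psi> r x"
proof -
  have "e r x * P n r x + e r (- x) * P n r (- x) \<le> f r x"
  proof (cases "0 < x")
    case True
    then have "P n r (- x) = 0"
      using assms(2) by (intro P_outside) (auto simp: R_def)
    with True show ?thesis
      by (simp add: f_def P_le_1 mult_left_le less_imp_le[OF e_pos])
  next
    case False
    then have "P n r x = 0"
      using assms by (intro P_outside) (auto simp: R_def)
    with False show ?thesis
      by (simp add: f_def P_le_1 mult_left_le less_imp_le[OF e_pos])
  qed
  also have "f r x \<le> \<Psi> r x"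
    using f_le_u[of r x] assms(2) by (auto simp: \<Psi>_def R_def)
  finally show ?thesis .
qed

text \<open>Optional stopping, carried out as an induction on the horizon. The assumption on
  \<open>A\<close> says that the triangle is closed at the final time \<open>r + n\<close>, so in
  the base case no walk is still inside.\<close>

lemma symmetrized_P_le:
  assumes "x \<noteq> 0" and "A \<le> B * (real r + real n)"
  shows "e r x * P n r x + e r (- x) * P n r (- x) \<le> \<Psi> r x"
  using assms
proof (induction n arbitrary: r x)
  case (0 r x)
  then have "\<not> \<bar>x\<bar> < R r" by (simp add: R_def)
  with 0(1) show ?case by (intro symmetrized_P_le_outside) auto
next
  case (Suc n r x)
  show ?case
  proof (cases "\<bar>x\<bar> < R r")
    case True
    then have pos: "0 \<le> A - B * r" by (auto simp: R_def)
    have "e r x * P (Suc n) r x + e r (- x) * P (Suc n) r (- x)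
      = (\<integral>z. e (real r + 1) (x + z) * P n (Suc r) (x + z) \<partial>gauss 1)
        + (\<integral>z. e (real r + 1) (- (x + z)) * P n (Suc r) (- (x + z)) \<partial>gauss 1)"
      using integral_P_tilt[of 1 r x n "Suc r"] integral_P_tilt_minus[of 1 r x n "Suc r"] True
      by (simp add: P_Suc)
    also have "\<dots> = (\<integral>z. e (real r + 1) (x + z) * P n (Suc r) (x + z)
        + e (real r + 1) (- (x + z)) * P n (Suc r) (- (x + z)) \<partial>gauss 1)"
      by (intro Bochner_Integration.integral_add[symmetric] integrable_e_P) auto
    also have "\<dots> \<le> (\<integral>z. \<Psi> (real r + 1) (x + z) \<partial>gauss 1)"
    proof (intro integral_mono_AE Bochner_Integration.integrable_add integrable_e_P integrable_\<Psi>)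
      show "AE z in gauss 1. e (real r + 1) (x + z) * P n (Suc r) (x + z)
        + e (real r + 1) (- (x + z)) * P n (Suc r) (- (x + z)) \<le> \<Psi> (real r + 1) (x + z)"
        using AE_gauss_neq[of x 1]
      proof eventually_elim
        case (elim z)
        have "A \<le> B * (real (Suc r) + real n)"
          using Suc.prems(2) by (simp add: algebra_simps)
        from Suc.IH[OF elim this] show ?case
          by (simp add: add.commute)
      qed
    qed auto
    also have "\<dots> \<le> u r x"
      by (rule integral_\<Psi>_le[OF pos]) simp
    finally show ?thesis
      using pos by (simp add: \<Psi>_def)
  next
    case False
    with Suc.prems(1) show ?thesis by (intro symmetrized_P_le_outside) auto
  qed
qed

text \<open>Monitoring begins only at time \<open>r\<close>. The unmonitored stretch is a single
  step of length \<open>r\<close> from the origin, where \<open>e\<close> is \<open>1\<close>;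
  \<open>integral_\<Psi>_le\<close> applies even if this step passes the apex.\<close>

theorem up_exit_prob_le:
  assumes r: "0 < r" and n: "A \<le> B * (real r + real n)"
  shows "(\<integral>z. P n r (z - real r * v) \<partial>gauss r) \<le> u 0 0 / 2"
proof -
  let ?I = "\<integral>z. P n r (z - real r * v) \<partial>gauss r"
  have "2 * ?I = (\<integral>z. e (real r) (0 + z) * P n r (0 + z) \<partial>gauss r)
        + (\<integral>z. e (real r) (- (0 + z)) * P n r (- (0 + z)) \<partial>gauss r)"
    using integral_P_tilt[of r 0 0 n r] integral_P_tilt_minus[of r 0 0 n r] r
    by (simp add: e_def)
  also have "\<dots> = (\<integral>z. e (real r) (0 + z) * P n r (0 + z) + e (real r) (- (0 + z)) * P n r (- (0 + z)) \<partial>gauss r)"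
    using r by (intro Bochner_Integration.integral_add[symmetric] integrable_e_P) auto
  also have "\<dots> \<le> (\<integral>z. \<Psi> (0 + real r) (0 + z) \<partial>gauss r)"
  proof (intro integral_mono_AE Bochner_Integration.integrable_add integrable_e_P integrable_\<Psi>)
    show "AE z in gauss r. e (real r) (0 + z) * P n r (0 + z)
        + e (real r) (- (0 + z)) * P n r (- (0 + z)) \<le> \<Psi> (0 + real r) (0 + z)"
      using AE_gauss_neq[of 0 r]
    proof eventually_elim
      case (elim z)
      show ?case using symmetrized_P_le[OF elim n] by simp
    qed
  qed (use r in auto)
  also have "\<dots> \<le> u 0 0"
    by (rule integral_\<Psi>_le) (use A_nonneg r in auto)
  finally show ?thesis by simp
qed

text \<open>With \<open>m = c - k\<close> one has \<open>c^2 - k^2 = (2 c - m) m\<close>, and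
  \<open>2 B = v / c\<close>. The term \<open>k = 0\<close>, which \<open>u\<close> contains once
  instead of twice, becomes the halved term \<open>m = c\<close>.\<close>

lemma u_0_0:
  "u 0 0 / 2 = (\<Sum>m=1..c. (- 1) ^ (m + 1) * (1 - (if m = c then 1 else 0) / 2) *
     exp (- ((2 * real c - real m) * real m / real c) * (A * v)))"
proof -
  have "u 0 0 / 2 = (\<Sum>k<c. (- 1) ^ (c - 1 - k) * \<theta> k 0 0) - (- 1) ^ (c - 1) * \<theta> 0 0 0 / 2"
    by (simp add: u_def sum_distrib_left[symmetric] mult.left_commute[of _ 2] diff_divide_distrib flip: mult_2)
  also have "\<dots> = (\<Sum>k<c. (- 1) ^ (c - 1 - k) * (1 - (if k = 0 then 1 else 0) / 2) * \<theta> k 0 0)"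
  proof -
    have "(\<Sum>k<c. (- 1) ^ (c - 1 - k) * (1 - (if k = 0 then 1 else 0) / 2) * \<theta> k 0 0)
      = (\<Sum>k<c. (- 1) ^ (c - 1 - k) * \<theta> k 0 0 - (if k = 0 then (- 1) ^ (c - 1) * \<theta> 0 0 0 / 2 else 0))"
      by (intro sum.cong) (auto simp: field_simps)
    also have "\<dots> = (\<Sum>k<c. (- 1) ^ (c - 1 - k) * \<theta> k 0 0) - (- 1) ^ (c - 1) * \<theta> 0 0 0 / 2"
      using c_pos by (simp add: sum_subtractf)
    finally show ?thesis by simp
  qed
  also have "\<dots> = (\<Sum>m=1..c. (- 1) ^ (m + 1) * (1 - (if m = c then 1 else 0) / 2) *
     exp (- ((2 * real c - real m) * real m / real c) * (A * v)))"
  proof (rule sum.reindex_bij_witness[of _ "\<lambda>m. c - m" "\<lambda>k. c - k"])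
    fix k assume k: "k \<in> {..<c}"
    then have "c - k + 1 = (c - 1 - k) + 2" by auto
    then have 1: "(- 1 :: real) ^ (c - k + 1) = (- 1) ^ (c - 1 - k)"
      by (metis power_add power2_minus power_one mult.right_neutral)
    have 2: "\<theta> k 0 0 = exp (- ((2 * real c - real (c - k)) * real (c - k) / real c) * (A * v))"
      using k c_pos by (simp add: \<theta>_def v_def of_nat_diff field_simps power2_eq_square)
    show "(- 1) ^ (c - k + 1) * (1 - (if c - k = c then 1 else 0) / 2) *
       exp (- ((2 * real c - real (c - k)) * real (c - k) / real c) * (A * v))
      = (- 1) ^ (c - 1 - k) * (1 - (if k = 0 then 1 else 0) / 2) * \<theta> k 0 0"
      using k unfolding 1 2 by auto
  qed auto
  finally show ?thesis .
qed

end

section \<open>Sums of squared deviations of Gaussian samples\<close>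

definition sum_sq_dev :: "nat \<Rightarrow> (nat \<Rightarrow> real) \<Rightarrow> real" where
  "sum_sq_dev n x = (\<Sum>j=1..n. (x j - sample_mean n x)\<^sup>2)"

lemma sum_sq_dev_nonneg: "0 \<le> sum_sq_dev n x"
  by (simp add: sum_sq_dev_def sum_nonneg)

lemma sum_sq_dev_1 [simp]: "sum_sq_dev (Suc 0) x = 0"
  by (simp add: sum_sq_dev_def sample_mean_def)

lemma sum_sq_dev_cong: "(\<And>j. j \<in> {1..n} \<Longrightarrow> x j = y j) \<Longrightarrow> sum_sq_dev n x = sum_sq_dev n y"
  by (simp add: sum_sq_dev_def sample_mean_def)

lemma sum_sq_dev_eq:
  assumes "1 \<le> n"
  shows "sum_sq_dev n x = (\<Sum>j=1..n. (x j)\<^sup>2) - (\<Sum>j=1..n. x j)\<^sup>2 / n"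
proof -
  define m where "m = sample_mean n x"
  have m: "(\<Sum>j=1..n. x j) = n * m"
    using assms by (simp add: m_def sample_mean_def)
  have "sum_sq_dev n x = (\<Sum>j=1..n. (x j)\<^sup>2 + m\<^sup>2 - 2 * m * x j)"
    unfolding sum_sq_dev_def m_def[symmetric] by (simp add: power2_diff mult_ac)
  also have "\<dots> = (\<Sum>j=1..n. (x j)\<^sup>2) + n * m\<^sup>2 - 2 * m * (n * m)"
    by (simp only: sum_subtractf sum.distrib sum_distrib_left[symmetric] m) simp
  also have "\<dots> = (\<Sum>j=1..n. (x j)\<^sup>2) - (\<Sum>j=1..n. x j)\<^sup>2 / n"
    unfolding m using assms by (simp add: power2_eq_square)
  finally show ?thesis .
qed

text \<open>The new observation enters only through its distance from the mean of the earlier ones,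
  which is the first coordinate of the rotation in \<open>nn_integral_gauss_rotate\<close>.\<close>

lemma sum_sq_dev_Suc:
  assumes "1 \<le> n"
  shows "sum_sq_dev (Suc n) x
    = sum_sq_dev n x + real n / (real n + 1) * (x (Suc n) - (\<Sum>j=1..n. x j) / n)\<^sup>2"
proof -
  have alg: "(S2 + y\<^sup>2) - (S + y)\<^sup>2 / (1 + m) = (S2 - S\<^sup>2 / m) + m / (m + 1) * (y - S / m)\<^sup>2"
    if "0 < m" for S2 S y m :: real
  proof -
    define a where "a = S / m"
    have S: "S = m * a" using that by (simp add: a_def)
    have "(1 + m) * y\<^sup>2 - (m * a + y)\<^sup>2 = (1 + m) * (- (m * a\<^sup>2)) + m * (y - a)\<^sup>2"
      by (simp add: power2_eq_square algebra_simps)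
    then have "((1 + m) * y\<^sup>2 - (m * a + y)\<^sup>2) / (1 + m) = ((1 + m) * (- (m * a\<^sup>2)) + m * (y - a)\<^sup>2) / (1 + m)"
      by simp
    then show ?thesis
      using that by (simp add: S diff_divide_distrib add_divide_distrib power_mult_distrib
          power2_eq_square[of m] add.commute[of m])
  qed
  show ?thesis
    using assms alg[of n "\<Sum>j=1..n. (x j)\<^sup>2" "x (Suc n)" "\<Sum>j=1..n. x j"]
    by (simp add: sum_sq_dev_eq)
qed

text \<open>The Laplace transform of a scaled chi-square variable with one degree of freedom. The
  weight merely changes the variance from \<open>h\<close> to \<open>h / k\<close>.\<close>

lemma integral_exp_square_gauss:
  assumes h: "0 < h" and a: "0 \<le> a"
  shows "(\<integral>\<^sup>+z. ennreal (exp (- a * z\<^sup>2)) \<partial>gauss h) = ennreal ((1 + 2 * a * h) powr (- 1 / 2))"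
proof -
  define k where "k = 1 + 2 * a * h"
  have k: "0 < k" using h a by (simp add: k_def add_pos_nonneg)
  have eq: "normal_density 0 (sqrt h) z * exp (- a * z\<^sup>2)
      = k powr (- 1 / 2) * normal_density 0 (sqrt (h / k)) z" for z
  proof -
    have ex: "- z\<^sup>2 / (2 * h) + - a * z\<^sup>2 = - z\<^sup>2 / (2 * (h / k))"
      using h by (simp add: k_def field_simps)
    have const: "1 / sqrt (2 * pi * h) = k powr (- 1 / 2) * (1 / sqrt (2 * pi * (h / k)))"
      using h k by (simp add: powr_minus powr_half_sqrt real_sqrt_mult real_sqrt_divide field_simps)
    have "normal_density 0 (sqrt h) z * exp (- a * z\<^sup>2)
        = 1 / sqrt (2 * pi * h) * exp (- z\<^sup>2 / (2 * h) + - a * z\<^sup>2)"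
      unfolding exp_add using h by (simp add: normal_density_def)
    also have "\<dots> = k powr (- 1 / 2) * normal_density 0 (sqrt (h / k)) z"
      unfolding ex const using h k by (simp add: normal_density_def)
    finally show ?thesis .
  qed
  have "(\<integral>\<^sup>+z. ennreal (exp (- a * z\<^sup>2)) \<partial>gauss h)
      = (\<integral>\<^sup>+z. ennreal (k powr (- 1 / 2)) * ennreal (normal_density 0 (sqrt (h / k)) z) \<partial>lborel)"
    by (subst nn_integral_gauss)
       (simp, simp only: eq ennreal_mult''[symmetric] exp_ge_zero normal_density_nonneg)
  also have "\<dots> = ennreal (k powr (- 1 / 2)) * (\<integral>\<^sup>+z. ennreal (normal_density 0 (sqrt (h / k)) z) \<partial>lborel)"
    by (rule nn_integral_cmult) simp
  also have "(\<integral>\<^sup>+z. ennreal (normal_density 0 (sqrt (h / k)) z) \<partial>lborel) = 1"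
    using h k by (subst nn_integral_eq_integral) auto
  finally show ?thesis by (simp add: k_def)
qed

text \<open>The map \<open>(s, x) \<mapsto> (x - s / n, s + x)\<close> is a rotation of independent Gaussians, up to scaling.\<close>
lemma nn_integral_gauss_rotate:
  fixes H :: "real \<Rightarrow> real \<Rightarrow> ennreal"
  assumes [measurable]: "case_prod H \<in> borel_measurable (borel \<Otimes>\<^sub>M borel)" and n: "0 < n"
  shows "(\<integral>\<^sup>+s. \<integral>\<^sup>+x. H (x - s / n) (s + x) \<partial>gauss 1 \<partial>gauss n)
    = (\<integral>\<^sup>+s. \<integral>\<^sup>+d. H d s \<partial>gauss ((n + 1) / n) \<partial>gauss (n + 1))"
proof -
  let ?\<phi> = "\<lambda>h z. ennreal (normal_density 0 (sqrt h) z)"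
  \<comment> \<open>The substitution is \<open>x = S - s\<close> followed by
    \<open>s = n (S - d) / (n + 1)\<close>, the solution of \<open>d = x - s / n\<close>; the factor
    \<open>n / (n + 1)\<close> is its Jacobian.\<close>
  have eq: "ennreal (n / (n + 1)) * (?\<phi> n (n * S / (n + 1) + - n / (n + 1) * d)
      * ?\<phi> 1 (S - (n * S / (n + 1) + - n / (n + 1) * d)))
      = ?\<phi> (n + 1) S * ?\<phi> ((n + 1) / n) d" for S d
  proof -
    have "- (n * S / (n + 1) + - n / (n + 1) * d)\<^sup>2 / (2 * n)
        + - (S - (n * S / (n + 1) + - n / (n + 1) * d))\<^sup>2 / 2
        = - (n * (S - d)\<^sup>2 + (S + n * d)\<^sup>2) / (2 * (n + 1)\<^sup>2)"
    proof -
      have 1: "n * S / (n + 1) + - n / (n + 1) * d = n * (S - d) / (n + 1)"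
        by (simp add: diff_divide_distrib right_diff_distrib)
      have 2: "S - n * (S - d) / (n + 1) = (S + n * d) / (n + 1)"
        using n by (simp add: divide_simps) (simp add: algebra_simps)
      show ?thesis
        unfolding 1 2 using n
        by (simp add: power_divide power_mult_distrib power2_eq_square[of n] diff_divide_distrib)
    qed
    also have "n * (S - d)\<^sup>2 + (S + n * d)\<^sup>2 = (n + 1) * (S\<^sup>2 + n * d\<^sup>2)"
      by (simp add: power2_eq_square algebra_simps)
    also have "- ((n + 1) * (S\<^sup>2 + n * d\<^sup>2)) / (2 * (n + 1)\<^sup>2) = - S\<^sup>2 / (2 * (n + 1)) + - d\<^sup>2 / (2 * ((n + 1) / n))"
    proof -
      have "d\<^sup>2 / (2 * ((n + 1) / n)) = n * d\<^sup>2 / (2 * (n + 1))"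
        using n by (simp add: field_simps)
      then show ?thesis
        using n by (simp add: power2_eq_square[of "n + 1"] add_divide_distrib diff_divide_distrib)
    qed
    finally have ex: "exp (- (n * S / (n + 1) + - n / (n + 1) * d)\<^sup>2 / (2 * n))
        * exp (- (S - (n * S / (n + 1) + - n / (n + 1) * d))\<^sup>2 / 2)
        = exp (- S\<^sup>2 / (2 * (n + 1))) * exp (- d\<^sup>2 / (2 * ((n + 1) / n)))"
      unfolding exp_add[symmetric] by (rule arg_cong)
    have const: "n / (n + 1) * (1 / sqrt (2 * pi * n) * (1 / sqrt (2 * pi)))
        = 1 / sqrt (2 * pi * (n + 1)) * (1 / sqrt (2 * pi * ((n + 1) / n)))"
    proof -
      have "sqrt (2 * pi * n) * sqrt (2 * pi) = sqrt ((2 * pi)\<^sup>2 * n)"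
        by (simp add: real_sqrt_mult[symmetric] power2_eq_square mult_ac)
      then have 1: "sqrt (2 * pi * n) * sqrt (2 * pi) = 2 * pi * sqrt n"
        by (simp add: real_sqrt_mult)
      have "sqrt (2 * pi * (n + 1)) * sqrt (2 * pi * ((n + 1) / n)) = sqrt ((2 * pi * (n + 1))\<^sup>2 / n)"
        by (simp add: real_sqrt_mult[symmetric] power2_eq_square mult_ac)
      then have 2: "sqrt (2 * pi * (n + 1)) * sqrt (2 * pi * ((n + 1) / n)) = 2 * pi * (n + 1) / sqrt n"
        using n by (simp add: real_sqrt_divide)
      have "n / (n + 1) * (1 / (2 * pi * sqrt n)) = (n / sqrt n) / (2 * pi * (n + 1))"
        by simp
      also have "\<dots> = 1 / (2 * pi * (n + 1) / sqrt n)"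
        using n by (simp add: real_div_sqrt)
      finally show ?thesis
        by (simp only: times_divide_times_eq 1 2 mult_1)
    qed
    have "n / (n + 1) * (normal_density 0 (sqrt n) (n * S / (n + 1) + - n / (n + 1) * d)
      * normal_density 0 (sqrt 1) (S - (n * S / (n + 1) + - n / (n + 1) * d)))
      = (n / (n + 1) * (1 / sqrt (2 * pi * n) * (1 / sqrt (2 * pi)))) *
        (exp (- (n * S / (n + 1) + - n / (n + 1) * d)\<^sup>2 / (2 * n))
        * exp (- (S - (n * S / (n + 1) + - n / (n + 1) * d))\<^sup>2 / 2))"
      using n by (simp add: normal_density_def)
    also have "\<dots> = normal_density 0 (sqrt (n + 1)) S * normal_density 0 (sqrt ((n + 1) / n)) d"
      unfolding ex const using n by (simp add: normal_density_def)
    finally show ?thesis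
      using n by (simp flip: ennreal_mult'')
  qed
  have "(\<integral>\<^sup>+s. \<integral>\<^sup>+x. H (x - s / n) (s + x) \<partial>gauss 1 \<partial>gauss n)
      = (\<integral>\<^sup>+s. \<integral>\<^sup>+x. ?\<phi> n s * (?\<phi> 1 x * H (x - s / n) (s + x)) \<partial>lborel \<partial>lborel)"
    by (simp add: nn_integral_gauss nn_integral_cmult)
  also have "\<dots> = (\<integral>\<^sup>+s. \<integral>\<^sup>+S. ?\<phi> n s * (?\<phi> 1 (S - s) * H (S - s - s / n) S) \<partial>lborel \<partial>lborel)"
  proof (rule nn_integral_cong)
    fix s
    show "(\<integral>\<^sup>+x. ?\<phi> n s * (?\<phi> 1 x * H (x - s / n) (s + x)) \<partial>lborel)
      = (\<integral>\<^sup>+S. ?\<phi> n s * (?\<phi> 1 (S - s) * H (S - s - s / n) S) \<partial>lborel)"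
      by (subst nn_integral_real_affine[where c=1 and t="- s"]) auto
  qed
  also have "\<dots> = (\<integral>\<^sup>+S. \<integral>\<^sup>+s. ?\<phi> n s * (?\<phi> 1 (S - s) * H (S - s - s / n) S) \<partial>lborel \<partial>lborel)"
    by (rule lborel_pair.Fubini') simp
  also have "\<dots> = (\<integral>\<^sup>+S. \<integral>\<^sup>+d. ?\<phi> (n + 1) S * (?\<phi> ((n + 1) / n) d * H d S) \<partial>lborel \<partial>lborel)"
  proof (rule nn_integral_cong)
    fix S
    let ?s = "\<lambda>d. n * S / (n + 1) + - n / (n + 1) * d"
    have d: "S - ?s d - ?s d / n = d" for d
    proof -
      define k where "k = (S - d) / (n + 1)"
      have "?s d = n * k"
        by (simp add: k_def diff_divide_distrib right_diff_distrib)
      then have "?s d + ?s d / n = (n + 1) * k"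
        using n by (simp add: algebra_simps)
      also have "\<dots> = S - d"
        using n by (simp add: k_def)
      finally show ?thesis by linarith
    qed
    have abs: "\<bar>- n / (n + 1)\<bar> = n / (n + 1)"
      using n by simp
    have "(\<integral>\<^sup>+s. ?\<phi> n s * (?\<phi> 1 (S - s) * H (S - s - s / n) S) \<partial>lborel)
      = ennreal \<bar>- n / (n + 1)\<bar> * (\<integral>\<^sup>+d. ?\<phi> n (?s d) * (?\<phi> 1 (S - ?s d) * H (S - ?s d - ?s d / n) S) \<partial>lborel)"
      by (rule nn_integral_real_affine) (use n in auto)
    also have "\<dots> = (\<integral>\<^sup>+d. (ennreal (n / (n + 1)) * (?\<phi> n (?s d) * ?\<phi> 1 (S - ?s d))) * H d S \<partial>lborel)"
      unfolding d abs by (subst nn_integral_cmult[symmetric]) (auto simp: mult.assoc)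
    finally show "(\<integral>\<^sup>+s. ?\<phi> n s * (?\<phi> 1 (S - s) * H (S - s - s / n) S) \<partial>lborel)
      = (\<integral>\<^sup>+d. ?\<phi> (n + 1) S * (?\<phi> ((n + 1) / n) d * H d S) \<partial>lborel)"
      unfolding eq by (simp add: mult.assoc)
  qed
  also have "\<dots> = (\<integral>\<^sup>+s. \<integral>\<^sup>+d. H d s \<partial>gauss ((n + 1) / n) \<partial>gauss (n + 1))"
    by (simp add: nn_integral_gauss nn_integral_cmult)
  finally show ?thesis .
qed

text \<open>Independence as decoupling: the second block may be read at a separate sample point.
  Writing the law of a block as an integral over \<open>M\<close> avoids naming that law.\<close>

lemma (in prob_space) nn_integral_indep_blocks:
  assumes ind: "indep_vars M' X I" and AB: "A \<inter> B = {}" "A \<subseteq> I" "B \<subseteq> I"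
    and f [measurable]: "f \<in> PiM A M' \<rightarrow>\<^sub>M N1" and g [measurable]: "g \<in> PiM B M' \<rightarrow>\<^sub>M N2"
    and G [measurable]: "G \<in> borel_measurable (N1 \<Otimes>\<^sub>M N2)"
  shows "(\<integral>\<^sup>+\<omega>. G (f (\<lambda>i\<in>A. X i \<omega>), g (\<lambda>i\<in>B. X i \<omega>)) \<partial>M)
    = (\<integral>\<^sup>+\<omega>. \<integral>\<^sup>+\<omega>'. G (f (\<lambda>i\<in>A. X i \<omega>), g (\<lambda>i\<in>B. X i \<omega>')) \<partial>M \<partial>M)"
proof -
  let ?A = "\<lambda>\<omega>. \<lambda>i\<in>A. X i \<omega>" and ?B = "\<lambda>\<omega>. \<lambda>i\<in>B. X i \<omega>"
  have iv: "indep_var (PiM A M') ?A (PiM B M') ?B"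
    by (rule indep_var_restrict[OF ind AB])
  then have [measurable]: "?A \<in> M \<rightarrow>\<^sub>M PiM A M'" "?B \<in> M \<rightarrow>\<^sub>M PiM B M'"
    by (auto simp: indep_var_distribution_eq)
  interpret B: prob_space "distr M (PiM B M') ?B" by (rule prob_space_distr) simp
  have "(\<integral>\<^sup>+\<omega>. G (f (?A \<omega>), g (?B \<omega>)) \<partial>M)
    = (\<integral>\<^sup>+w. G (f (fst w), g (snd w)) \<partial>distr M (PiM A M' \<Otimes>\<^sub>M PiM B M') (\<lambda>\<omega>. (?A \<omega>, ?B \<omega>)))"
    by (simp add: nn_integral_distr)
  also have "\<dots> = (\<integral>\<^sup>+w. G (f (fst w), g (snd w)) \<partial>(distr M (PiM A M') ?A \<Otimes>\<^sub>M distr M (PiM B M') ?B))"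
    using iv by (simp add: indep_var_distribution_eq)
  also have "\<dots> = (\<integral>\<^sup>+x. \<integral>\<^sup>+y. G (f x, g y) \<partial>distr M (PiM B M') ?B \<partial>distr M (PiM A M') ?A)"
    by (subst B.nn_integral_fst[symmetric]) auto
  also have "\<dots> = (\<integral>\<^sup>+\<omega>. \<integral>\<^sup>+y. G (f (?A \<omega>), g y) \<partial>distr M (PiM B M') ?B \<partial>M)"
    by (subst nn_integral_distr) auto
  also have "\<dots> = (\<integral>\<^sup>+\<omega>. \<integral>\<^sup>+\<omega>'. G (f (?A \<omega>), g (?B \<omega>')) \<partial>M \<partial>M)"
  proof (rule nn_integral_cong)
    fix \<omega> assume "\<omega> \<in> space M"
    then have [simp]: "f (?A \<omega>) \<in> space N1"
      by (intro measurable_space[OF f] measurable_space[of ?A M]) simp_all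
    show "(\<integral>\<^sup>+y. G (f (?A \<omega>), g y) \<partial>distr M (PiM B M') ?B) = (\<integral>\<^sup>+\<omega>'. G (f (?A \<omega>), g (?B \<omega>')) \<partial>M)"
      by (rule nn_integral_distr) simp_all
  qed
  finally show ?thesis .
qed

lemma (in prob_space) random_variable_sum_sq_dev:
  assumes "\<And>j. j \<in> {1..n} \<Longrightarrow> random_variable borel (X j)"
  shows "random_variable borel (\<lambda>\<omega>. sum_sq_dev n (\<lambda>j. X j \<omega>))"
proof -
  have [measurable]: "random_variable borel (\<lambda>\<omega>. \<Sum>j=1..n. X j \<omega>)"
    using assms by (intro borel_measurable_sum) auto
  show ?thesis
    unfolding sum_sq_dev_def sample_mean_def
    using assms by (intro borel_measurable_sum borel_measurable_power borel_measurable_diff) auto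
qed

lemma measurable_sum_sq_dev_PiM [measurable]:
  "sum_sq_dev n \<in> borel_measurable (PiM {1..n} (\<lambda>_. borel))"
proof -
  have "(\<lambda>w::nat \<Rightarrow> real. \<Sum>j=1..n. w j) \<in> borel_measurable (PiM {1..n} (\<lambda>_. borel))"
    by (intro borel_measurable_sum measurable_component_singleton)
  then show ?thesis
    unfolding sum_sq_dev_def[abs_def] sample_mean_def
    by (intro borel_measurable_sum borel_measurable_power borel_measurable_diff
        measurable_component_singleton) auto
qed

text \<open>Independence gives the new observation an integral of its own, \<open>IH\<close> does
  the same for the old sum, and the rotation turns these two variables into the new sum and the new
  deviation.\<close>

lemma (in prob_space) sum_sq_dev_step:
  fixes F :: "real \<times> real \<Rightarrow> ennreal"
  assumes n: "1 \<le> n"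
    and ind: "indep_vars (\<lambda>_. borel) X {1..Suc n}"
    and dist: "distr M borel (X (Suc n)) = gauss 1"
    and IH: "\<And>F. F \<in> borel_measurable (borel \<Otimes>\<^sub>M borel) \<Longrightarrow>
      (\<integral>\<^sup>+\<omega>. F (sum_sq_dev n (\<lambda>j. X j \<omega>), \<Sum>j=1..n. X j \<omega>) \<partial>M)
      = (\<integral>\<^sup>+\<omega>. \<integral>\<^sup>+s. F (sum_sq_dev n (\<lambda>j. X j \<omega>), s) \<partial>gauss n \<partial>M)"
    and F: "F \<in> borel_measurable (borel \<Otimes>\<^sub>M borel)"
  shows "(\<integral>\<^sup>+\<omega>. F (sum_sq_dev (Suc n) (\<lambda>j. X j \<omega>), \<Sum>j=1..Suc n. X j \<omega>) \<partial>M)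
    = (\<integral>\<^sup>+\<omega>. \<integral>\<^sup>+s. \<integral>\<^sup>+d. F (sum_sq_dev n (\<lambda>j. X j \<omega>) + real n / (real n + 1) * d\<^sup>2, s)
        \<partial>gauss ((real n + 1) / n) \<partial>gauss (real n + 1) \<partial>M)"
proof -
  note [measurable] = F
  interpret G: prob_space "gauss 1" by (rule prob_space_gauss) simp
  let ?Q = "\<lambda>\<omega>. sum_sq_dev n (\<lambda>j. X j \<omega>)"
  define G where "G w = F (fst (fst w) + real n / (real n + 1) * (snd w - snd (fst w) / n)\<^sup>2, snd (fst w) + snd w)" for w
  have [measurable]: "G \<in> borel_measurable ((borel \<Otimes>\<^sub>M borel) \<Otimes>\<^sub>M borel)"
    unfolding G_def[abs_def] by measurable
  have "(\<integral>\<^sup>+\<omega>. F (sum_sq_dev (Suc n) (\<lambda>j. X j \<omega>), \<Sum>j=1..Suc n. X j \<omega>) \<partial>M)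
    = (\<integral>\<^sup>+\<omega>. G ((?Q \<omega>, \<Sum>j=1..n. X j \<omega>), X (Suc n) \<omega>) \<partial>M)"
    using n by (simp add: G_def sum_sq_dev_Suc)
  also have "\<dots> = (\<integral>\<^sup>+\<omega>. \<integral>\<^sup>+x. G ((?Q \<omega>, \<Sum>j=1..n. X j \<omega>), x) \<partial>gauss 1 \<partial>M)"
  proof -
    have [measurable]: "random_variable borel (X (Suc n))"
      using ind by (auto simp: indep_vars_def)
    have "(\<integral>\<^sup>+\<omega>. G ((?Q \<omega>, \<Sum>j=1..n. X j \<omega>), X (Suc n) \<omega>) \<partial>M)
      = (\<integral>\<^sup>+\<omega>. \<integral>\<^sup>+\<omega>'. G ((?Q \<omega>, \<Sum>j=1..n. X j \<omega>), X (Suc n) \<omega>') \<partial>M \<partial>M)"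
    proof -
      have Q: "sum_sq_dev n (\<lambda>i\<in>{1..n}. X i \<omega>) = ?Q \<omega>" for \<omega>
        by (rule sum_sq_dev_cong) simp
      have T: "(\<Sum>j=1..n. (\<lambda>i\<in>{1..n}. X i \<omega>) j) = (\<Sum>j=1..n. X j \<omega>)" for \<omega>
        by (rule sum.cong) auto
      show ?thesis
      using nn_integral_indep_blocks[OF ind, of "{1..n}" "{Suc n}" "\<lambda>w. (sum_sq_dev n w, \<Sum>j=1..n. w j)"
          "borel \<Otimes>\<^sub>M borel" "\<lambda>w. w (Suc n)" borel G]
        by (simp add: Q T del: One_nat_def)
    qed
    also have "\<dots> = (\<integral>\<^sup>+\<omega>. \<integral>\<^sup>+x. G ((?Q \<omega>, \<Sum>j=1..n. X j \<omega>), x) \<partial>gauss 1 \<partial>M)"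
      unfolding dist[symmetric] by (simp add: nn_integral_distr)
    finally show ?thesis .
  qed
  also have "\<dots> = (\<integral>\<^sup>+\<omega>. \<integral>\<^sup>+s. \<integral>\<^sup>+x. G ((?Q \<omega>, s), x) \<partial>gauss 1 \<partial>gauss n \<partial>M)"
    using IH[of "\<lambda>w. \<integral>\<^sup>+x. G (w, x) \<partial>gauss 1"] by simp
  also have "\<dots> = (\<integral>\<^sup>+\<omega>. \<integral>\<^sup>+s. \<integral>\<^sup>+d. F (?Q \<omega> + real n / (real n + 1) * d\<^sup>2, s)
        \<partial>gauss ((real n + 1) / n) \<partial>gauss (real n + 1) \<partial>M)"
  proof (rule nn_integral_cong)
    fix \<omega>
    show "(\<integral>\<^sup>+s. \<integral>\<^sup>+x. G ((?Q \<omega>, s), x) \<partial>gauss 1 \<partial>gauss n)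
      = (\<integral>\<^sup>+s. \<integral>\<^sup>+d. F (?Q \<omega> + real n / (real n + 1) * d\<^sup>2, s)
        \<partial>gauss ((real n + 1) / n) \<partial>gauss (real n + 1))"
      using nn_integral_gauss_rotate[of "\<lambda>d s. F (?Q \<omega> + real n / (real n + 1) * d\<^sup>2, s)" n] n
      by (simp add: G_def)
  qed
  finally show ?thesis .
qed

text \<open>The first claim is the independence of the sum of squares and the sum, in integral form;
  the second is the Laplace transform of a chi-square variable with \<open>n - 1\<close> degrees of
  freedom. Each new observation adds a deviation that is independent of the new sum and contributes
  one degree of freedom.\<close>

lemma (in prob_space)
  assumes "1 \<le> n"
    and ind: "indep_vars (\<lambda>_. borel) X {1..n}"
    and dist: "\<And>j. j \<in> {1..n} \<Longrightarrow> distr M borel (X j) = gauss 1"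
  shows nn_integral_sum_sq_dev_sum: "\<And>F. F \<in> borel_measurable (borel \<Otimes>\<^sub>M borel) \<Longrightarrow>
      (\<integral>\<^sup>+\<omega>. F (sum_sq_dev n (\<lambda>j. X j \<omega>), \<Sum>j=1..n. X j \<omega>) \<partial>M)
      = (\<integral>\<^sup>+\<omega>. \<integral>\<^sup>+s. F (sum_sq_dev n (\<lambda>j. X j \<omega>), s) \<partial>gauss n \<partial>M)"
    and nn_integral_exp_sum_sq_dev: "\<And>t. 0 \<le> t \<Longrightarrow>
      (\<integral>\<^sup>+\<omega>. ennreal (exp (- t * sum_sq_dev n (\<lambda>j. X j \<omega>))) \<partial>M)
      = ennreal ((1 + 2 * t) powr (- (real n - 1) / 2))"
proof -
  have "(\<forall>F \<in> borel_measurable (borel \<Otimes>\<^sub>M borel).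
      (\<integral>\<^sup>+\<omega>. F (sum_sq_dev n (\<lambda>j. X j \<omega>), \<Sum>j=1..n. X j \<omega>) \<partial>M)
      = (\<integral>\<^sup>+\<omega>. \<integral>\<^sup>+s. F (sum_sq_dev n (\<lambda>j. X j \<omega>), s) \<partial>gauss n \<partial>M)) \<and>
    (\<forall>t\<ge>0. (\<integral>\<^sup>+\<omega>. ennreal (exp (- t * sum_sq_dev n (\<lambda>j. X j \<omega>))) \<partial>M)
      = ennreal ((1 + 2 * t) powr (- (real n - 1) / 2)))"
    using assms
  proof (induction n rule: nat_induct_at_least)
    case base
    have [measurable]: "random_variable borel (X (Suc 0))"
      using base(1) by (auto simp: indep_vars_def)
    have "(\<integral>\<^sup>+\<omega>. F (0, X (Suc 0) \<omega>) \<partial>M) = (\<integral>\<^sup>+s. F (0, s) \<partial>gauss 1)"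
      if [measurable]: "F \<in> borel_measurable (borel \<Otimes>\<^sub>M borel)" for F
      using base(2)[of "Suc 0"] by (subst nn_integral_distr[symmetric, of "X (Suc 0)" M borel]) auto
    moreover have "ennreal ((1 + 2 * t) powr 0) = 1" if "0 \<le> t" for t :: real
      using that by simp
    ultimately show ?case
      by (simp add: emeasure_space_1) blast
  next
    case (Suc n)
    have "indep_vars (\<lambda>_. borel) X {1..n}"
      using Suc.prems(1) by (rule indep_vars_subset) auto
    note IH = Suc.IH[OF this Suc.prems(2)]
    have d: "distr M borel (X (Suc n)) = gauss 1"
      using Suc.prems(2) by simp
    note step = sum_sq_dev_step[OF Suc.hyps Suc.prems(1) d]
    interpret N: prob_space "gauss (real n + 1)" by (rule prob_space_gauss) simp
    let ?Q = "\<lambda>\<omega>. sum_sq_dev n (\<lambda>j. X j \<omega>)"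
    \<comment> \<open>Integrating out the sum, whose law has mass one, leaves a recursion for the
      sum of squares alone.\<close>
    have first: "(\<integral>\<^sup>+\<omega>. F (sum_sq_dev (Suc n) (\<lambda>j. X j \<omega>)) \<partial>M)
      = (\<integral>\<^sup>+\<omega>. \<integral>\<^sup>+d. F (?Q \<omega> + real n / (real n + 1) * d\<^sup>2) \<partial>gauss ((real n + 1) / n) \<partial>M)"
      if [measurable]: "F \<in> borel_measurable borel" for F
      using step[of "\<lambda>w. F (fst w)"] IH by (simp add: N.emeasure_space_1[simplified])
    show ?case
    proof safe
      fix F :: "real \<times> real \<Rightarrow> ennreal" assume F [measurable]: "F \<in> borel_measurable (borel \<Otimes>\<^sub>M borel)"
      have "(\<integral>\<^sup>+\<omega>. F (sum_sq_dev (Suc n) (\<lambda>j. X j \<omega>), \<Sum>j=1..Suc n. X j \<omega>) \<partial>M)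
        = (\<integral>\<^sup>+\<omega>. \<integral>\<^sup>+s. \<integral>\<^sup>+d. F (?Q \<omega> + real n / (real n + 1) * d\<^sup>2, s)
            \<partial>gauss ((real n + 1) / n) \<partial>gauss (real n + 1) \<partial>M)"
        using step[OF _ F] IH by simp
      also have "\<dots> = (\<integral>\<^sup>+\<omega>. \<integral>\<^sup>+d. \<integral>\<^sup>+s. F (?Q \<omega> + real n / (real n + 1) * d\<^sup>2, s)
            \<partial>gauss (real n + 1) \<partial>gauss ((real n + 1) / n) \<partial>M)"
      proof (rule nn_integral_cong)
        fix \<omega>
        interpret D: prob_space "gauss ((real n + 1) / n)"
          by (rule prob_space_gauss) (use Suc.hyps in simp)
        interpret pair_sigma_finite "gauss ((real n + 1) / n)" "gauss (real n + 1)" ..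
        show "(\<integral>\<^sup>+s. \<integral>\<^sup>+d. F (?Q \<omega> + real n / (real n + 1) * d\<^sup>2, s)
            \<partial>gauss ((real n + 1) / n) \<partial>gauss (real n + 1))
          = (\<integral>\<^sup>+d. \<integral>\<^sup>+s. F (?Q \<omega> + real n / (real n + 1) * d\<^sup>2, s)
            \<partial>gauss (real n + 1) \<partial>gauss ((real n + 1) / n))"
          by (rule Fubini'[of "\<lambda>d s. F (?Q \<omega> + real n / (real n + 1) * d\<^sup>2, s)"]) simp
      qed
      also have "\<dots> = (\<integral>\<^sup>+\<omega>. \<integral>\<^sup>+s. F (sum_sq_dev (Suc n) (\<lambda>j. X j \<omega>), s) \<partial>gauss (Suc n) \<partial>M)"
      proof -
        have "(\<lambda>q. \<integral>\<^sup>+s. F (q, s) \<partial>gauss (real n + 1)) \<in> borel_measurable borel"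
          by measurable
        from first[OF this] show ?thesis by (simp add: add.commute)
      qed
      finally show "(\<integral>\<^sup>+\<omega>. F (sum_sq_dev (Suc n) (\<lambda>j. X j \<omega>), \<Sum>j=1..Suc n. X j \<omega>) \<partial>M)
        = (\<integral>\<^sup>+\<omega>. \<integral>\<^sup>+s. F (sum_sq_dev (Suc n) (\<lambda>j. X j \<omega>), s) \<partial>gauss (Suc n) \<partial>M)" .
    next
      fix t :: real assume t: "0 \<le> t"
      have [measurable]: "random_variable borel ?Q"
        by (rule random_variable_sum_sq_dev) (use Suc.prems(1) in \<open>auto simp: indep_vars_def\<close>)
      have "(\<integral>\<^sup>+\<omega>. ennreal (exp (- t * sum_sq_dev (Suc n) (\<lambda>j. X j \<omega>))) \<partial>M)
        = (\<integral>\<^sup>+\<omega>. \<integral>\<^sup>+d. ennreal (exp (- t * ?Q \<omega>)) * ennreal (exp (- (t * (real n / (real n + 1))) * d\<^sup>2))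
            \<partial>gauss ((real n + 1) / n) \<partial>M)"
        by (subst first[of "\<lambda>q. ennreal (exp (- t * q))"])
           (auto simp: ennreal_mult''[symmetric] exp_add[symmetric] algebra_simps)
      also have "\<dots> = (\<integral>\<^sup>+\<omega>. ennreal (exp (- t * ?Q \<omega>)) * ennreal ((1 + 2 * t) powr (- 1 / 2)) \<partial>M)"
      proof (rule nn_integral_cong)
        fix \<omega>
        have eq: "2 * (t * (real n / (real n + 1))) * ((real n + 1) / n) = 2 * t"
        proof -
          have "real n \<noteq> 0" "real n + 1 \<noteq> 0"
            using Suc.hyps by auto
          then have "real n / (real n + 1) * ((real n + 1) / n) = 1"
            by simp
          then show ?thesis by (simp only: mult.assoc mult_1_right)
        qed
        have pos: "0 < (real n + 1) / n" "0 \<le> t * (real n / (real n + 1))"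
          using t Suc.hyps by auto
        note I = integral_exp_square_gauss[OF pos, unfolded eq]
        show "(\<integral>\<^sup>+d. ennreal (exp (- t * ?Q \<omega>)) * ennreal (exp (- (t * (real n / (real n + 1))) * d\<^sup>2))
            \<partial>gauss ((real n + 1) / n)) = ennreal (exp (- t * ?Q \<omega>)) * ennreal ((1 + 2 * t) powr (- 1 / 2))"
          by (subst nn_integral_cmult) (simp, simp only: I)
      qed
      also have "\<dots> = ennreal ((1 + 2 * t) powr (- (real n - 1) / 2)) * ennreal ((1 + 2 * t) powr (- 1 / 2))"
        using IH t by (subst nn_integral_multc) auto
      also have "\<dots> = ennreal ((1 + 2 * t) powr (- (real (Suc n) - 1) / 2))"
        using t by (simp add: ennreal_mult''[symmetric] powr_add[symmetric] field_simps)
      finally show "(\<integral>\<^sup>+\<omega>. ennreal (exp (- t * sum_sq_dev (Suc n) (\<lambda>j. X j \<omega>))) \<partial>M)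
        = ennreal ((1 + 2 * t) powr (- (real (Suc n) - 1) / 2))" .
    qed
  qed
  then show "\<And>F. F \<in> borel_measurable (borel \<Otimes>\<^sub>M borel) \<Longrightarrow>
      (\<integral>\<^sup>+\<omega>. F (sum_sq_dev n (\<lambda>j. X j \<omega>), \<Sum>j=1..n. X j \<omega>) \<partial>M)
      = (\<integral>\<^sup>+\<omega>. \<integral>\<^sup>+s. F (sum_sq_dev n (\<lambda>j. X j \<omega>), s) \<partial>gauss n \<partial>M)"
    and "\<And>t. 0 \<le> t \<Longrightarrow>
      (\<integral>\<^sup>+\<omega>. ennreal (exp (- t * sum_sq_dev n (\<lambda>j. X j \<omega>))) \<partial>M)
      = ennreal ((1 + 2 * t) powr (- (real n - 1) / 2))"
    by blast+
qed

section \<open>Walks with an estimated variance\<close>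

lemma up_exit_withinI:
  assumes "\<And>k. S (Suc k) = S k + s !! k - v"
    and "R (r + n) \<le> S n" and "\<And>k. k < n \<Longrightarrow> \<bar>S k\<bar> < R (r + k)"
  shows "up_exit_within R v n r (S 0) s"
  using assms
proof (induction n arbitrary: r s S)
  case 0
  then show ?case by simp
next
  case (Suc n)
  have "up_exit_within R v n (Suc r) (S (Suc 0)) (stl s)"
  proof (rule Suc.IH)
    show "S (Suc (Suc k)) = S (Suc k) + stl s !! k - v" for k
      using Suc.prems(1)[of "Suc k"] by simp
    show "R (Suc r + n) \<le> S (Suc n)"
      using Suc.prems(2) by simp
    show "\<bar>S (Suc k)\<bar> < R (Suc r + k)" if "k < n" for k
      using Suc.prems(3)[of "Suc k"] that by simp
  qed
  moreover have "S (Suc 0) = S 0 + shd s - v"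
    using Suc.prems(1)[of 0] by simp
  ultimately show ?case
    using Suc.prems(3)[of 0] by simp
qed

lemma up_exit_within_Suc:
  "up_exit_within R v n r x s \<Longrightarrow> up_exit_within R v (Suc n) r x s"
proof (induction n arbitrary: r x s)
  case 0
  then show ?case by simp
next
  case (Suc n)
  then have "R r \<le> x \<or> \<bar>x\<bar> < R r \<and> up_exit_within R v n (Suc r) (x + shd s - v) (stl s)"
    by simp
  then show ?case
    using Suc.IH by (subst up_exit_within.simps(2)) blast
qed

lemma up_exit_within_mono:
  "n \<le> m \<Longrightarrow> up_exit_within R v n r x s \<Longrightarrow> up_exit_within R v m r x s"
  by (induction rule: dec_induct) (auto intro: up_exit_within_Suc simp del: up_exit_within.simps)

text \<open>Fabian's bound for the exit of a Brownian motion with drift from a triangle: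
  \<open>u 0 0 / 2\<close> as a function of the product \<open>a = A v\<close>. Averaged over
  \<open>a\<close>, \<eta> times a chi-square variable, it becomes \<open>g_fun\<close>.\<close>

definition fabian :: "nat \<Rightarrow> real \<Rightarrow> real" where
  "fabian c a = (\<Sum>m=1..c. (- 1) ^ (m + 1) * (1 - (if m = c then 1 else 0) / 2) *
     exp (- ((2 * real c - real m) * real m / real c) * a))"

text \<open>The horizon is enlarged until the triangle is closed, as \<open>up_exit_prob_le\<close>
  requires. The triangle has \<open>A = a / v\<close>, so \<open>A v = a\<close> and the bound is
  the same for every \<open>v\<close>.\<close>

lemma up_exit_measure_le:
  assumes c: "1 \<le> c" and v: "0 < v" and a: "0 \<le> a" and r: "0 < r"
  shows "(\<integral>\<^sup>+z. emeasure (stream_space (gauss 1))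
      {s \<in> space (stream_space (gauss 1)).
        up_exit_within (\<lambda>r. max 0 (a / v - v / (2 * real c) * real r)) v n r (z - real r * v) s} \<partial>gauss r)
    \<le> ennreal (fabian c a)"
proof -
  interpret G: prob_space "gauss 1" by (rule prob_space_gauss) simp
  interpret S: prob_space "stream_space (gauss 1)" by (rule G.prob_space_stream_space)
  interpret Gr: prob_space "gauss (real r)" by (rule prob_space_gauss) (use r in simp)
  interpret T: triangle c "a / v" "v / (2 * real c)"
    using assms by unfold_locales auto
  have Tv: "T.v = v"
    using c by (simp add: T.v_def)
  have TR: "T.R = (\<lambda>r. max 0 (a / v - v / (2 * real c) * real r))"
    by (simp add: T.R_def fun_eq_iff)
  obtain N :: nat where N: "a / v / (v / (2 * real c)) \<le> real N"
    using real_arch_simple by blast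
  define m where "m = max n N"
  have m: "a / v \<le> v / (2 * real c) * (real r + real m)"
  proof -
    have "a / v / (v / (2 * real c)) \<le> real r + real m"
      using N by (simp add: m_def)
    then show ?thesis
      using c v by (subst (asm) pos_divide_le_eq) (auto simp: mult.commute)
  qed
  let ?U = "\<lambda>n z s. up_exit_within T.R v n r (z - real r * v) s"
  have "(\<integral>\<^sup>+z. emeasure (stream_space (gauss 1)) {s \<in> space (stream_space (gauss 1)). ?U n z s} \<partial>gauss r)
    \<le> (\<integral>\<^sup>+z. emeasure (stream_space (gauss 1)) {s \<in> space (stream_space (gauss 1)). ?U m z s} \<partial>gauss r)"
    by (intro nn_integral_mono emeasure_mono)
       (auto intro: up_exit_within_mono[of n m, OF max.cobounded1[of n N, folded m_def]])
  also have "\<dots> = (\<integral>\<^sup>+z. ennreal (T.P m r (z - real r * v)) \<partial>gauss r)"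
    unfolding T.P_def Tv S.emeasure_eq_measure ..
  also have "\<dots> = ennreal (\<integral>z. T.P m r (z - real r * v) \<partial>gauss r)"
    by (intro nn_integral_eq_integral Gr.integrable_const_bound[where B=1])
       (auto simp: T.P_nonneg T.P_le_1)
  also have "\<dots> \<le> ennreal (T.u 0 0 / 2)"
    using T.up_exit_prob_le[OF r m] by (intro ennreal_leI) (simp add: Tv)
  also have "T.u 0 0 / 2 = fabian c a"
    using v unfolding T.u_0_0 fabian_def Tv by simp
  finally show ?thesis
    unfolding TR .
qed

text \<open>The signs alternate, so nonnegativity is read off from a probability that the sum
  bounds, namely the exit probability of the triangle with \<open>v = 1\<close>.\<close>

lemma fabian_nonneg:
  assumes "1 \<le> c" and "0 \<le> a"
  shows "0 \<le> fabian c a"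
proof -
  interpret T: triangle c a "1 / (2 * real c)"
    using assms by unfold_locales auto
  obtain N :: nat where "a / (1 / (2 * real c)) \<le> real N"
    using real_arch_simple by blast
  then have N: "a \<le> 1 / (2 * real c) * (real 1 + real N)"
    using assms by (simp add: field_simps)
  have "0 \<le> (\<integral>z. T.P N 1 (z - real 1 * T.v) \<partial>gauss (real 1))"
    by (intro integral_nonneg_AE) (simp add: T.P_nonneg)
  also have "\<dots> \<le> T.u 0 0 / 2"
    by (rule T.up_exit_prob_le[OF _ N]) simp
  also have "\<dots> = fabian c a"
    using assms by (simp add: T.u_0_0 fabian_def T.v_def)
  finally show ?thesis .
qed

lemma (in prob_space) indep_vars_reindex:
  assumes f: "inj_on f I" and ind: "indep_vars M' X (f ` I)"
  shows "indep_vars (\<lambda>i. M' (f i)) (\<lambda>i. X (f i)) I"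
proof (cases "I = {}")
  case True
  then show ?thesis by (simp add: indep_vars_def indep_sets_def)
next
  case False
  have rv [measurable]: "i \<in> f ` I \<Longrightarrow> random_variable (M' i) (X i)" for i
    using ind by (auto simp: indep_vars_def)
  let ?D = "\<lambda>i. distr M (M' i) (X i)"
  have D: "distr M (PiM (f ` I) M') (\<lambda>\<omega>. \<lambda>i\<in>f ` I. X i \<omega>) = PiM (f ` I) ?D"
    using ind False by (subst (asm) indep_vars_iff_distr_eq_PiM') (auto simp: rv)
  have "PiM I (\<lambda>i. ?D (f i)) = distr (PiM (f ` I) ?D) (PiM I (\<lambda>i. ?D (f i))) (\<lambda>\<omega>. \<lambda>i\<in>I. \<omega> (f i))"
    using f by (intro distr_PiM_reindex[symmetric] prob_space_distr rv) auto
  also have "\<dots> = distr (PiM (f ` I) ?D) (PiM I (\<lambda>i. M' (f i))) (\<lambda>\<omega>. \<lambda>i\<in>I. \<omega> (f i))"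
    by (intro distr_cong refl sets_PiM_cong) simp
  also have "\<dots> = distr M (PiM I (\<lambda>i. M' (f i))) ((\<lambda>\<omega>. \<lambda>i\<in>I. \<omega> (f i)) \<circ> (\<lambda>\<omega>. \<lambda>i\<in>f ` I. X i \<omega>))"
    unfolding D[symmetric]
    by (intro distr_distr measurable_restrict rv measurable_component_singleton) auto
  also have "(\<lambda>\<omega>. \<lambda>i\<in>I. \<omega> (f i)) \<circ> (\<lambda>\<omega>. \<lambda>i\<in>f ` I. X i \<omega>) = (\<lambda>\<omega>. \<lambda>i\<in>I. X (f i) \<omega>)"
    by (auto simp: fun_eq_iff)
  finally have "PiM I (\<lambda>i. ?D (f i)) = distr M (PiM I (\<lambda>i. M' (f i))) (\<lambda>\<omega>. \<lambda>i\<in>I. X (f i) \<omega>)" .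
  then show ?thesis
    using False by (subst indep_vars_iff_distr_eq_PiM') (simp_all add: rv)
qed

text \<open>\<open>Z\<close> are standardized observations, and \<open>w\<close> computes the standardized tolerance from the
  first-stage sample.\<close>
locale monitored_sample = prob_space M for M :: "'a measure" +
  fixes Z :: "nat + nat \<Rightarrow> 'a \<Rightarrow> real" and n0' r0 c :: nat and \<eta> :: real
    and w :: "(nat \<Rightarrow> real) \<Rightarrow> real"
  assumes indep: "indep_vars (\<lambda>_. borel) Z (obs_index n0')"
    and distr_Z: "\<And>p. p \<in> obs_index n0' \<Longrightarrow> distr M borel (Z p) = gauss 1"
    and n0': "1 \<le> n0'" and r0: "1 \<le> r0" and c: "1 \<le> c" and \<eta>: "0 < \<eta>"
    and w_measurable [measurable]: "w \<in> borel_measurable (PiM {1..n0'} (\<lambda>_. borel))"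
    and w_pos: "\<And>x. 0 < w x"
begin

definition Q' where "Q' \<omega> = sum_sq_dev n0' (\<lambda>j. Z (Inl j) \<omega>)"
definition Q where "Q \<omega> = sum_sq_dev r0 (\<lambda>j. Z (Inr j) \<omega>)"
definition T where "T \<omega> = (\<Sum>j=1..r0. Z (Inr j) \<omega>)"
definition V where "V \<omega> = w (\<lambda>j\<in>{1..n0'}. Z (Inl j) \<omega>)"
definition tail where "tail \<omega> = to_stream (\<lambda>k. Z (Inr (Suc (r0 + k))) \<omega>)"

lemma in_obs_index [simp]: "Inl j \<in> obs_index n0' \<longleftrightarrow> 1 \<le> j \<and> j \<le> n0'" "Inr j \<in> obs_index n0' \<longleftrightarrow> 1 \<le> j"
  by (auto simp: obs_index_def)

lemma random_variable_Z: "p \<in> obs_index n0' \<Longrightarrow> random_variable borel (Z p)"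
  using indep by (auto simp: indep_vars_def)

lemma random_variables [measurable]:
  "random_variable borel Q'" "random_variable borel Q" "random_variable borel T" "random_variable borel V"
  "tail \<in> M \<rightarrow>\<^sub>M stream_space borel"
proof -
  show "random_variable borel Q'" "random_variable borel Q"
    unfolding Q'_def[abs_def] Q_def[abs_def]
    by (intro random_variable_sum_sq_dev random_variable_Z; simp)+
  show "random_variable borel T"
    unfolding T_def[abs_def] by (intro borel_measurable_sum random_variable_Z) simp
  have "(\<lambda>\<omega>. \<lambda>j\<in>{1..n0'}. Z (Inl j) \<omega>) \<in> M \<rightarrow>\<^sub>M PiM {1..n0'} (\<lambda>_. borel)"
    by (intro measurable_restrict random_variable_Z) simp
  then show "random_variable borel V"
    unfolding V_def[abs_def] by (rule measurable_compose) (rule w_measurable)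
  show "tail \<in> M \<rightarrow>\<^sub>M stream_space borel"
    unfolding tail_def[abs_def]
    by (rule measurable_stream_space2) (simp add: to_stream_def random_variable_Z)
qed

lemma distr_tail: "distr M (stream_space borel) tail = stream_space (gauss 1)"
proof -
  define X where "X k = Z (Inr (Suc (r0 + k)))" for k
  have ind: "indep_vars (\<lambda>_. borel) X UNIV"
    unfolding X_def
    by (rule indep_vars_reindex[of "\<lambda>k. Inr (Suc (r0 + k))", OF _ indep_vars_subset[OF indep]])
       (auto simp: inj_on_def)
  have [measurable]: "random_variable borel (X k)" for k
    by (simp add: X_def random_variable_Z)
  have "distr M (PiM UNIV (\<lambda>_. borel)) (\<lambda>\<omega>. \<lambda>k\<in>UNIV. X k \<omega>) = PiM UNIV (\<lambda>k. distr M borel (X k))"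
    using ind by (subst (asm) indep_vars_iff_distr_eq_PiM) auto
  then have eq: "distr M (PiM UNIV (\<lambda>_. borel)) (\<lambda>\<omega> k. X k \<omega>) = PiM UNIV (\<lambda>_. gauss 1)"
    by (simp add: X_def distr_Z restrict_def)
  have "stream_space (gauss 1) = distr (PiM UNIV (\<lambda>_. gauss 1)) (stream_space (gauss 1)) to_stream"
    by (rule stream_space_eq_distr)
  also have "\<dots> = distr (PiM UNIV (\<lambda>_. gauss 1)) (stream_space borel) to_stream"
    by (intro distr_cong refl sets_stream_space_cong) simp
  also have "\<dots> = distr M (stream_space borel) (\<lambda>\<omega>. to_stream (\<lambda>k. X k \<omega>))"
    unfolding eq[symmetric]
    by (subst distr_distr) (auto simp: comp_def intro: measurable_PiM_single')
  finally show ?thesis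
    by (simp add: tail_def[abs_def] X_def)
qed

text \<open>The first stage, the next \<open>r0\<close> observations and the later ones are
  independent blocks, and inside the middle block the sum of squares is independent of the sum.
  \<open>V\<close> and \<open>Q'\<close> stay at the same sample point, since both are functions of
  the first stage and may be dependent.\<close>

lemma nn_integral_blocks:
  assumes G [measurable]: "G \<in> borel_measurable (((borel \<Otimes>\<^sub>M borel) \<Otimes>\<^sub>M (borel \<Otimes>\<^sub>M borel)) \<Otimes>\<^sub>M stream_space borel)"
  shows "(\<integral>\<^sup>+\<omega>. G (((V \<omega>, Q' \<omega>), (Q \<omega>, T \<omega>)), tail \<omega>) \<partial>M)
    = (\<integral>\<^sup>+\<omega>. \<integral>\<^sup>+\<omega>'. \<integral>\<^sup>+t. \<integral>\<^sup>+s. G (((V \<omega>, Q' \<omega>), (Q \<omega>', t)), s) \<partial>stream_space (gauss 1) \<partial>gauss r0 \<partial>M \<partial>M)"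
proof -
  interpret G1: prob_space "gauss 1" by (rule prob_space_gauss) simp
  interpret S: prob_space "stream_space (gauss 1)" by (rule G1.prob_space_stream_space)
  let ?I = "Inl ` {1..n0'} :: (nat + nat) set" and ?J = "Inr ` {1..r0} :: (nat + nat) set"
    and ?K = "Inr ` {r0<..} :: (nat + nat) set"
  define f where "f x = (w (\<lambda>j\<in>{1..n0'}. x (Inl j)), sum_sq_dev n0' (\<lambda>j. x (Inl j)))" for x :: "nat + nat \<Rightarrow> real"
  define g where "g x = (sum_sq_dev r0 (\<lambda>j. x (Inr j)), \<Sum>j=1..r0. x (Inr j))" for x :: "nat + nat \<Rightarrow> real"
  define h where "h x = to_stream (\<lambda>k. x (Inr (Suc (r0 + k))))" for x :: "nat + nat \<Rightarrow> real"
  have restr: "(\<lambda>x. \<lambda>j\<in>N. x (e j)) \<in> PiM A (\<lambda>_. borel) \<rightarrow>\<^sub>M PiM N (\<lambda>_. borel :: real measure)"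
    if "e ` N \<subseteq> A" for e :: "nat \<Rightarrow> nat + nat" and A N
    using that by (intro measurable_restrict measurable_component_singleton) auto
  have ssd: "(\<lambda>x. sum_sq_dev n (\<lambda>j. x (e j))) \<in> borel_measurable (PiM A (\<lambda>_. borel))"
    if "e ` {1..n} \<subseteq> A" for e :: "nat \<Rightarrow> nat + nat" and n A
  proof -
    have "(\<lambda>x. sum_sq_dev n (\<lambda>j\<in>{1..n}. x (e j))) \<in> borel_measurable (PiM A (\<lambda>_. borel))"
      by (rule measurable_compose[OF restr[OF that] measurable_sum_sq_dev_PiM])
    also have "(\<lambda>x. sum_sq_dev n (\<lambda>j\<in>{1..n}. x (e j))) = (\<lambda>x. sum_sq_dev n (\<lambda>j. x (e j)))"
      by (intro ext sum_sq_dev_cong) simp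
    finally show ?thesis .
  qed
  have f: "f \<in> PiM A (\<lambda>_. borel) \<rightarrow>\<^sub>M borel \<Otimes>\<^sub>M borel" if "?I \<subseteq> A" for A
    unfolding f_def[abs_def] using that
    by (intro measurable_Pair ssd measurable_compose[OF restr w_measurable])
  have g: "g \<in> PiM A (\<lambda>_. borel) \<rightarrow>\<^sub>M borel \<Otimes>\<^sub>M borel" if "?J \<subseteq> A" for A
    unfolding g_def[abs_def] using that
    by (intro measurable_Pair ssd borel_measurable_sum measurable_component_singleton) auto
  have h: "h \<in> PiM ?K (\<lambda>_. borel) \<rightarrow>\<^sub>M stream_space borel"
    unfolding h_def[abs_def]
    by (rule measurable_stream_space2) (auto simp: to_stream_def intro!: measurable_component_singleton)
  have fZ: "f (\<lambda>p\<in>A. Z p \<omega>) = (V \<omega>, Q' \<omega>)" if "?I \<subseteq> A" for A \<omega>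
  proof -
    have [simp]: "Inl j \<in> A" if "1 \<le> j" "j \<le> n0'" for j
      using \<open>?I \<subseteq> A\<close> that by auto
    show ?thesis
      unfolding f_def V_def Q'_def
      by (auto intro!: arg_cong[where f=w] sum_sq_dev_cong simp: fun_eq_iff)
  qed
  have gZ: "g (\<lambda>p\<in>A. Z p \<omega>) = (Q \<omega>, T \<omega>)" if "?J \<subseteq> A" for A \<omega>
  proof -
    have [simp]: "Inr j \<in> A" if "1 \<le> j" "j \<le> r0" for j
      using \<open>?J \<subseteq> A\<close> that by auto
    show ?thesis
      unfolding g_def Q_def T_def by (auto intro!: sum_sq_dev_cong sum.cong)
  qed
  have hZ: "h (\<lambda>p\<in>?K. Z p \<omega>) = tail \<omega>" for \<omega>
    by (simp add: h_def tail_def image_iff)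
  have sub: "(?I \<union> ?J) \<inter> ?K = {}" "?K \<subseteq> obs_index n0'" "?I \<inter> ?J = {}"
    "?I \<subseteq> obs_index n0'" "?J \<subseteq> obs_index n0'" "?I \<union> ?J \<subseteq> obs_index n0'"
    by auto
  define H where "H p = (\<integral>\<^sup>+s. G (p, s) \<partial>stream_space (gauss 1))" for p
  have [measurable]: "H \<in> borel_measurable ((borel \<Otimes>\<^sub>M borel) \<Otimes>\<^sub>M (borel \<Otimes>\<^sub>M borel))"
    unfolding H_def[abs_def] by measurable
  have "(\<integral>\<^sup>+\<omega>. G (((V \<omega>, Q' \<omega>), (Q \<omega>, T \<omega>)), tail \<omega>) \<partial>M)
    = (\<integral>\<^sup>+\<omega>. \<integral>\<^sup>+\<omega>'. G (((V \<omega>, Q' \<omega>), (Q \<omega>, T \<omega>)), tail \<omega>') \<partial>M \<partial>M)"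
  proof -
    have "(\<lambda>x. (f x, g x)) \<in> PiM (?I \<union> ?J) (\<lambda>_. borel) \<rightarrow>\<^sub>M (borel \<Otimes>\<^sub>M borel) \<Otimes>\<^sub>M (borel \<Otimes>\<^sub>M borel)"
      by (intro measurable_Pair f g) auto
    from nn_integral_indep_blocks[OF indep sub(1,6,2) this h G] show ?thesis
      unfolding hZ fZ[OF Un_upper1] gZ[OF Un_upper2] .
  qed
  also have "\<dots> = (\<integral>\<^sup>+\<omega>. H ((V \<omega>, Q' \<omega>), (Q \<omega>, T \<omega>)) \<partial>M)"
    unfolding H_def distr_tail[symmetric] by (simp add: nn_integral_distr)
  also have "\<dots> = (\<integral>\<^sup>+\<omega>. \<integral>\<^sup>+\<omega>'. H ((V \<omega>, Q' \<omega>), (Q \<omega>', T \<omega>')) \<partial>M \<partial>M)"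
    using nn_integral_indep_blocks[OF indep sub(3,4,5) f[OF order_refl] g[OF order_refl], of H]
    unfolding fZ[OF order_refl] gZ[OF order_refl] by simp
  also have "\<dots> = (\<integral>\<^sup>+\<omega>. \<integral>\<^sup>+\<omega>'. \<integral>\<^sup>+t. H ((V \<omega>, Q' \<omega>), (Q \<omega>', t)) \<partial>gauss r0 \<partial>M \<partial>M)"
  proof (rule nn_integral_cong)
    fix \<omega>
    have "indep_vars (\<lambda>_. borel) (\<lambda>j. Z (Inr j)) {1..r0}"
      by (rule indep_vars_reindex[OF _ indep_vars_subset[OF indep]]) (auto simp: inj_on_def)
    from nn_integral_sum_sq_dev_sum[OF r0 this, of "\<lambda>p. H ((V \<omega>, Q' \<omega>), p)"]
    show "(\<integral>\<^sup>+\<omega>'. H ((V \<omega>, Q' \<omega>), (Q \<omega>', T \<omega>')) \<partial>M)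
      = (\<integral>\<^sup>+\<omega>'. \<integral>\<^sup>+t. H ((V \<omega>, Q' \<omega>), (Q \<omega>', t)) \<partial>gauss r0 \<partial>M)"
      by (simp add: distr_Z Q_def T_def)
  qed
  finally show ?thesis
    unfolding H_def .
qed

lemma integral_exp_sum_sq_dev:
  assumes "0 \<le> t"
  shows "has_bochner_integral M (\<lambda>\<omega>. exp (- t * Q' \<omega>)) ((1 + 2 * t) powr (- (real n0' - 1) / 2))"
    and "has_bochner_integral M (\<lambda>\<omega>. exp (- t * Q \<omega>)) ((1 + 2 * t) powr (- (real r0 - 1) / 2))"
proof -
  have "indep_vars (\<lambda>_. borel) (\<lambda>j. Z (Inl j)) {1..n0'}"
    by (rule indep_vars_reindex[OF _ indep_vars_subset[OF indep]]) (auto simp: inj_on_def)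
  from nn_integral_exp_sum_sq_dev[OF n0' this _ assms]
  show "has_bochner_integral M (\<lambda>\<omega>. exp (- t * Q' \<omega>)) ((1 + 2 * t) powr (- (real n0' - 1) / 2))"
    by (intro has_bochner_integral_nn_integral) (auto simp: distr_Z Q'_def[symmetric])
  have "indep_vars (\<lambda>_. borel) (\<lambda>j. Z (Inr j)) {1..r0}"
    by (rule indep_vars_reindex[OF _ indep_vars_subset[OF indep]]) (auto simp: inj_on_def)
  from nn_integral_exp_sum_sq_dev[OF r0 this _ assms]
  show "has_bochner_integral M (\<lambda>\<omega>. exp (- t * Q \<omega>)) ((1 + 2 * t) powr (- (real r0 - 1) / 2))"
    by (intro has_bochner_integral_nn_integral) (auto simp: distr_Z Q_def[symmetric])
qed

text \<open>Each term of \<open>fabian\<close> splits into an exponential in \<open>Q'\<close> and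
  one in \<open>Q\<close>, so it integrates to a product of two chi-square transforms, whose degrees
  of freedom add up to \<open>n0' + r0 - 2\<close>. As the signs alternate, the terms are integrated
  in the Bochner sense, and nonnegativity of the whole sums transfers the result.\<close>

lemma nn_integral_fabian:
  "(\<integral>\<^sup>+\<omega>. \<integral>\<^sup>+\<omega>'. ennreal (fabian c (\<eta> * (Q' \<omega> + Q \<omega>'))) \<partial>M \<partial>M) = ennreal (g_fun c (n0' + r0 - 2) \<eta>)"
proof -
  define a :: "nat \<Rightarrow> real" where "a m = (- 1) ^ (m + 1) * (1 - (if m = c then 1 else 0) / 2)" for m
  define t where "t m = (2 * real c - real m) * real m / real c * \<eta>" for m
  define p where "p m n = (1 + 2 * t m) powr (- (real n - 1) / 2)" for m n
  have t: "0 \<le> t m" if "m \<in> {1..c}" for m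
    using that \<eta> by (simp add: t_def)
  have fab: "fabian c (\<eta> * (x + y)) = (\<Sum>m=1..c. a m * exp (- t m * x) * exp (- t m * y))" for x y
  proof -
    have "- ((2 * real c - real m) * real m / real c) * (\<eta> * (x + y)) = - t m * x + - t m * y" for m
    proof -
      have "- K * (\<eta> * (x + y)) = - (K * \<eta>) * x + - (K * \<eta>) * y" for K
        by (simp add: algebra_simps)
      then show ?thesis unfolding t_def .
    qed
    note eq = this
    show ?thesis
      unfolding fabian_def a_def by (simp only: eq exp_add mult.assoc)
  qed
  have nn: "0 \<le> fabian c (\<eta> * (Q' \<omega> + Q \<omega>'))" for \<omega> \<omega>'
    using \<eta> by (intro fabian_nonneg c) (simp add: Q'_def Q_def sum_sq_dev_nonneg)
  have inner: "has_bochner_integral M (\<lambda>\<omega>'. fabian c (\<eta> * (Q' \<omega> + Q \<omega>'))) (\<Sum>m=1..c. a m * exp (- t m * Q' \<omega>) * p m r0)" for \<omega>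
    unfolding fab p_def
    by (intro has_bochner_integral_sum has_bochner_integral_mult_right integral_exp_sum_sq_dev t)
  have outer: "has_bochner_integral M (\<lambda>\<omega>. \<Sum>m=1..c. a m * exp (- t m * Q' \<omega>) * p m r0) (\<Sum>m=1..c. a m * p m n0' * p m r0)"
    unfolding p_def
    by (intro has_bochner_integral_sum has_bochner_integral_mult_right has_bochner_integral_mult_left
        integral_exp_sum_sq_dev t)
  have inner_nn: "0 \<le> (\<Sum>m=1..c. a m * exp (- t m * Q' \<omega>) * p m r0)" for \<omega>
  proof -
    have "0 \<le> (\<integral>\<omega>'. fabian c (\<eta> * (Q' \<omega> + Q \<omega>')) \<partial>M)"
      using nn by (intro integral_nonneg_AE) simp
    then show ?thesis
      using inner by (simp add: has_bochner_integral_iff)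
  qed
  have "(\<integral>\<^sup>+\<omega>. \<integral>\<^sup>+\<omega>'. ennreal (fabian c (\<eta> * (Q' \<omega> + Q \<omega>'))) \<partial>M \<partial>M)
    = (\<integral>\<^sup>+\<omega>. ennreal (\<Sum>m=1..c. a m * exp (- t m * Q' \<omega>) * p m r0) \<partial>M)"
    using inner nn by (simp add: nn_integral_eq_integral has_bochner_integral_iff)
  also have "\<dots> = ennreal (\<Sum>m=1..c. a m * p m n0' * p m r0)"
    using outer inner_nn by (simp add: nn_integral_eq_integral has_bochner_integral_iff)
  also have "(\<Sum>m=1..c. a m * p m n0' * p m r0) = g_fun c (n0' + r0 - 2) \<eta>"
    unfolding g_fun_def
  proof (intro sum.cong refl)
    fix m
    have "- (real n0' - 1) / 2 + - (real r0 - 1) / 2 = - real (n0' + r0 - 2) / 2"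
      using n0' r0 by (simp add: of_nat_diff add_divide_distrib diff_divide_distrib)
    then have "p m n0' * p m r0 = (1 + 2 * t m) powr (- real (n0' + r0 - 2) / 2)"
      unfolding p_def by (simp only: powr_add[symmetric])
    moreover have "1 + 2 * t m = 1 + 2 * \<eta> * (2 * real c - real m) * real m / real c"
      by (simp add: t_def)
    ultimately show "a m * p m n0' * p m r0 = (- 1) ^ (m + 1) * (1 - (if m = c then 1 else 0) / 2) *
        (1 + 2 * \<eta> * (2 * real c - real m) * real m / real c) powr (- real (n0' + r0 - 2) / 2)"
      by (simp only: a_def mult.assoc)
  qed
  finally show ?thesis .
qed

text \<open>The boundary of the procedure divided by the standard deviation, with the pooled
  variance written through sums of squares.\<close>

definition bound where
  "bound \<omega> r = max 0 (\<eta> * (Q' \<omega> + Q \<omega>) / V \<omega> - V \<omega> / (2 * real c) * real r)"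

lemma measurable_bound [measurable]: "(\<lambda>\<omega>. bound \<omega> r) \<in> borel_measurable M"
  unfolding bound_def by measurable

lemma prob_up_exit_within_le:
  "emeasure M {\<omega> \<in> space M. up_exit_within (bound \<omega>) (V \<omega>) n r0 (T \<omega> - real r0 * V \<omega>) (tail \<omega>)}
    \<le> ennreal (g_fun c (n0' + r0 - 2) \<eta>)"
proof -
  interpret G1: prob_space "gauss 1" by (rule prob_space_gauss) simp
  interpret S: prob_space "stream_space (gauss 1)" by (rule G1.prob_space_stream_space)
  let ?R = "\<lambda>v a r. max 0 (a / v - v / (2 * real c) * real r)"
  define E where "E = {x :: ((real \<times> real) \<times> (real \<times> real)) \<times> real stream.
    up_exit_within (?R (fst (fst (fst x))) (\<eta> * (snd (fst (fst x)) + fst (snd (fst x)))))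
      (fst (fst (fst x))) n r0 (snd (snd (fst x)) - real r0 * fst (fst (fst x))) (snd x)}"
  have E [measurable]: "E \<in> sets (((borel \<Otimes>\<^sub>M borel) \<Otimes>\<^sub>M (borel \<Otimes>\<^sub>M borel)) \<Otimes>\<^sub>M stream_space borel)"
  proof -
    have "Measurable.pred (((borel \<Otimes>\<^sub>M borel) \<Otimes>\<^sub>M (borel \<Otimes>\<^sub>M borel)) \<Otimes>\<^sub>M stream_space borel)
      (\<lambda>x. up_exit_within (?R (fst (fst (fst x))) (\<eta> * (snd (fst (fst x)) + fst (snd (fst x)))))
        (fst (fst (fst x))) n r0 (snd (snd (fst x)) - real r0 * fst (fst (fst x))) (snd x))"
      by measurable
    then show ?thesis
      unfolding pred_def E_def by (simp add: space_pair_measure space_stream_space)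
  qed
  have "emeasure M {\<omega> \<in> space M. up_exit_within (bound \<omega>) (V \<omega>) n r0 (T \<omega> - real r0 * V \<omega>) (tail \<omega>)}
    = (\<integral>\<^sup>+\<omega>. indicator E (((V \<omega>, Q' \<omega>), (Q \<omega>, T \<omega>)), tail \<omega>) \<partial>M)"
  proof -
    have "emeasure M {\<omega> \<in> space M. up_exit_within (bound \<omega>) (V \<omega>) n r0 (T \<omega> - real r0 * V \<omega>) (tail \<omega>)}
      = (\<integral>\<^sup>+\<omega>. indicator {\<omega> \<in> space M. up_exit_within (bound \<omega>) (V \<omega>) n r0 (T \<omega> - real r0 * V \<omega>) (tail \<omega>)} \<omega> \<partial>M)"
      by (rule nn_integral_indicator[symmetric]) measurable
    also have "\<dots> = (\<integral>\<^sup>+\<omega>. indicator E (((V \<omega>, Q' \<omega>), (Q \<omega>, T \<omega>)), tail \<omega>) \<partial>M)"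
      by (rule nn_integral_cong) (simp add: E_def bound_def[abs_def] indicator_def)
    finally show ?thesis .
  qed
  also have "\<dots> = (\<integral>\<^sup>+\<omega>. \<integral>\<^sup>+\<omega>'. \<integral>\<^sup>+t. \<integral>\<^sup>+s. indicator E (((V \<omega>, Q' \<omega>), (Q \<omega>', t)), s)
      \<partial>stream_space (gauss 1) \<partial>gauss r0 \<partial>M \<partial>M)"
    by (rule nn_integral_blocks) simp
  also have "\<dots> = (\<integral>\<^sup>+\<omega>. \<integral>\<^sup>+\<omega>'. \<integral>\<^sup>+t. emeasure (stream_space (gauss 1)) {s \<in> space (stream_space (gauss 1)).
      up_exit_within (?R (V \<omega>) (\<eta> * (Q' \<omega> + Q \<omega>'))) (V \<omega>) n r0 (t - real r0 * V \<omega>) s} \<partial>gauss r0 \<partial>M \<partial>M)"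
  proof -
    have "(\<integral>\<^sup>+s. indicator E (((v, q'), (q, t)), s) \<partial>stream_space (gauss 1))
      = emeasure (stream_space (gauss 1)) {s \<in> space (stream_space (gauss 1)).
          up_exit_within (?R v (\<eta> * (q' + q))) v n r0 (t - real r0 * v) s}" for v q' q t
    proof -
      have "(\<integral>\<^sup>+s. indicator E (((v, q'), (q, t)), s) \<partial>stream_space (gauss 1))
        = (\<integral>\<^sup>+s. indicator {s \<in> space (stream_space (gauss 1)).
          up_exit_within (?R v (\<eta> * (q' + q))) v n r0 (t - real r0 * v) s} s \<partial>stream_space (gauss 1))"
        by (rule nn_integral_cong) (simp add: E_def indicator_def)
      also have "\<dots> = emeasure (stream_space (gauss 1)) {s \<in> space (stream_space (gauss 1)).
          up_exit_within (?R v (\<eta> * (q' + q))) v n r0 (t - real r0 * v) s}"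
        by (rule nn_integral_indicator) measurable
      finally show ?thesis .
    qed
    then show ?thesis by (simp only:)
  qed
  \<comment> \<open>For fixed \<open>V \<omega>\<close> this is \<open>up_exit_measure_le\<close>
    with \<open>a = \<eta> * (Q' \<omega> + Q \<omega>')\<close>; here the random tolerance
    disappears from the bound.\<close>
  also have "\<dots> \<le> (\<integral>\<^sup>+\<omega>. \<integral>\<^sup>+\<omega>'. ennreal (fabian c (\<eta> * (Q' \<omega> + Q \<omega>'))) \<partial>M \<partial>M)"
    using \<eta> r0 w_pos
    by (intro nn_integral_mono up_exit_measure_le c) (auto simp: V_def Q'_def Q_def sum_sq_dev_nonneg)
  finally show ?thesis
    by (simp only: nn_integral_fabian)
qed

lemma prob_up_exit_le:
  "emeasure M {\<omega> \<in> space M. \<exists>n. up_exit_within (bound \<omega>) (V \<omega>) n r0 (T \<omega> - real r0 * V \<omega>) (tail \<omega>)}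
    \<le> ennreal (g_fun c (n0' + r0 - 2) \<eta>)"
proof -
  let ?U = "\<lambda>n. {\<omega> \<in> space M. up_exit_within (bound \<omega>) (V \<omega>) n r0 (T \<omega> - real r0 * V \<omega>) (tail \<omega>)}"
  have "emeasure M (\<Union>n. ?U n) = (SUP n. emeasure M (?U n))"
  proof (rule SUP_emeasure_incseq[symmetric])
    show "range ?U \<subseteq> sets M" by auto
    show "incseq ?U"
      by (intro monoI Collect_mono) (auto intro: up_exit_within_mono)
  qed
  moreover have "\<dots> \<le> ennreal (g_fun c (n0' + r0 - 2) \<eta>)"
    by (intro SUP_least prob_up_exit_within_le)
  moreover have "{\<omega> \<in> space M. \<exists>n. up_exit_within (bound \<omega>) (V \<omega>) n r0 (T \<omega> - real r0 * V \<omega>) (tail \<omega>)} = (\<Union>n. ?U n)"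
    by auto
  ultimately show ?thesis by simp
qed

lemma prob_upper_exit_le:
  assumes S: "\<And>\<omega> r. S \<omega> r = (\<Sum>j=1..r. Z (Inr j) \<omega>) - real r * V \<omega>"
    and E: "E \<in> sets M" "\<And>\<omega>. \<omega> \<in> E \<Longrightarrow> \<exists>r\<ge>r0. bound \<omega> r \<le> S \<omega> r \<and> (\<forall>r'. r0 \<le> r' \<and> r' < r \<longrightarrow> \<bar>S \<omega> r'\<bar> < bound \<omega> r')"
  shows "emeasure M E \<le> ennreal (g_fun c (n0' + r0 - 2) \<eta>)"
proof -
  let ?U = "{\<omega> \<in> space M. \<exists>n. up_exit_within (bound \<omega>) (V \<omega>) n r0 (T \<omega> - real r0 * V \<omega>) (tail \<omega>)}"
  have "E \<subseteq> ?U"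
  proof
    fix \<omega> assume \<omega>: "\<omega> \<in> E"
    then obtain r where r: "r0 \<le> r" "bound \<omega> r \<le> S \<omega> r"
      "\<And>r'. r0 \<le> r' \<Longrightarrow> r' < r \<Longrightarrow> \<bar>S \<omega> r'\<bar> < bound \<omega> r'"
      using E(2) by blast
    have "up_exit_within (bound \<omega>) (V \<omega>) (r - r0) r0 (S \<omega> (r0 + 0)) (tail \<omega>)"
    proof (rule up_exit_withinI[of "\<lambda>k. S \<omega> (r0 + k)"])
      show "S \<omega> (r0 + Suc k) = S \<omega> (r0 + k) + tail \<omega> !! k - V \<omega>" for k
        by (simp add: S tail_def to_stream_def algebra_simps)
    qed (use r in auto)
    moreover have "S \<omega> (r0 + 0) = T \<omega> - real r0 * V \<omega>"
      by (simp add: S T_def)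
    ultimately show "\<omega> \<in> ?U"
      using sets.sets_into_space[OF E(1)] \<omega> by auto
  qed
  then have "emeasure M E \<le> emeasure M ?U"
    by (rule emeasure_mono) measurable
  also have "\<dots> \<le> ennreal (g_fun c (n0' + r0 - 2) \<eta>)"
    by (rule prob_up_exit_le)
  finally show ?thesis .
qed

end

section \<open>Marginals of multivariate normal vectors\<close>

text \<open>The shift property says that \<open>exp (z\<^sup>2 / 2)\<close> times the law of \<open>Z\<close> is translation invariant.
  Averaging over the translations in \<open>[0, 1]\<close> shows that it is a multiple of Lebesgue measure.\<close>
lemma (in prob_space) distr_eq_gauss_if_shift:
  fixes Z :: "'a \<Rightarrow> real"
  assumes Z [measurable]: "random_variable borel Z"
    and shift: "\<And>F a. F \<in> borel_measurable borel \<Longrightarrow>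
      (\<integral>\<^sup>+\<omega>. F (Z \<omega>) \<partial>M) = (\<integral>\<^sup>+\<omega>. ennreal (exp (((Z \<omega>)\<^sup>2 - (Z \<omega> + a)\<^sup>2) / 2)) * F (Z \<omega> + a) \<partial>M)"
  shows "distr M borel Z = gauss 1"
proof -
  let ?h = "\<lambda>z. ennreal (exp (z\<^sup>2 / 2))" and ?h' = "\<lambda>z. ennreal (exp (- z\<^sup>2 / 2))"
  let ?k = "indicator {0..1::real} :: real \<Rightarrow> ennreal"
  interpret L: pair_sigma_finite lborel M ..
  define C where "C = (\<integral>\<^sup>+\<omega>. ?h (Z \<omega>) * ?k (- Z \<omega>) \<partial>M)"
  have C: "(\<integral>\<^sup>+\<omega>. ?h (Z \<omega>) * ?k (y - Z \<omega>) \<partial>M) = C" for y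
    unfolding C_def
    by (subst shift[of _ y]) (auto simp: ennreal_mult''[symmetric] exp_add[symmetric] diff_divide_distrib
        mult.assoc[symmetric])
  have eq: "(\<integral>\<^sup>+\<omega>. F (Z \<omega>) \<partial>M) = C * (\<integral>\<^sup>+y. ?h' y * F y \<partial>lborel)"
    if [measurable]: "F \<in> borel_measurable borel" for F
  proof -
    have "(\<integral>\<^sup>+\<omega>. F (Z \<omega>) \<partial>M) = (\<integral>\<^sup>+a. ?k a * (\<integral>\<^sup>+\<omega>. F (Z \<omega>) \<partial>M) \<partial>lborel)"
      by (subst nn_integral_multc) auto
    also have "\<dots> = (\<integral>\<^sup>+a. \<integral>\<^sup>+\<omega>. ?k a * (?h (Z \<omega>) * (?h' (Z \<omega> + a) * F (Z \<omega> + a))) \<partial>M \<partial>lborel)"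
    proof (rule nn_integral_cong)
      fix a :: real
      have "(\<integral>\<^sup>+\<omega>. F (Z \<omega>) \<partial>M) = (\<integral>\<^sup>+\<omega>. ?h (Z \<omega>) * (?h' (Z \<omega> + a) * F (Z \<omega> + a)) \<partial>M)"
        by (subst shift[of _ a])
           (auto simp: ennreal_mult''[symmetric] exp_add[symmetric] diff_divide_distrib mult.assoc[symmetric])
      then show "?k a * (\<integral>\<^sup>+\<omega>. F (Z \<omega>) \<partial>M) = (\<integral>\<^sup>+\<omega>. ?k a * (?h (Z \<omega>) * (?h' (Z \<omega> + a) * F (Z \<omega> + a))) \<partial>M)"
        by (simp add: nn_integral_cmult)
    qed
    also have "\<dots> = (\<integral>\<^sup>+\<omega>. \<integral>\<^sup>+a. ?k a * (?h (Z \<omega>) * (?h' (Z \<omega> + a) * F (Z \<omega> + a))) \<partial>lborel \<partial>M)"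
      by (rule L.Fubini'[symmetric]) simp
    also have "\<dots> = (\<integral>\<^sup>+\<omega>. \<integral>\<^sup>+y. (?h' y * F y) * (?h (Z \<omega>) * ?k (y - Z \<omega>)) \<partial>lborel \<partial>M)"
    proof (rule nn_integral_cong)
      fix \<omega>
      show "(\<integral>\<^sup>+a. ?k a * (?h (Z \<omega>) * (?h' (Z \<omega> + a) * F (Z \<omega> + a))) \<partial>lborel)
        = (\<integral>\<^sup>+y. (?h' y * F y) * (?h (Z \<omega>) * ?k (y - Z \<omega>)) \<partial>lborel)"
        by (subst (2) nn_integral_real_affine[where c=1 and t="Z \<omega>"]) (auto simp: mult_ac)
    qed
    also have "\<dots> = (\<integral>\<^sup>+y. \<integral>\<^sup>+\<omega>. (?h' y * F y) * (?h (Z \<omega>) * ?k (y - Z \<omega>)) \<partial>M \<partial>lborel)"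
      by (rule L.Fubini') simp
    also have "\<dots> = (\<integral>\<^sup>+y. (?h' y * F y) * C \<partial>lborel)"
      by (rule nn_integral_cong) (simp add: nn_integral_cmult C)
    also have "\<dots> = C * (\<integral>\<^sup>+y. ?h' y * F y \<partial>lborel)"
      by (subst nn_integral_multc) (auto simp: mult.commute)
    finally show ?thesis .
  qed
  have dens: "?h' z = ennreal (sqrt (2 * pi)) * ennreal (std_normal_density z)" for z
    by (simp add: std_normal_density_def ennreal_mult''[symmetric])
  define D where "D = C * ennreal (sqrt (2 * pi))"
  have eq': "(\<integral>\<^sup>+\<omega>. F (Z \<omega>) \<partial>M) = D * (\<integral>\<^sup>+y. F y \<partial>gauss 1)"
    if [measurable]: "F \<in> borel_measurable borel" for F
    unfolding eq[OF that] D_def dens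
    by (simp add: nn_integral_gauss nn_integral_cmult mult.assoc)
  interpret G: prob_space "gauss 1" by (rule prob_space_gauss) simp
  have "D = 1"
    using eq'[of "\<lambda>_. 1"] G.emeasure_space_1 by (simp add: emeasure_space_1)
  show ?thesis
  proof (rule measure_eqI)
    fix A assume "A \<in> sets (distr M borel Z)"
    then have [measurable]: "A \<in> sets borel" by simp
    have "emeasure (distr M borel Z) A = (\<integral>\<^sup>+x. indicator A x \<partial>distr M borel Z)"
      by simp
    also have "\<dots> = (\<integral>\<^sup>+\<omega>. indicator A (Z \<omega>) \<partial>M)"
      by (rule nn_integral_distr) auto
    also have "\<dots> = emeasure (gauss 1) A"
      by (subst eq') (auto simp: \<open>D = 1\<close>)
    finally show "emeasure (distr M borel Z) A = emeasure (gauss 1) A" .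
  qed simp
qed

section \<open>Shifts of the multivariate normal density\<close>

lemma positive_definite_inverse:
  fixes \<Sigma> :: "real ^ 's::finite ^ 's"
  assumes "positive_definite \<Sigma>"
  shows "\<Sigma> *v (matrix_inv \<Sigma> *v x) = x" and "matrix_inv \<Sigma> *v (\<Sigma> *v x) = x"
proof -
  have "x = 0" if "\<Sigma> *v x = 0" for x
    using assms that unfolding positive_definite_def by force
  then have "invertible \<Sigma>"
    by (simp add: invertible_left_inverse matrix_left_invertible_ker)
  then have "\<Sigma> ** matrix_inv \<Sigma> = mat 1 \<and> matrix_inv \<Sigma> ** \<Sigma> = mat 1"
    unfolding invertible_def matrix_inv_def by (rule someI_ex)
  then show "\<Sigma> *v (matrix_inv \<Sigma> *v x) = x" "matrix_inv \<Sigma> *v (\<Sigma> *v x) = x"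
    by (simp_all add: matrix_vector_mul_assoc)
qed

lemma positive_definite_diagonal:
  fixes \<Sigma> :: "real ^ 's::finite ^ 's"
  assumes "positive_definite \<Sigma>"
  shows "0 < \<Sigma> $ l $ l"
proof -
  have "axis l 1 \<bullet> (\<Sigma> *v axis l 1) > 0"
    using assms unfolding positive_definite_def by (auto simp: axis_eq_0_iff)
  then show ?thesis
    by (simp add: inner_axis' matrix_vector_mul_component inner_axis)
qed

text \<open>The inverse of \<Sigma> turns the direction \<open>\<Sigma> *v axis l 1\<close> into a
  unit vector, so the quadratic form changes by an amount that involves only the coordinate
  \<open>l\<close>.\<close>

lemma mvn_density_shift:
  fixes \<Sigma> :: "real ^ 's::finite ^ 's"
  assumes pd: "positive_definite \<Sigma>"
  shows "mvn_density \<mu> \<Sigma> (x + s *\<^sub>R (\<Sigma> *v axis l 1))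
    = mvn_density \<mu> \<Sigma> x * exp (- s * (x - \<mu>) $ l - s\<^sup>2 * \<Sigma> $ l $ l / 2)"
proof -
  define b where "b = \<Sigma> *v axis l 1"
  define P where "P = matrix_inv \<Sigma>"
  define z where "z = x - \<mu>"
  have sym: "(\<Sigma> *v x) \<bullet> y = x \<bullet> (\<Sigma> *v y)" for x y
    using pd unfolding positive_definite_def
    by (metis dot_lmul_matrix transpose_matrix_vector)
  have 1: "b \<bullet> (P *v y) = y $ l" for y
    unfolding b_def P_def sym positive_definite_inverse[OF pd] by (simp add: inner_axis')
  have 2: "y \<bullet> (P *v b) = y $ l" for y
    unfolding b_def P_def positive_definite_inverse[OF pd] by (simp add: inner_axis)
  have 3: "b $ l = \<Sigma> $ l $ l"
    by (simp add: b_def matrix_vector_mul_component inner_axis)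
  have "(z + s *\<^sub>R b) \<bullet> (P *v (z + s *\<^sub>R b)) = z \<bullet> (P *v z) + 2 * s * z $ l + s\<^sup>2 * \<Sigma> $ l $ l"
    by (simp add: matrix_vector_right_distrib matrix_vector_mult_scaleR inner_add_left inner_add_right 1 2 3
        power2_eq_square algebra_simps)
  moreover have "x + s *\<^sub>R b - \<mu> = z + s *\<^sub>R b"
    by (simp add: z_def)
  ultimately have "mvn_density \<mu> \<Sigma> (x + s *\<^sub>R b)
      = exp (- (z \<bullet> (P *v z)) / 2 + (- s * z $ l - s\<^sup>2 * \<Sigma> $ l $ l / 2)) / sqrt ((2 * pi) ^ CARD('s) * det \<Sigma>)"
    unfolding mvn_density_def P_def by (simp add: add_divide_distrib diff_divide_distrib algebra_simps)
  then show ?thesis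
    unfolding exp_add by (simp add: mvn_density_def P_def z_def b_def)
qed

text \<open>The marginal law is recognized from its behaviour under shifts; this avoids integrating
  out the other coordinates and evaluating the determinant. \<sigma> may be the negative root, which
  serves for a mean above the threshold.\<close>

lemma (in prob_space) distr_mvn_standardized:
  fixes X :: "'a \<Rightarrow> real ^ 's::finite"
  assumes pd: "positive_definite \<Sigma>"
    and X: "distributed M lborel X (\<lambda>x. ennreal (mvn_density \<mu> \<Sigma> x))"
    and \<sigma>: "\<sigma>\<^sup>2 = \<Sigma> $ l $ l"
  shows "distr M borel (\<lambda>\<omega>. (X \<omega> $ l - \<mu> $ l) / \<sigma>) = gauss 1"
proof (rule distr_eq_gauss_if_shift)
  have [measurable]: "X \<in> borel_measurable M"
    using distributed_measurable[OF X] by simp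
  have [measurable]: "(\<lambda>x :: real ^ 's. x $ l) \<in> borel_measurable borel"
    by (rule borel_measurable_nth)
  have [measurable]: "random_variable borel (\<lambda>\<omega>. X \<omega> $ l)"
    by (rule measurable_compose[OF _ borel_measurable_nth]) measurable
  show "(\<lambda>\<omega>. (X \<omega> $ l - \<mu> $ l) / \<sigma>) \<in> borel_measurable M"
    by measurable
  have \<sigma>0: "\<sigma> \<noteq> 0"
    using positive_definite_diagonal[OF pd, of l] \<sigma> by auto
  fix F :: "real \<Rightarrow> ennreal" and a :: real
  assume F [measurable]: "F \<in> borel_measurable borel"
  let ?Z = "\<lambda>x :: real ^ 's. (x $ l - \<mu> $ l) / \<sigma>" and ?d = "\<lambda>x. ennreal (mvn_density \<mu> \<Sigma> x)"
  \<comment> \<open>With this \<open>s\<close> the standardized coordinate moves by exactly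
    \<open>a\<close>, because \<open>\<Sigma> $ l $ l\<close> is the square of \<sigma>.\<close>
  define s where "s = a / \<sigma>"
  define b where "b = s *\<^sub>R (\<Sigma> *v axis l 1)"
  have b: "b $ l = a * \<sigma>"
    using \<sigma>0 by (simp add: b_def s_def matrix_vector_mul_component inner_axis \<sigma>[symmetric] power2_eq_square)
  have Zb: "?Z (x + b) = ?Z x + a" for x
    using \<sigma>0 by (simp add: b field_simps)
  have [measurable]: "?d \<in> borel_measurable borel"
    using distributed_borel_measurable[OF X] by simp
  have db: "?d (x + b) = ?d x * ennreal (exp (((?Z x)\<^sup>2 - (?Z x + a)\<^sup>2) / 2))" for x
  proof -
    have "- s * (x - \<mu>) $ l - s\<^sup>2 * \<Sigma> $ l $ l / 2 = ((?Z x)\<^sup>2 - (?Z x + a)\<^sup>2) / 2"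
      unfolding \<sigma>[symmetric] s_def using \<sigma>0 by (simp add: power2_eq_square field_simps)
    note ex = this
    show ?thesis
      unfolding b_def mvn_density_shift[OF pd] ex by (rule ennreal_mult'') simp
  qed
  have "(\<integral>\<^sup>+\<omega>. F (?Z (X \<omega>)) \<partial>M) = (\<integral>\<^sup>+x. ?d x * F (?Z x) \<partial>lborel)"
    by (rule distributed_nn_integral[OF X, symmetric]) measurable
  also have "\<dots> = (\<integral>\<^sup>+x. ?d x * F (?Z x) \<partial>distr lborel borel ((+) b))"
    by (simp only: lborel_distr_plus)
  also have "\<dots> = (\<integral>\<^sup>+x. ?d (x + b) * F (?Z (x + b)) \<partial>lborel)"
    by (subst nn_integral_distr) (auto simp: add.commute)
  also have "\<dots> = (\<integral>\<^sup>+x. ?d x * (ennreal (exp (((?Z x)\<^sup>2 - (?Z x + a)\<^sup>2) / 2)) * F (?Z x + a)) \<partial>lborel)"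
    unfolding Zb db by (simp only: mult.assoc)
  also have "\<dots> = (\<integral>\<^sup>+\<omega>. ennreal (exp (((?Z (X \<omega>))\<^sup>2 - (?Z (X \<omega>) + a)\<^sup>2) / 2)) * F (?Z (X \<omega>) + a) \<partial>M)"
    by (rule distributed_nn_integral[OF X]) measurable
  finally show "(\<integral>\<^sup>+\<omega>. F (?Z (X \<omega>)) \<partial>M)
    = (\<integral>\<^sup>+\<omega>. ennreal (exp (((?Z (X \<omega>))\<^sup>2 - (?Z (X \<omega>) + a)\<^sup>2) / 2)) * F (?Z (X \<omega>) + a) \<partial>M)" .
qed

section \<open>The procedure\<close>

lemma all_phase: "(\<forall>t. Q t) \<longleftrightarrow> Q First \<and> Q Second" and ex_phase: "(\<exists>t. Q t) \<longleftrightarrow> Q First \<or> Q Second"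
  by (metis phase.exhaust)+

lemma all_decision: "(\<forall>d. Q d) \<longleftrightarrow> Q Feasible \<and> Q Infeasible"
  by (metis decision.exhaust)

lemma sample_mean_cong: "(\<And>j. j \<in> {1..n} \<Longrightarrow> x j = y j) \<Longrightarrow> sample_mean n x = sample_mean n y"
  by (simp add: sample_mean_def)

lemma sample_var_cong: "(\<And>j. j \<in> {1..n} \<Longrightarrow> x j = y j) \<Longrightarrow> sample_var n x = sample_var n y"
  by (simp add: sample_var_def sample_mean_def)

lemma tolerance_cong:
  assumes "\<And>j. j \<in> {1..n} \<Longrightarrow> x j = y j"
  shows "tolerance n \<nu> q e x t = tolerance n \<nu> q e y t"
  using sample_mean_cong[OF assms] by (cases t) (simp_all add: xi_hat_def delta_hat_def)

text \<open>The procedure reads only observations indexed by \<open>obs_index\<close>. This allows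
  its events to be expressed through the restricted families in which
  \<open>systems_independent\<close> is stated.\<close>

lemma declares_cong:
  assumes x': "\<And>j. j \<in> {1..n0'} \<Longrightarrow> x' j = y' j" and x: "\<And>j. 1 \<le> j \<Longrightarrow> x j = y j"
  shows "declares n0' n0'' c \<eta> \<nu> q e tie x' x d = declares n0' n0'' c \<eta> \<nu> q e tie y' y d"
proof -
  have "pooled_var n0' n0'' x' x = pooled_var n0' n0'' y' y"
    using sample_var_cong[of n0' x' y'] sample_var_cong[of n0'' x y] assms
    by (simp add: pooled_var_def)
  moreover have "tolerance n0' \<nu> q e x' = tolerance n0' \<nu> q e y'"
    using tolerance_cong[OF x'] by (intro ext)
  moreover have "(\<Sum>j=1..m. x j) = (\<Sum>j=1..m. y j)" for m
    using x by (intro sum.cong) auto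
  ultimately show ?thesis
    unfolding declares_def agree_by_def by presburger
qed

section \<open>Measurability of the procedure\<close>

lemma measurable_sample_mean:
  assumes "\<And>j. j \<in> {1..n} \<Longrightarrow> (\<lambda>\<omega>. x \<omega> j) \<in> borel_measurable M"
  shows "(\<lambda>\<omega>. sample_mean n (x \<omega>)) \<in> borel_measurable M"
  unfolding sample_mean_def using assms by (intro borel_measurable_divide borel_measurable_sum) auto

lemma measurable_sample_var:
  assumes "\<And>j. j \<in> {1..n} \<Longrightarrow> (\<lambda>\<omega>. x \<omega> j) \<in> borel_measurable M"
  shows "(\<lambda>\<omega>. sample_var n (x \<omega>)) \<in> borel_measurable M"
  unfolding sample_var_def using assms
  by (intro borel_measurable_divide borel_measurable_sum borel_measurable_power borel_measurable_diff
      measurable_sample_mean) auto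

lemma measurable_tolerance:
  assumes "\<And>j. j \<in> {1..n} \<Longrightarrow> (\<lambda>\<omega>. x \<omega> j) \<in> borel_measurable M"
  shows "(\<lambda>\<omega>. tolerance n \<nu> q e (x \<omega>) t) \<in> borel_measurable M"
proof -
  note [measurable] = measurable_sample_mean[OF assms]
  show ?thesis
    by (cases t) (simp_all add: xi_hat_def delta_hat_def)
qed

lemma measurable_subroutine_stops:
  assumes [measurable]: "\<And>r. (\<lambda>\<omega>. S \<omega> r) \<in> borel_measurable M" "\<And>r. (\<lambda>\<omega>. R \<omega> r) \<in> borel_measurable M"
  shows "Measurable.pred M (\<lambda>\<omega>. subroutine_stops r0 (S \<omega>) (R \<omega>) r d)"
proof -
  have "d = (if P then Feasible else Infeasible) \<longleftrightarrow> (if d = Feasible then P else \<not> P)" for P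
    by (cases d) auto
  then show ?thesis
    unfolding subroutine_stops_def by (cases "d = Feasible") simp_all
qed

text \<open>The form \<open>a + b * tolerance\<close> covers both subroutines, with
  \<open>b = - 1\<close> and \<open>b = 1\<close>.\<close>

lemma
  assumes x': "\<And>j. j \<in> {1..n0'} \<Longrightarrow> (\<lambda>\<omega>. x' \<omega> j) \<in> borel_measurable M"
    and x: "\<And>j. 1 \<le> j \<Longrightarrow> (\<lambda>\<omega>. x \<omega> j) \<in> borel_measurable M"
  shows measurable_subroutine_stops_tolerance:
    "Measurable.pred M (\<lambda>\<omega>. subroutine_stops r0
      (\<lambda>m. (\<Sum>j=1..m. x \<omega> j) - real m * (a + b * tolerance n0' \<nu> q e (x' \<omega>) t))
      (\<lambda>m. boundary c (real m) (tolerance n0' \<nu> q e (x' \<omega>) t) w (pooled_var n0' n0'' (x' \<omega>) (x \<omega>))) r d)"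
    (is "Measurable.pred M (\<lambda>\<omega>. ?stop r0 a b w t r d \<omega>)")
    and measurable_declares:
    "Measurable.pred M (\<lambda>\<omega>. declares n0' n0'' c \<eta> \<nu> q e tie (x' \<omega>) (x \<omega>) d)"
proof -
  have [measurable]: "(\<lambda>\<omega>. sample_var n0' (x' \<omega>)) \<in> borel_measurable M"
    "(\<lambda>\<omega>. sample_var n0'' (x \<omega>)) \<in> borel_measurable M"
    "(\<lambda>\<omega>. tolerance n0' \<nu> q e (x' \<omega>) t) \<in> borel_measurable M"
    "(\<lambda>\<omega>. \<Sum>j=1..m. x \<omega> j) \<in> borel_measurable M" for t m
    using assms by (auto intro!: measurable_sample_var measurable_tolerance borel_measurable_sum)
  have [measurable]: "(\<lambda>\<omega>. pooled_var n0' n0'' (x' \<omega>) (x \<omega>)) \<in> borel_measurable M"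
    unfolding pooled_var_def by (cases "2 \<le> n0''") simp_all
  have stop: "Measurable.pred M (\<lambda>\<omega>. ?stop r0 a b w t r d \<omega>)" for r0 a b t w r d
    by (rule measurable_subroutine_stops) (unfold boundary_def, measurable)
  then show "Measurable.pred M (\<lambda>\<omega>. ?stop r0 a b w t r d \<omega>)" .
  from stop[of _ _ 1] stop[of _ _ "-1"]
  have "Measurable.pred M (\<lambda>\<omega>. agree_by m c w (pooled_var n0' n0'' (x' \<omega>) (x \<omega>))
      q e (x \<omega>) (tolerance n0' \<nu> q e (x' \<omega>) t) r d)" for m w t r d
    unfolding agree_by_def by (intro pred_intros_countable pred_intros_logic) simp_all
  then show "Measurable.pred M (\<lambda>\<omega>. declares n0' n0'' c \<eta> \<nu> q e tie (x' \<omega>) (x \<omega>) d)"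
    unfolding declares_def Let_def all_phase ex_phase all_decision
    by (intro pred_intros_countable pred_intros_logic) (simp_all del: tolerance.simps)
qed

text \<open>The boundary is \<open>0\<close> from some time on, and then one of the two stopping
  conditions holds.\<close>

lemma subroutine_stops_exists:
  assumes "0 < v" and "1 \<le> c"
  shows "\<exists>r d. subroutine_stops r0 S (\<lambda>m. boundary c (real m) v w z) r d"
proof -
  let ?R = "\<lambda>m. boundary c (real m) v w z"
  let ?stop = "\<lambda>r. r0 \<le> r \<and> (S r \<le> - ?R r \<or> S r \<ge> ?R r)"
  obtain N :: nat where N: "w * z / (2 * real c * v) / (v / (2 * real c)) \<le> real N"
    using real_arch_simple by blast
  have "w * z / (2 * real c * v) \<le> v / (2 * real c) * real (max r0 N)"
  proof -
    have "w * z / (2 * real c * v) / (v / (2 * real c)) \<le> real (max r0 N)"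
      using N by simp
    then show ?thesis
      using assms by (subst (asm) pos_divide_le_eq) (auto simp: mult.commute)
  qed
  then have "?R (max r0 N) = 0"
    by (simp add: boundary_def)
  then have ex: "?stop (max r0 N)" by auto
  define r where "r = (LEAST r. ?stop r)"
  have "?stop r"
    unfolding r_def by (rule LeastI[of ?stop, OF ex])
  moreover have "\<not> ?stop r'" if "r' < r" for r'
    using that not_less_Least unfolding r_def by blast
  ultimately show ?thesis
    unfolding subroutine_stops_def by blast
qed

lemma subroutine_stops_unique:
  assumes "subroutine_stops r0 S R r d" and "subroutine_stops r0 S R r' d'"
  shows "d = d'"
proof -
  have "r = r'"
    using assms unfolding subroutine_stops_def by (metis linorder_neqE_nat)
  then show ?thesis
    using assms by (simp add: subroutine_stops_def)
qed

lemma agree_by_unique: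
  "agree_by r0 c w z q e x v r d \<Longrightarrow> agree_by r0 c w z q e x v r d' \<Longrightarrow> d = d'"
  unfolding agree_by_def by (blast dest: subroutine_stops_unique)

text \<open>With the second tolerance both subroutines monitor the same statistic, so they agree.\<close>
lemma declares_exists:
  assumes "0 < e" and "1 \<le> c"
  shows "\<exists>d. declares n0' n0'' c \<eta> \<nu> q e tie x' x d"
proof -
  define A where "A t = agree_by (max n0'' 1) c (h_sq c \<eta> (dof n0' n0'')) (pooled_var n0' n0'' x' x)
                     q e x (tolerance n0' \<nu> q e x' t)" for t
  have unique: "A t r d \<Longrightarrow> A t r d' \<Longrightarrow> d = d'" for t r d d'
    unfolding A_def by (rule agree_by_unique)
  obtain r0 d0 where stop: "subroutine_stops (max n0'' 1) (\<lambda>m. (\<Sum>j=1..m. x j) - real m * q)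
      (\<lambda>m. boundary c (real m) e (h_sq c \<eta> (dof n0' n0'')) (pooled_var n0' n0'' x' x)) r0 d0"
    using subroutine_stops_exists[OF assms] by blast
  have "A Second r0 d0"
    unfolding A_def agree_by_def using stop by (intro conjI exI[of _ r0]) simp_all
  then have ex: "\<exists>t d. A t r0 d" by blast
  define r where "r = (LEAST r. \<exists>t d. A t r d)"
  have "\<exists>t d. A t r d"
    unfolding r_def by (rule LeastI[of "\<lambda>r. \<exists>t d. A t r d", OF ex])
  then obtain t d where td: "A t r d" by blast
  have first: "\<not> A t' r' d'" if "r' < r" for r' t' d'
    using that not_less_Least unfolding r_def by blast
  have "\<exists>t d. A t r d \<and> (\<forall>d1 d2. A First r d1 \<and> A Second r d2 \<longrightarrow> t = tie r d1 d2)"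
  proof (cases "\<exists>d1 d2. A First r d1 \<and> A Second r d2")
    case True
    then obtain d1 d2 where d: "A First r d1" "A Second r d2" by blast
    then have "\<exists>d. A (tie r d1 d2) r d"
      by (cases "tie r d1 d2") auto
    moreover have "tie r d1 d2 = tie r e1 e2" if "A First r e1" "A Second r e2" for e1 e2
      using unique[OF d(1) that(1)] unique[OF d(2) that(2)] by simp
    ultimately show ?thesis by blast
  next
    case False
    then show ?thesis using td by blast
  qed
  then show ?thesis
    unfolding declares_def Let_def A_def[symmetric] using first by blast
qed

text \<open>What is kept of a declaration is that with some tolerance both subroutines reached the
  declared decision. When this happened and how a tie was broken is given up; the union over the two
  tolerances pays for it.\<close>

lemma declaresE:
  assumes "declares n0' n0'' c \<eta> \<nu> q e tie x' x d"
  obtains t rU rD where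
    "subroutine_stops (max n0'' 1) (\<lambda>m. (\<Sum>j=1..m. x j) - real m * (q + e - tolerance n0' \<nu> q e x' t))
      (\<lambda>m. boundary c (real m) (tolerance n0' \<nu> q e x' t) (h_sq c \<eta> (dof n0' n0'')) (pooled_var n0' n0'' x' x)) rU d"
    "subroutine_stops (max n0'' 1) (\<lambda>m. (\<Sum>j=1..m. x j) - real m * (q - e + tolerance n0' \<nu> q e x' t))
      (\<lambda>m. boundary c (real m) (tolerance n0' \<nu> q e x' t) (h_sq c \<eta> (dof n0' n0'')) (pooled_var n0' n0'' x' x)) rD d"
  using assms unfolding declares_def Let_def agree_by_def by blast

lemma tolerance_pos: "0 < e \<Longrightarrow> 0 < \<nu> \<Longrightarrow> 0 < tolerance n \<nu> q e x t"
  by (cases t) (auto simp: xi_hat_def intro!: mult_pos_pos)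

text \<open>Take the first time at which \<open>S2\<close> reaches the upper boundary; it is not
  later than \<open>r\<close>. Before it \<open>S1\<close> has stayed above the lower boundary,
  hence so has \<open>S2\<close>. This passes from the true mean to the worst case and removes the
  scale \<open>k\<close> at the same time.\<close>

lemma upper_exit_mono:
  fixes S1 S2 R1 R2 :: "nat \<Rightarrow> real"
  assumes k: "0 < k" and S: "\<And>r. S1 r \<le> k * S2 r" and R: "\<And>r. R1 r = k * R2 r"
    and r: "r0 \<le> r" "R1 r \<le> S1 r" "\<And>r'. r0 \<le> r' \<Longrightarrow> r' < r \<Longrightarrow> \<bar>S1 r'\<bar> < R1 r'"
  shows "\<exists>r\<ge>r0. R2 r \<le> S2 r \<and> (\<forall>r'. r0 \<le> r' \<and> r' < r \<longrightarrow> \<bar>S2 r'\<bar> < R2 r')"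
proof -
  let ?stop = "\<lambda>r. r0 \<le> r \<and> R2 r \<le> S2 r"
  have "k * R2 r \<le> k * S2 r"
    using r(2) S[of r] R[of r] by linarith
  then have ex: "?stop r" using k r(1) by simp
  define r1 where "r1 = (LEAST r. ?stop r)"
  have stop: "?stop r1"
    unfolding r1_def by (rule LeastI[of ?stop, OF ex])
  have "r1 \<le> r"
    unfolding r1_def using ex by (rule Least_le)
  have "\<bar>S2 r'\<bar> < R2 r'" if r': "r0 \<le> r'" "r' < r1" for r'
  proof -
    have "\<not> ?stop r'"
      using r'(2) not_less_Least unfolding r1_def by blast
    then have 1: "S2 r' < R2 r'" using r' by simp
    have "\<bar>S1 r'\<bar> < R1 r'"
      using r(3)[of r'] r' \<open>r1 \<le> r\<close> by simp
    then have "- R1 r' < k * S2 r'"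
      using S[of r'] by linarith
    then have "k * (- R2 r') < k * S2 r'"
      using R[of r'] by simp
    then have "- R2 r' < S2 r'"
      using k by (simp only: mult_less_cancel_left_pos)
    with 1 show ?thesis by linarith
  qed
  with stop show ?thesis by blast
qed

lemma sum_sq_dev_affine:
  assumes "1 \<le> n"
  shows "sum_sq_dev n (\<lambda>j. a + b * x j) = b\<^sup>2 * sum_sq_dev n x"
proof -
  have "sample_mean n (\<lambda>j. a + b * x j) = a + b * sample_mean n x"
    using assms by (simp add: sample_mean_def sum.distrib sum_distrib_left[symmetric] add_divide_distrib)
  then show ?thesis
    unfolding sum_sq_dev_def sum_distrib_left
    by (intro sum.cong) (simp_all add: power_mult_distrib[symmetric] right_diff_distrib)
qed

text \<open>For \<open>n0'' = 0\<close> the last sum of squares has a single observation and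
  vanishes. So the first monitored time \<open>max n0'' 1\<close> is also the right sample size
  here, and the case is not treated separately afterwards.\<close>

lemma dof_mult_pooled_var:
  assumes "2 \<le> n0'" and "n0'' \<noteq> 1"
  shows "real (dof n0' n0'') * pooled_var n0' n0'' x' x = sum_sq_dev n0' x' + sum_sq_dev (max n0'' 1) x"
proof -
  have sv: "(real n - 1) * sample_var n y = sum_sq_dev n y" if "2 \<le> n" for n and y :: "nat \<Rightarrow> real"
    using that by (simp add: sample_var_def sum_sq_dev_def)
  show ?thesis
  proof (cases "2 \<le> n0''")
    case True
    define D where "D = real n0' + real n0'' - 2"
    have D: "D \<noteq> 0" "real (dof n0' n0'') = D"
      using True assms by (simp_all add: D_def dof_def of_nat_diff)
    have "real (dof n0' n0'') * pooled_var n0' n0'' x' x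
        = (real n0' - 1) * sample_var n0' x' + (real n0'' - 1) * sample_var n0'' x"
      using D True by (simp add: pooled_var_def D_def[symmetric] distrib_left)
    then show ?thesis
      using True assms by (simp add: sv)
  next
    case False
    then show ?thesis
      using assms sv[of n0' x'] by (simp add: pooled_var_def dof_def of_nat_diff)
  qed
qed

lemma subroutine_stops_InfeasibleD:
  assumes "subroutine_stops r0 S R r Infeasible"
  shows "\<exists>r\<ge>r0. R r \<le> S r \<and> (\<forall>r'. r0 \<le> r' \<and> r' < r \<longrightarrow> \<bar>S r'\<bar> < R r')"
proof -
  have "r0 \<le> r" "R r \<le> S r"
    using assms by (auto simp: subroutine_stops_def split: if_splits)
  moreover have "\<bar>S r'\<bar> < R r'" if "r0 \<le> r'" "r' < r" for r'
    using assms that by (force simp: subroutine_stops_def)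
  ultimately show ?thesis by blast
qed

lemma subroutine_stops_FeasibleD:
  assumes "subroutine_stops r0 S R r Feasible"
  shows "\<exists>r\<ge>r0. R r \<le> - S r \<and> (\<forall>r'. r0 \<le> r' \<and> r' < r \<longrightarrow> \<bar>- S r'\<bar> < R r')"
proof -
  have "r0 \<le> r" "R r \<le> - S r"
    using assms by (auto simp: subroutine_stops_def split: if_splits)
  moreover have "\<bar>- S r'\<bar> < R r'" if "r0 \<le> r'" "r' < r" for r'
    using assms that by (force simp: subroutine_stops_def)
  ultimately show ?thesis by blast
qed

text \<open>One lemma for both kinds of error: for a mean above the threshold, \<open>S\<close> is
  the negated statistic and \<sigma> the negative root. \<open>S\<close> is only bounded above by
  the walk with drift \<open>- tolerance\<close>, since a mean further from the threshold makes an
  error less likely.\<close>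

lemma (in prob_space) emeasure_upper_exit_le:
  fixes X' X :: "nat \<Rightarrow> 'a \<Rightarrow> real ^ 's::finite"
  assumes pd: "positive_definite \<Sigma>"
    and iid: "iid_mvn M (obs_index n0') (case_sum X' X) \<mu> \<Sigma>"
    and n: "2 \<le> n0'" "n0'' \<noteq> 1" and c: "1 \<le> c" and pos: "0 < \<nu>" "0 < e" "0 < \<eta>"
    and \<sigma>: "\<sigma>\<^sup>2 = \<Sigma> $ l $ l"
    and S: "\<And>\<omega> r. S \<omega> r \<le> sgn \<sigma> * (\<Sum>j=1..r. X j \<omega> $ l - \<mu> $ l) - real r * tolerance n0' \<nu> q e (\<lambda>j. X' j \<omega> $ l) t"
    and R: "\<And>\<omega> r. R \<omega> r = boundary c (real r) (tolerance n0' \<nu> q e (\<lambda>j. X' j \<omega> $ l) t) (h_sq c \<eta> (dof n0' n0''))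
      (pooled_var n0' n0'' (\<lambda>j. X' j \<omega> $ l) (\<lambda>j. X j \<omega> $ l))"
    and E: "E \<in> events" "\<And>\<omega>. \<omega> \<in> E \<Longrightarrow> \<exists>r\<ge>max n0'' 1. R \<omega> r \<le> S \<omega> r \<and>
      (\<forall>r'. max n0'' 1 \<le> r' \<and> r' < r \<longrightarrow> \<bar>S \<omega> r'\<bar> < R \<omega> r')"
  shows "emeasure M E \<le> ennreal (g_fun c (dof n0' n0'') \<eta>)"
proof -
  have \<sigma>0: "\<sigma> \<noteq> 0"
    using positive_definite_diagonal[OF pd, of l] \<sigma> by auto
  define Z where "Z p \<omega> = (case_sum X' X p \<omega> $ l - \<mu> $ l) / \<sigma>" for p \<omega>
  \<comment> \<open>\<open>w\<close> rebuilds the raw first-stage sample from the standardized one,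
    computes its tolerance and rescales that to unit variance.\<close>
  define w where "w x = tolerance n0' \<nu> q e (\<lambda>j. \<mu> $ l + \<sigma> * x j) t / \<bar>\<sigma>\<bar>" for x
  interpret mon: monitored_sample M Z n0' "max n0'' 1" c \<eta> w
  proof
    show "indep_vars (\<lambda>_. borel) Z (obs_index n0')"
    proof -
      have [measurable]: "(\<lambda>x :: real ^ 's. x $ l) \<in> borel_measurable borel"
        by (rule borel_measurable_nth)
      have "indep_vars (\<lambda>_. borel) (\<lambda>p \<omega>. (\<lambda>x. (x $ l - \<mu> $ l) / \<sigma>) (case_sum X' X p \<omega>)) (obs_index n0')"
        using iid unfolding iid_mvn_def
        by (intro indep_vars_compose2[where M'="\<lambda>_. borel" and X="case_sum X' X"
              and Y="\<lambda>_ x. (x $ l - \<mu> $ l) / \<sigma>"]) simp_all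
      then show ?thesis by (simp add: Z_def[abs_def])
    qed
    show "distr M borel (Z p) = gauss 1" if "p \<in> obs_index n0'" for p
      using distr_mvn_standardized[OF pd _ \<sigma>, of "case_sum X' X p" \<mu>] iid that
      by (simp add: iid_mvn_def Z_def[abs_def])
    show "w \<in> borel_measurable (PiM {1..n0'} (\<lambda>_. borel))"
      unfolding w_def
      by (intro borel_measurable_divide measurable_tolerance borel_measurable_add borel_measurable_times
          measurable_component_singleton) auto
    show "0 < w x" for x
      using \<sigma>0 tolerance_pos[OF pos(2,1)] by (simp add: w_def)
  qed (use n c pos in auto)
  define v where "v \<omega> = tolerance n0' \<nu> q e (\<lambda>j. X' j \<omega> $ l) t" for \<omega>
  have v: "0 < v \<omega>" for \<omega>
    unfolding v_def by (rule tolerance_pos[OF pos(2,1)])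
  have XZ: "X' j \<omega> $ l = \<mu> $ l + \<sigma> * Z (Inl j) \<omega>" "X j \<omega> $ l = \<mu> $ l + \<sigma> * Z (Inr j) \<omega>" for j \<omega>
    using \<sigma>0 by (simp_all add: Z_def)
  have V: "mon.V \<omega> = v \<omega> / \<bar>\<sigma>\<bar>" for \<omega>
    unfolding mon.V_def w_def v_def XZ
    by (intro arg_cong2[where f="(/)"] tolerance_cong refl) auto
  have dofQ: "real (dof n0' n0'') * pooled_var n0' n0'' (\<lambda>j. X' j \<omega> $ l) (\<lambda>j. X j \<omega> $ l)
      = \<sigma>\<^sup>2 * (mon.Q' \<omega> + mon.Q \<omega>)" for \<omega>
    unfolding dof_mult_pooled_var[OF n] XZ mon.Q'_def mon.Q_def
    using n by (subst (1 2) sum_sq_dev_affine) (auto simp: distrib_left)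
  have R_eq: "R \<omega> r = \<bar>\<sigma>\<bar> * mon.bound \<omega> r" for \<omega> r
  proof -
    have "h_sq c \<eta> (dof n0' n0'') * pooled_var n0' n0'' (\<lambda>j. X' j \<omega> $ l) (\<lambda>j. X j \<omega> $ l) / (2 * real c * v \<omega>)
      = \<eta> * (real (dof n0' n0'') * pooled_var n0' n0'' (\<lambda>j. X' j \<omega> $ l) (\<lambda>j. X j \<omega> $ l)) / v \<omega>"
      using c by (simp add: h_sq_def)
    also have "\<dots> = \<bar>\<sigma>\<bar> * (\<eta> * (mon.Q' \<omega> + mon.Q \<omega>) / mon.V \<omega>)"
      unfolding dofQ V by (simp add: power2_eq_square abs_mult_self_eq[of \<sigma>, symmetric] del: abs_mult_self_eq)
    finally have 1: "h_sq c \<eta> (dof n0' n0'') * pooled_var n0' n0'' (\<lambda>j. X' j \<omega> $ l) (\<lambda>j. X j \<omega> $ l) / (2 * real c * v \<omega>)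
      = \<bar>\<sigma>\<bar> * (\<eta> * (mon.Q' \<omega> + mon.Q \<omega>) / mon.V \<omega>)" .
    have 2: "v \<omega> / (2 * real c) * real r = \<bar>\<sigma>\<bar> * (mon.V \<omega> / (2 * real c) * real r)"
      using \<sigma>0 by (simp add: V)
    show ?thesis
      unfolding R boundary_def v_def[symmetric] 1 2 right_diff_distrib[symmetric] mon.bound_def
      using max_mult_distrib_left[of "\<bar>\<sigma>\<bar>" 0] by simp
  qed
  define T where "T \<omega> r = (\<Sum>j=1..r. Z (Inr j) \<omega>) - real r * mon.V \<omega>" for \<omega> r
  have S_le: "S \<omega> r \<le> \<bar>\<sigma>\<bar> * T \<omega> r" for \<omega> r
  proof -
    have "sgn \<sigma> * (\<Sum>j=1..r. X j \<omega> $ l - \<mu> $ l) = \<bar>\<sigma>\<bar> * (\<Sum>j=1..r. Z (Inr j) \<omega>)"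
      unfolding XZ sum_distrib_left by (intro sum.cong) (simp_all add: abs_sgn mult_ac)
    then show ?thesis
      using S[of \<omega> r] \<sigma>0 by (simp add: T_def V right_diff_distrib v_def)
  qed
  have "emeasure M E \<le> ennreal (g_fun c (n0' + max n0'' 1 - 2) \<eta>)"
  proof (rule mon.prob_upper_exit_le[of T E, OF _ E(1)])
    fix \<omega> assume "\<omega> \<in> E"
    from E(2)[OF this] obtain r where r: "max n0'' 1 \<le> r" "R \<omega> r \<le> S \<omega> r"
      "\<And>r'. max n0'' 1 \<le> r' \<Longrightarrow> r' < r \<Longrightarrow> \<bar>S \<omega> r'\<bar> < R \<omega> r'"
      by blast
    show "\<exists>r\<ge>max n0'' 1. mon.bound \<omega> r \<le> T \<omega> r \<and>
        (\<forall>r'. max n0'' 1 \<le> r' \<and> r' < r \<longrightarrow> \<bar>T \<omega> r'\<bar> < mon.bound \<omega> r')"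
      by (rule upper_exit_mono[of "\<bar>\<sigma>\<bar>" "S \<omega>" _ "R \<omega>"]) (use \<sigma>0 S_le R_eq r in auto)
  qed (simp add: T_def)
  also have "n0' + max n0'' 1 - 2 = dof n0' n0''"
    using n by (auto simp: dof_def)
  finally show ?thesis .
qed

lemma (in prob_space) prob_incorrect_le:
  fixes X' X :: "nat \<Rightarrow> 'a \<Rightarrow> real ^ 's::finite"
  assumes pd: "positive_definite \<Sigma>"
    and iid: "iid_mvn M (obs_index n0') (case_sum X' X) \<mu> \<Sigma>"
    and n: "2 \<le> n0'" "n0'' \<noteq> 1" and c: "1 \<le> c" and pos: "0 < \<nu>" "0 < e" "0 < \<eta>"
    and g: "0 \<le> g_fun c (dof n0' n0'') \<eta>"
  shows "prob {\<omega> \<in> space M. \<not> correct_decision (\<mu> $ l) q e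
      (declares n0' n0'' c \<eta> \<nu> q e tie (\<lambda>j. X' j \<omega> $ l) (\<lambda>j. X j \<omega> $ l))}
    \<le> 2 * g_fun c (dof n0' n0'') \<eta>" (is "prob ?bad \<le> _")
proof -
  let ?x' = "\<lambda>\<omega> j. X' j \<omega> $ l" and ?x = "\<lambda>\<omega> j. X j \<omega> $ l"
  let ?v = "\<lambda>\<omega>. tolerance n0' \<nu> q e (?x' \<omega>)"
  let ?stop = "\<lambda>s t r d \<omega>. subroutine_stops (max n0'' 1)
    (\<lambda>m. (\<Sum>j=1..m. ?x \<omega> j) - real m * (q + s * e + - s * ?v \<omega> t))
    (\<lambda>m. boundary c (real m) (?v \<omega> t) (h_sq c \<eta> (dof n0' n0'')) (pooled_var n0' n0'' (?x' \<omega>) (?x \<omega>))) r d"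
  have rv: "random_variable borel (\<lambda>\<omega>. X' j \<omega> $ l)" if "j \<in> {1..n0'}" for j
  proof -
    have "Inl j \<in> obs_index n0'" using that by (auto simp: obs_index_def)
    then have "random_variable borel (X' j)"
      using iid unfolding iid_mvn_def indep_vars_def by force
    then show ?thesis by (rule measurable_compose[OF _ borel_measurable_nth])
  qed
  have rv': "random_variable borel (\<lambda>\<omega>. X j \<omega> $ l)" if "1 \<le> j" for j
  proof -
    have "Inr j \<in> obs_index n0'" using that by (auto simp: obs_index_def)
    then have "random_variable borel (X j)"
      using iid unfolding iid_mvn_def indep_vars_def by force
    then show ?thesis by (rule measurable_compose[OF _ borel_measurable_nth])
  qed
  \<comment> \<open>\<open>s = 1\<close> selects the subroutine centred at \<open>q + e - v\<close>,
    \<open>s = - 1\<close> the one centred at \<open>q - e + v\<close>. For each kind of error a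
    single one of them is followed.\<close>
  define E where "E s d t = {\<omega> \<in> space M. \<exists>r. ?stop s t r d \<omega>}" for s t d
  have E: "E s d t \<in> events" for s d t
  proof -
    have "Measurable.pred M (\<lambda>\<omega>. \<exists>r. ?stop s t r d \<omega>)"
      by (intro pred_intros_countable measurable_subroutine_stops_tolerance rv rv')
    then show ?thesis by (simp add: E_def pred_def)
  qed
  have two: "prob ?bad \<le> 2 * g_fun c (dof n0' n0'') \<eta>"
    if sub: "?bad \<subseteq> E s d First \<union> E s d Second"
      and le: "\<And>t. emeasure M (E s d t) \<le> ennreal (g_fun c (dof n0' n0'') \<eta>)" for s d
  proof -
    have "prob ?bad \<le> prob (E s d First \<union> E s d Second)"
      using sub E by (intro finite_measure_mono) auto
    also have "\<dots> \<le> prob (E s d First) + prob (E s d Second)"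
      by (rule measure_Un_le) (rule E)+
    also have "\<dots> \<le> 2 * g_fun c (dof n0' n0'') \<eta>"
      using le[of First] le[of Second] g by (simp add: emeasure_eq_measure)
    finally show ?thesis .
  qed
  have declared: "\<omega> \<in> E s d First \<union> E s d Second"
    if "\<omega> \<in> space M" "declares n0' n0'' c \<eta> \<nu> q e tie (?x' \<omega>) (?x \<omega>) d" "s = 1 \<or> s = - 1" for \<omega> s d
    using that(2)
  proof (rule declaresE)
    fix t rU rD
    assume a: "subroutine_stops (max n0'' 1) (\<lambda>m. (\<Sum>j=1..m. ?x \<omega> j) - real m * (q + e - ?v \<omega> t))
      (\<lambda>m. boundary c (real m) (?v \<omega> t) (h_sq c \<eta> (dof n0' n0'')) (pooled_var n0' n0'' (?x' \<omega>) (?x \<omega>))) rU d"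
    "subroutine_stops (max n0'' 1) (\<lambda>m. (\<Sum>j=1..m. ?x \<omega> j) - real m * (q - e + ?v \<omega> t))
      (\<lambda>m. boundary c (real m) (?v \<omega> t) (h_sq c \<eta> (dof n0' n0'')) (pooled_var n0' n0'' (?x' \<omega>) (?x \<omega>))) rD d"
    have "\<exists>r. ?stop s t r d \<omega>"
      using that(3) a by (auto simp del: tolerance.simps)
    then show ?thesis
      using that(1) by (cases t) (auto simp: E_def simp del: tolerance.simps)
  qed
  obtain \<sigma> where \<sigma>: "0 < \<sigma>" "\<sigma>\<^sup>2 = \<Sigma> $ l $ l"
    using positive_definite_diagonal[OF pd, of l] by (intro that[of "sqrt (\<Sigma> $ l $ l)"]) auto
  \<comment> \<open>Absence of the correct declaration could also mean that nothing is declared;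
    \<open>declares_exists\<close> rules this out, so the opposite decision is declared.\<close>
  have other: "\<exists>d'. d' \<noteq> d \<and> declares n0' n0'' c \<eta> \<nu> q e tie x' x d'"
    if "\<not> declares n0' n0'' c \<eta> \<nu> q e tie x' x d" for x' x d
    using declares_exists[OF pos(2) c] that by metis
  consider "\<mu> $ l \<le> q - e" | "q + e \<le> \<mu> $ l" | "q - e < \<mu> $ l" "\<mu> $ l < q + e"
    by linarith
  then show ?thesis
  proof cases
    case 1
    have "?bad \<subseteq> E (- 1) Infeasible First \<union> E (- 1) Infeasible Second"
    proof
      fix \<omega> assume "\<omega> \<in> ?bad"
      then have \<omega>: "\<omega> \<in> space M" "\<not> declares n0' n0'' c \<eta> \<nu> q e tie (?x' \<omega>) (?x \<omega>) Feasible"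
        using 1 pos by (auto simp: correct_decision_def)
      from other[OF \<omega>(2)] obtain d where "d \<noteq> Feasible" "declares n0' n0'' c \<eta> \<nu> q e tie (?x' \<omega>) (?x \<omega>) d"
        by blast
      then have "declares n0' n0'' c \<eta> \<nu> q e tie (?x' \<omega>) (?x \<omega>) Infeasible"
        by (cases d) auto
      then show "\<omega> \<in> E (- 1) Infeasible First \<union> E (- 1) Infeasible Second"
        by (rule declared[OF \<omega>(1)]) simp
    qed
    then show ?thesis
    proof (rule two)
      fix t
      show "emeasure M (E (- 1) Infeasible t) \<le> ennreal (g_fun c (dof n0' n0'') \<eta>)"
      proof (rule emeasure_upper_exit_le[OF pd iid n c pos \<sigma>(2) _ refl E])
        fix \<omega> r
        \<comment> \<open>A mean of at most \<open>q - e\<close> leaves the statistic a drift of at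
          most minus the tolerance.\<close>
        have "real r * \<mu> $ l \<le> real r * (q - e)"
          using 1 by (intro mult_left_mono) auto
        then show "(\<Sum>j=1..r. ?x \<omega> j) - real r * (q + - 1 * e + - (- 1) * ?v \<omega> t)
          \<le> sgn \<sigma> * (\<Sum>j=1..r. ?x \<omega> j - \<mu> $ l) - real r * ?v \<omega> t"
          using \<sigma>(1) by (simp add: sum_subtractf algebra_simps del: tolerance.simps)
      next
        fix \<omega> assume "\<omega> \<in> E (- 1) Infeasible t"
        then show "\<exists>r\<ge>max n0'' 1. boundary c (real r) (?v \<omega> t) (h_sq c \<eta> (dof n0' n0'')) (pooled_var n0' n0'' (?x' \<omega>) (?x \<omega>))
           \<le> (\<Sum>j=1..r. ?x \<omega> j) - real r * (q + - 1 * e + - (- 1) * ?v \<omega> t) \<and>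
          (\<forall>r'. max n0'' 1 \<le> r' \<and> r' < r \<longrightarrow>
            \<bar>(\<Sum>j=1..r'. ?x \<omega> j) - real r' * (q + - 1 * e + - (- 1) * ?v \<omega> t)\<bar>
            < boundary c (real r') (?v \<omega> t) (h_sq c \<eta> (dof n0' n0'')) (pooled_var n0' n0'' (?x' \<omega>) (?x \<omega>)))"
          unfolding E_def by (blast dest: subroutine_stops_InfeasibleD)
      qed
    qed
  next
    case 2
    have "?bad \<subseteq> E 1 Feasible First \<union> E 1 Feasible Second"
    proof
      fix \<omega> assume "\<omega> \<in> ?bad"
      then have \<omega>: "\<omega> \<in> space M" "\<not> declares n0' n0'' c \<eta> \<nu> q e tie (?x' \<omega>) (?x \<omega>) Infeasible"
        using 2 pos by (auto simp: correct_decision_def)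
      from other[OF \<omega>(2)] obtain d where "d \<noteq> Infeasible" "declares n0' n0'' c \<eta> \<nu> q e tie (?x' \<omega>) (?x \<omega>) d"
        by blast
      then have "declares n0' n0'' c \<eta> \<nu> q e tie (?x' \<omega>) (?x \<omega>) Feasible"
        by (cases d) auto
      then show "\<omega> \<in> E 1 Feasible First \<union> E 1 Feasible Second"
        by (rule declared[OF \<omega>(1)]) simp
    qed
    then show ?thesis
    proof (rule two)
      fix t
      have \<sigma>': "(- \<sigma>)\<^sup>2 = \<Sigma> $ l $ l" using \<sigma> by simp
      show "emeasure M (E 1 Feasible t) \<le> ennreal (g_fun c (dof n0' n0'') \<eta>)"
      proof (rule emeasure_upper_exit_le[OF pd iid n c pos \<sigma>' _ refl E])
        fix \<omega> r
        have "real r * (q + e) \<le> real r * \<mu> $ l"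
          using 2 by (intro mult_left_mono) auto
        then show "- ((\<Sum>j=1..r. ?x \<omega> j) - real r * (q + 1 * e + - 1 * ?v \<omega> t))
          \<le> sgn (- \<sigma>) * (\<Sum>j=1..r. ?x \<omega> j - \<mu> $ l) - real r * ?v \<omega> t"
          using \<sigma>(1) by (simp add: sum_subtractf algebra_simps del: tolerance.simps)
      next
        fix \<omega> assume "\<omega> \<in> E 1 Feasible t"
        then show "\<exists>r\<ge>max n0'' 1. boundary c (real r) (?v \<omega> t) (h_sq c \<eta> (dof n0' n0'')) (pooled_var n0' n0'' (?x' \<omega>) (?x \<omega>))
           \<le> - ((\<Sum>j=1..r. ?x \<omega> j) - real r * (q + 1 * e + - 1 * ?v \<omega> t)) \<and>
          (\<forall>r'. max n0'' 1 \<le> r' \<and> r' < r \<longrightarrow>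
            \<bar>- ((\<Sum>j=1..r'. ?x \<omega> j) - real r' * (q + 1 * e + - 1 * ?v \<omega> t))\<bar>
            < boundary c (real r') (?v \<omega> t) (h_sq c \<eta> (dof n0' n0'')) (pooled_var n0' n0'' (?x' \<omega>) (?x \<omega>)))"
          unfolding E_def by (blast dest: subroutine_stops_FeasibleD)
      qed
    qed
  next
    case 3
    then have "?bad = {}" by (auto simp: correct_decision_def)
    then have "prob ?bad = 0" by (simp only: measure_empty)
    with g show ?thesis by simp
  qed
qed

section \<open>Combining the constraints and the systems\<close>

lemma measurable_correct_decision:
  fixes x' x :: "nat \<Rightarrow> 'a \<Rightarrow> real ^ 's::finite"
  assumes "\<And>j. j \<in> {1..n0'} \<Longrightarrow> x' j \<in> borel_measurable M" and "\<And>j. 1 \<le> j \<Longrightarrow> x j \<in> borel_measurable M"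
  shows "Measurable.pred M (\<lambda>\<omega>. correct_decision y q e
    (declares n0' n0'' c \<eta> \<nu> q e tie (\<lambda>j. x' j \<omega> $ l) (\<lambda>j. x j \<omega> $ l)))"
proof -
  have [measurable]: "Measurable.pred M (\<lambda>\<omega>. declares n0' n0'' c \<eta> \<nu> q e tie
      (\<lambda>j. x' j \<omega> $ l) (\<lambda>j. x j \<omega> $ l) d)" for d
    using assms by (intro measurable_declares measurable_compose[OF _ borel_measurable_nth])
  show ?thesis
    unfolding correct_decision_def by measurable
qed

theorem theorem2:
  fixes M :: "'a measure"
    and Y' Y :: "'k::finite \<Rightarrow> nat \<Rightarrow> 'a \<Rightarrow> real ^ 's::finite"
    and \<mu> :: "'k \<Rightarrow> real ^ 's"
    and \<Sigma> :: "'k \<Rightarrow> real ^ 's ^ 's"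
    and n0' n0'' c :: nat
    and \<alpha> \<nu> :: real
    and q \<epsilon> :: "'s \<Rightarrow> real"
    and tie :: "'k \<Rightarrow> 's \<Rightarrow> nat \<Rightarrow> decision \<Rightarrow> decision \<Rightarrow> phase"
  assumes "prob_space M"
    and "\<And>i. positive_definite (\<Sigma> i)"
    and "\<And>i. iid_mvn M (obs_index n0') (obs Y' Y i) (\<mu> i) (\<Sigma> i)"
    and "n0' \<ge> 2" and "n0'' \<noteq> 1"
    and "0 < \<alpha>" and "\<alpha> < 1"
    and "c \<ge> 1"
    and "1 / 2 < \<nu>" and "\<nu> \<le> 1"
    and "\<And>l. \<epsilon> l > 0"
  shows "(systems_independent M (obs_index n0') (obs Y' Y) \<longrightarrow>
           (\<forall>\<eta>>0. g_fun c (dof n0' n0'') \<eta> = beta_indep \<alpha> CARD('k) CARD('s) \<longrightarrow>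
              measure M (\<Inter>i. \<Inter>l. CD_event M Y' Y \<mu> n0' n0'' c \<eta> \<nu> q \<epsilon> tie i l) \<ge> 1 - \<alpha>)) \<and>
         (\<forall>\<eta>>0. g_fun c (dof n0' n0'') \<eta> = beta_dep \<alpha> CARD('k) CARD('s) \<longrightarrow>
              measure M (\<Inter>i. \<Inter>l. CD_event M Y' Y \<mu> n0' n0'' c \<eta> \<nu> q \<epsilon> tie i l) \<ge> 1 - \<alpha>)"
proof -
  interpret prob_space M by fact
  let ?J = "obs_index n0'" and ?k = "real CARD('k)" and ?s = "real CARD('s)"
  let ?CD = "\<lambda>\<eta> i l. CD_event M Y' Y \<mu> n0' n0'' c \<eta> \<nu> q \<epsilon> tie i l"
  have J: "Inl j \<in> ?J \<longleftrightarrow> j \<in> {1..n0'}" "Inr j \<in> ?J \<longleftrightarrow> 1 \<le> j" for j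
    by (auto simp: obs_index_def)
  have rv: "random_variable borel (obs Y' Y i p)" if "p \<in> ?J" for i p
    using assms(3)[of i] that unfolding iid_mvn_def indep_vars_def by blast
  have CD_sets: "?CD \<eta> i l \<in> events" for \<eta> i l
  proof -
    have "j \<in> {1..n0'} \<Longrightarrow> random_variable borel (Y' i j)" "1 \<le> j \<Longrightarrow> random_variable borel (Y i j)" for j
      using rv[of "Inl j" i] rv[of "Inr j" i] by (simp_all add: J obs_def)
    from measurable_correct_decision[of n0' "Y' i" M "Y i", OF this] show ?thesis
      unfolding CD_event_def by (simp add: pred_def)
  qed
  have CD: "prob (space M - ?CD \<eta> i l) \<le> 2 * \<beta>"
    if "0 < \<eta>" "g_fun c (dof n0' n0'') \<eta> = \<beta>" "0 \<le> \<beta>" for \<eta> \<beta> i l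
  proof -
    have "space M - ?CD \<eta> i l = {\<omega> \<in> space M. \<not> correct_decision (\<mu> i $ l) (q l) (\<epsilon> l)
        (declares n0' n0'' c \<eta> \<nu> (q l) (\<epsilon> l) (tie i l) (\<lambda>j. Y' i j \<omega> $ l) (\<lambda>j. Y i j \<omega> $ l))}"
      unfolding CD_event_def by blast
    then show ?thesis
      using prob_incorrect_le[of "\<Sigma> i" n0' "Y' i" "Y i" "\<mu> i" n0'' c \<nu> "\<epsilon> l" \<eta> l "q l" "tie i l"] assms that
      by (simp add: obs_def)
  qed
  show ?thesis
  proof (intro conjI impI allI)
    fix \<eta> :: real
    assume indep: "systems_independent M ?J (obs Y' Y)" and \<eta>: "0 < \<eta>"
      and g: "g_fun c (dof n0' n0'') \<eta> = beta_indep \<alpha> CARD('k) CARD('s)"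
    \<comment> \<open>\<gamma> is the target for one system: over all systems it multiplies up to 1
      - \<alpha>. The error 1 - \<gamma> of a system is shared by its constraints, each of which
      gets \<open>2 * \<beta>\<close>, one \<beta> per tolerance.\<close>
    define \<gamma> where "\<gamma> = (1 - \<alpha>) powr (1 / ?k)"
    define \<beta> where "\<beta> = beta_indep \<alpha> CARD('k) CARD('s)"
    have \<gamma>: "0 \<le> \<gamma>" "\<gamma> \<le> 1"
      using assms(6,7) powr_mono2[of "1 / ?k" "1 - \<alpha>" 1] by (auto simp: \<gamma>_def)
    have \<beta>: "0 \<le> \<beta>" "?s * (2 * \<beta>) = 1 - \<gamma>"
      using \<gamma> by (auto simp: \<beta>_def beta_indep_def \<gamma>_def)
    \<comment> \<open>Independence of the systems concerns their restricted families as random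
      elements of the product space, so the event has to be written as a preimage of a set
      there.\<close>
    define B where "B i = {w \<in> space (PiM ?J (\<lambda>_. borel)). \<forall>l. correct_decision (\<mu> i $ l) (q l) (\<epsilon> l)
      (declares n0' n0'' c \<eta> \<nu> (q l) (\<epsilon> l) (tie i l) (\<lambda>j. w (Inl j) $ l) (\<lambda>j. w (Inr j) $ l))}" for i
    have B: "B i \<in> sets (PiM ?J (\<lambda>_. borel))" for i
    proof -
      have "Measurable.pred (PiM ?J (\<lambda>_. borel)) (\<lambda>w :: nat + nat \<Rightarrow> real ^ 's. \<forall>l. correct_decision (\<mu> i $ l) (q l) (\<epsilon> l)
        (declares n0' n0'' c \<eta> \<nu> (q l) (\<epsilon> l) (tie i l) (\<lambda>j. w (Inl j) $ l) (\<lambda>j. w (Inr j) $ l)))"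
        by (intro pred_intros_countable measurable_correct_decision measurable_component_singleton) (simp_all add: J)
      then show ?thesis
        unfolding B_def by (simp add: pred_def)
    qed
    have BCD: "(\<lambda>\<omega>. \<lambda>p\<in>?J. obs Y' Y i p \<omega>) -` B i \<inter> space M = (\<Inter>l. ?CD \<eta> i l)" for i
    proof -
      have "(\<lambda>p\<in>?J. obs Y' Y i p \<omega>) \<in> space (PiM ?J (\<lambda>_. borel))" for \<omega>
        by (simp add: space_PiM)
      moreover have "declares n0' n0'' c \<eta> \<nu> (q l) (\<epsilon> l) (tie i l)
          (\<lambda>j. (\<lambda>p\<in>?J. obs Y' Y i p \<omega>) (Inl j) $ l) (\<lambda>j. (\<lambda>p\<in>?J. obs Y' Y i p \<omega>) (Inr j) $ l)
        = declares n0' n0'' c \<eta> \<nu> (q l) (\<epsilon> l) (tie i l) (\<lambda>j. Y' i j \<omega> $ l) (\<lambda>j. Y i j \<omega> $ l)" for \<omega> l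
        by (intro ext declares_cong) (simp_all add: J obs_def)
      ultimately show ?thesis
        unfolding B_def CD_event_def by auto
    qed
    have "\<gamma> \<le> prob (\<Inter>l. ?CD \<eta> i l)" for i
    proof -
      have "prob (space M - (\<Inter>l. ?CD \<eta> i l)) = prob (\<Union>l. space M - ?CD \<eta> i l)"
        by (rule arg_cong[where f=prob]) auto
      also have "\<dots> \<le> (\<Sum>l\<in>UNIV. prob (space M - ?CD \<eta> i l))"
        using CD_sets by (intro finite_measure_subadditive_finite) auto
      also have "\<dots> \<le> (\<Sum>l\<in>(UNIV::'s set). 2 * \<beta>)"
        using \<eta> g \<beta>(1) by (intro sum_mono CD) (auto simp: \<beta>_def)
      also have "\<dots> = 1 - \<gamma>"
        using \<beta>(2) by simp
      finally show ?thesis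
        using CD_sets by (subst (asm) prob_compl) auto
    qed
    then have "(\<Prod>i\<in>(UNIV::'k set). \<gamma>) \<le> (\<Prod>i\<in>UNIV. prob (\<Inter>l. ?CD \<eta> i l))"
      using \<gamma> by (intro prod_mono) auto
    also have "\<dots> = prob (\<Inter>i. \<Inter>l. ?CD \<eta> i l)"
      using indep_varsD_finite[OF indep[unfolded systems_independent_def], of B] B by (simp add: BCD)
    also have "(\<Prod>i\<in>(UNIV::'k set). \<gamma>) = 1 - \<alpha>"
      using assms(7) by (simp add: \<gamma>_def powr_power)
    finally show "1 - \<alpha> \<le> prob (\<Inter>i. \<Inter>l. ?CD \<eta> i l)" .
  next
    fix \<eta> :: real
    assume \<eta>: "0 < \<eta>" and g: "g_fun c (dof n0' n0'') \<eta> = beta_dep \<alpha> CARD('k) CARD('s)"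
    define \<beta> where "\<beta> = beta_dep \<alpha> CARD('k) CARD('s)"
    have \<beta>: "0 \<le> \<beta>" "?k * ?s * (2 * \<beta>) = \<alpha>"
      using assms(6) by (auto simp: \<beta>_def beta_dep_def)
    \<comment> \<open>Without independence the product over systems is replaced by a union bound
      over all pairs of a system and a constraint.\<close>
    have "prob (space M - (\<Inter>i. \<Inter>l. ?CD \<eta> i l)) = prob (\<Union>(i, l)\<in>UNIV. space M - ?CD \<eta> i l)"
      by (rule arg_cong[where f=prob]) auto
    also have "\<dots> \<le> (\<Sum>(i, l)\<in>UNIV. prob (space M - ?CD \<eta> i l))"
      using CD_sets finite_measure_subadditive_finite[of UNIV "\<lambda>(i, l). space M - ?CD \<eta> i l"]
      by (auto simp: case_prod_beta image_subset_iff)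
    also have "\<dots> \<le> (\<Sum>(i, l)\<in>(UNIV::('k \<times> 's) set). 2 * \<beta>)"
      using \<eta> g \<beta>(1) CD by (intro sum_mono) (auto simp: \<beta>_def)
    also have "\<dots> = \<alpha>"
      using \<beta>(2) by (simp add: case_prod_beta card_prod)
    finally show "1 - \<alpha> \<le> prob (\<Inter>i. \<Inter>l. ?CD \<eta> i l)"
      using CD_sets by (subst (asm) prob_compl) auto
  qed
qed

end
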